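(* Given $1<p\le\infty$ and a matrix weight $W\in\mathcal{A}_p$ on $\mathbb{R}^n$, the convex-set valued maximal operator satisfies $M:L^p_{\mathcal{K}}(\mathbb{R}^n,W)\to L^p_{\mathcal{K}}(\mathbb{R}^n,W)$. Moreover, for all $F\in L^p_{\mathcal{K}}(\mathbb{R}^n,W)$, $$\|MF\|_{L^p_{\mathcal{K}}(\mathbb{R}^n,W)}\le C(n,d,p)\,[W]_{\mathcal{A}_p}^{p'}\,\|F\|_{L^p_{\mathcal{K}}(\mathbb{R}^n,W)} .$$
   Context: $\mathcal{K}_{bcs}(\mathbb{R}^d)$: nonempty closed, bounded, convex, symmetric ($-K=K$) subsets of $\mathbb{R}^d$. $F:\mathbb{R}^n\to\mathcal{K}_{bcs}(\mathbb{R}^d)$ is measurable if $\{x:F(x)\cap U\ne\emptyset\}$ is measurable for each open $U$. $|K|=\sup\{|v|:v\in K\}$. A matrix weight is a measurable map $W$ from $\mathbb{R}^n$ into the $d\times d$ real symmetric positive semidefinite matrices, positive definite a.e. $L^p_{\mathcal{K}}(\mathbb{R}^n,W)$ is the set of measurable $F:\mathbb{R}^n\to\mathcal{K}_{bcs}(\mathbb{R}^d)$ with $\|F\|_{L^p_{\mathcal{K}}(\mathbb{R}^n,W)}=\big(\int_{\mathbb{R}^n}|W(x)F(x)|^p\,dx\big)^{1/p}<\infty$ (ess sup of $|W(x)F(x)|$ if $p=\infty$); functions are identified when equal a.e., so values need lie in $\mathcal{K}_{bcs}(\mathbb{R}^d)$ only a.e. The Aumann integral is $\int_QF\,dy=\{\int_Qf\,dy:f\in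 L^1(Q,\mathbb{R}^d),\ f(y)\in F(y)\text{ a.e.}\}$. For a cube $Q$ (sides parallel to the axes), $A_QF(x)=\frac{1}{|Q|}\int_QF(y)\,dy$ if $x\in Q$ and $\{0\}$ otherwise, and $MF(x)=\overline{\mathrm{conv}}\big(\bigcup_QA_QF(x)\big)$ (closed convex hull, union over all cubes). With $|\cdot|_{\mathrm{op}}$ the operator norm and $1/p+1/p'=1$: for $1<p<\infty$, $W\in\mathcal{A}_p$ means $$[W]_{\mathcal{A}_p}=\sup_Q\Big(\frac{1}{|Q|}\int_Q\Big(\frac{1}{|Q|}\int_Q|W(x)W^{-1}(y)|_{\mathrm{op}}^{p'}\,dy\Big)^{p/p'}dx\Big)^{1/p}<\infty ;$$ $W\in\mathcal{A}_\infty$ means $[W]_{\mathcal{A}_\infty}=\sup_Q\operatorname{ess\,sup}_{x\in Q}\frac{1}{|Q|}\int_Q|W(x)W^{-1}(y)|_{\mathrm{op}}\,dy<\infty$ (and $p'=1$ when $p=\infty$). *)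

theory Defs
  imports "HOL-Analysis.Analysis" "HOL-Probability.Essential_Supremum"
begin

text \<open>
  The dimensions are \<open>n = CARD('n)\<close> and \<open>d = CARD('d)\<close>. Norms and weight constants take values
  in \<^typ>\<open>ennreal\<close>, so suprema and integrals of nonnegative functions need no finiteness
  assumptions. Measurability is with respect to the completed Lebesgue measure.
\<close>

subsection \<open>Extended nonnegative numbers and exponents\<close>

text \<open>Used for exponents \<open>a > 0\<close> only.\<close>

definition ennpowr :: "ennreal \<Rightarrow> real \<Rightarrow> ennreal" where
  "ennpowr x a = (if x = \<infinity> then \<infinity> else ennreal (enn2real x powr a))"

text \<open>For \<open>1 < p \<le> \<infinity>\<close> the conjugate exponent is finite, hence a real number.\<close>

definition conj_exp :: "ennreal \<Rightarrow> real" where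
  "conj_exp p = (if p = \<infinity> then 1 else enn2real p / (enn2real p - 1))"

subsection \<open>Convex-set valued functions\<close>

definition Kbcs :: "(real^'d) set set" where
  "Kbcs = {K. K \<noteq> {} \<and> closed K \<and> bounded K \<and> convex K \<and> uminus ` K = K}"

definition set_measurable :: "(real^'n \<Rightarrow> (real^'d) set) \<Rightarrow> bool" where
  "set_measurable F \<longleftrightarrow> (\<forall>U. open U \<longrightarrow> {x. F x \<inter> U \<noteq> {}} \<in> sets lebesgue)"

definition set_norm :: "(real^'d) set \<Rightarrow> ennreal" where
  "set_norm K = (SUP v\<in>K. ennreal (norm v))"

definition LpK_norm ::
  "ennreal \<Rightarrow> (real^'n \<Rightarrow> real^'d^'d) \<Rightarrow> (real^'n \<Rightarrow> (real^'d) set) \<Rightarrow> ennreal" where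
  "LpK_norm p W F =
     (if p = \<infinity> then esssup lebesgue (\<lambda>x. set_norm ((\<lambda>v. W x *v v) ` F x))
      else ennpowr (\<integral>\<^sup>+ x. ennpowr (set_norm ((\<lambda>v. W x *v v) ` F x)) (enn2real p) \<partial>lebesgue)
             (1 / enn2real p))"

text \<open>Functions are identified when equal almost everywhere, so values are only required to lie
  in \<open>Kbcs\<close> almost everywhere.\<close>

definition LpK ::
  "ennreal \<Rightarrow> (real^'n \<Rightarrow> real^'d^'d) \<Rightarrow> (real^'n \<Rightarrow> (real^'d) set) set" where
  "LpK p W = {F. set_measurable F \<and> (AE x in lebesgue. F x \<in> Kbcs) \<and> LpK_norm p W F < \<infinity>}"

subsection \<open>The maximal operator\<close>

definition cubes :: "(real^'n) set set" where
  "cubes = {cbox a (\<chi> i. a $ i + l) | a l. l > 0}"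

definition aumann_integral :: "(real^'n) set \<Rightarrow> (real^'n \<Rightarrow> (real^'d) set) \<Rightarrow> (real^'d) set" where
  "aumann_integral Q F =
     {integral\<^sup>L (lebesgue_on Q) f | f.
        integrable (lebesgue_on Q) f \<and> (AE y in lebesgue_on Q. f y \<in> F y)}"

definition avg_op ::
  "(real^'n) set \<Rightarrow> (real^'n \<Rightarrow> (real^'d) set) \<Rightarrow> real^'n \<Rightarrow> (real^'d) set" where
  "avg_op Q F x =
     (if x \<in> Q then (\<lambda>v. (1 / measure lebesgue Q) *\<^sub>R v) ` aumann_integral Q F else {0})"

definition maximal_op :: "(real^'n \<Rightarrow> (real^'d) set) \<Rightarrow> real^'n \<Rightarrow> (real^'d) set" where
  "maximal_op F x = closure (convex hull (\<Union>Q\<in>cubes. avg_op Q F x))"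

subsection \<open>Matrix weights\<close>

definition pos_semidef :: "real^'d^'d \<Rightarrow> bool" where
  "pos_semidef A \<longleftrightarrow> transpose A = A \<and> (\<forall>v. 0 \<le> v \<bullet> (A *v v))"

definition pos_def :: "real^'d^'d \<Rightarrow> bool" where
  "pos_def A \<longleftrightarrow> transpose A = A \<and> (\<forall>v. v \<noteq> 0 \<longrightarrow> 0 < v \<bullet> (A *v v))"

definition matrix_weight :: "(real^'n \<Rightarrow> real^'d^'d) \<Rightarrow> bool" where
  "matrix_weight W \<longleftrightarrow>
     W \<in> borel_measurable lebesgue \<and> (\<forall>x. pos_semidef (W x)) \<and> (AE x in lebesgue. pos_def (W x))"

definition op_norm :: "real^'d^'d \<Rightarrow> ennreal" where
  "op_norm A = ennreal (onorm (\<lambda>v. A *v v))"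

definition navg :: "(real^'n) set \<Rightarrow> (real^'n \<Rightarrow> ennreal) \<Rightarrow> ennreal" where
  "navg Q g = (\<integral>\<^sup>+ y\<in>Q. g y \<partial>lebesgue) / emeasure lebesgue Q"

text \<open>For a matrix weight, \<open>W y\<close> is invertible for almost every \<open>y\<close>; the unspecified value of
  \<^const>\<open>matrix_inv\<close> at the remaining points does not affect the integrals.\<close>

definition Ap_const :: "ennreal \<Rightarrow> (real^'n \<Rightarrow> real^'d^'d) \<Rightarrow> ennreal" where
  "Ap_const p W =
     (if p = \<infinity> then
        (SUP Q\<in>cubes. esssup (lebesgue_on Q)
           (\<lambda>x. navg Q (\<lambda>y. op_norm (W x ** matrix_inv (W y)))))
      else
        (SUP Q\<in>cubes. ennpowr
           (navg Q (\<lambda>x. ennpowr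
              (navg Q (\<lambda>y. ennpowr (op_norm (W x ** matrix_inv (W y))) (conj_exp p)))
              (enn2real p / conj_exp p)))
           (1 / enn2real p)))"

definition Ap_weight :: "ennreal \<Rightarrow> (real^'n \<Rightarrow> real^'d^'d) \<Rightarrow> bool" where
  "Ap_weight p W \<longleftrightarrow> matrix_weight W \<and> Ap_const p W < \<infinity>"

end

theory Submission
  imports Defs
begin

text \<open>
  Since \<open>|W(x) A\<^sub>Q F(x)|\<close> is at most the average over \<open>Q\<close> of \<open>|W(x) W\<^sup>-\<^sup>1(y)| |W(y) F(y)|\<close>, the theorem reduces to a
  scalar function \<open>g = |W F|\<close>. For \<open>p = \<infinity>\<close> this is immediate. For \<open>p < \<infinity>\<close> the one-third trick reduces it to dyadic
  cubes. Put \<open>r = p'\<close>, let \<open>\<phi>\<^sub>Q(v)\<close> be the average of \<open>|W\<^sup>-\<^sup>1 v|\<^sup>r\<close> over \<open>Q\<close>, let \<open>N\<^sub>Q(x)\<close> be the sum of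
  \<open>\<phi>\<^sub>Q(W(x) e\<^sub>i)\<close> over the standard basis, and let \<open>a\<^sub>Q\<close> be the supremum of the averages of \<open>|W\<^sup>-\<^sup>1 v| g\<close> over
  \<open>\<phi>\<^sub>Q(v) \<le> 1\<close>. By duality the maximal function is pointwise dominated by a multiple of the supremum over
  \<open>Q \<ni> x\<close> of \<open>N\<^sub>Q(x)\<^sup>1\<^sup>/\<^sup>r a\<^sub>Q\<close>. Goldberg's stopping-time argument shows that the factors \<open>N\<^sub>Q\<close> cost only \<open>[W]\<close>.
  The scalar weights \<open>|W\<^sup>-\<^sup>1 v|\<^sup>r\<close> are \<open>A\<^sub>\<infinity>\<close> with constant of order \<open>[W]\<^sup>r\<close>, so the sharp reverse Hoelder inequality
  replaces \<open>a\<^sub>Q\<close> by \<open>L\<^sup>s\<close> averages of \<open>g\<close> with \<open>p - s\<close> of order \<open>[W]\<^sup>-\<^sup>r\<close>, which costs \<open>[W]\<^sup>r\<^sup>/\<^sup>p\<close>. Finally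
  \<open>1 + r / p = r\<close>.
\<close>

section \<open>Dyadic grids and the reverse Hoelder inequality\<close>

text \<open>The factor \<open>N Q x\<close> depends both on the cube and on the point, so no
  covering argument applies to the product directly. Level families separate the two: membership of
  a cube depends on its supremum a_Q alone, and Goldberg's bound is proved for arbitrary families,
  with the measure of the union on the right. That measure is a scalar quantity, for which the gain
  from p to s < p replaces interpolation. With \<open>B\<close> of order [W]^p, the first ingredient
  costs \<open>B\<close> and the second 1 / (p - s), at most of order \<open>B powr (r - 1)\<close>;
  the total \<open>B powr r\<close> is of order [W]^(p r) before the p-th root. Grids have a
  coarsest generation, so that maximal cubes exist without any decay of averages over large cubes.
  All cubes are reached by letting the coarsest side grow and applying Fatou's lemma to the
  majorants.\<close>

abbreviation leb :: "'a::euclidean_space set \<Rightarrow> ennreal" where "leb \<equiv> emeasure lebesgue"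

abbreviation vol :: "'a::euclidean_space set \<Rightarrow> real" where "vol \<equiv> measure lebesgue"

text \<open>\<open>q k x\<close> is the cell of generation \<open>k\<close> around \<open>x\<close>.
  Indexing by naturals provides a coarsest generation, hence maximal cells; \<open>D\<close> bounds
  the volume ratio of a cell to its child. Equal cells in consecutive generations are
  allowed.\<close>

locale dyadic_grid =
  fixes q :: "nat \<Rightarrow> 'a::euclidean_space \<Rightarrow> 'a set" and D :: real
  assumes q_mem: "x \<in> q k x"
    and q_eq: "y \<in> q k x \<Longrightarrow> q k y = q k x"
    and q_nest: "q (Suc k) x \<subseteq> q k x"
    and q_lmeasurable: "q k x \<in> lmeasurable"
    and q_pos: "0 < vol (q k x)"
    and q_doubling: "vol (q k x) \<le> D * vol (q (Suc k) x)"
    and q_countable: "countable (range (q k))"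
    and q_small: "open U \<Longrightarrow> x \<in> U \<Longrightarrow> \<exists>k. q k x \<subseteq> U"
begin

definition grid :: "'a set set" where
  "grid = (\<Union>k. range (q k))"

definition maximal_in :: "'a set set \<Rightarrow> 'a set \<Rightarrow> bool" where
  "maximal_in S Q \<longleftrightarrow> Q \<in> S \<and> (\<forall>P\<in>S. Q \<subseteq> P \<longrightarrow> P = Q)"

lemma countable_grid: "countable grid"
  unfolding grid_def by (intro countable_UN q_countable) auto

lemma countable_subgrid: "S \<subseteq> grid \<Longrightarrow> countable S"
  using countable_grid countable_subset by blast

lemma q_in_grid: "q k x \<in> grid"
  unfolding grid_def by auto

lemma q_antimono: "i \<le> k \<Longrightarrow> q k x \<subseteq> q i x"
  using lift_Suc_antimono_le[of "\<lambda>k. q k x"] q_nest by blast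

lemma grid_ex_q: assumes "Q \<in> grid" "x \<in> Q" shows "\<exists>k. Q = q k x"
  using assms q_eq unfolding grid_def by blast

lemma grid_sets [measurable]: "Q \<in> grid \<Longrightarrow> Q \<in> sets lebesgue"
  unfolding grid_def using q_lmeasurable by auto

lemma grid_emeasure: assumes "Q \<in> grid"
  shows "leb Q = ennreal (vol Q)" "0 < vol Q"
proof -
  obtain k x where "Q = q k x" using assms unfolding grid_def by auto
  then show "leb Q = ennreal (vol Q)" "0 < vol Q"
    using q_lmeasurable q_pos by (auto simp: emeasure_eq_measure2)
qed

lemma grid_cases: assumes "Q \<in> grid" "R \<in> grid" "x \<in> Q" "x \<in> R"
  shows "Q \<subseteq> R \<or> R \<subseteq> Q"
proof -
  obtain i j where "Q = q i x" "R = q j x" using grid_ex_q assms by metis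
  then show ?thesis using q_antimono by (metis nle_le)
qed

text \<open>The members of \<open>S\<close> through a point of \<open>Q\<close> form a chain indexed
  by generations; the earliest generation that occurs in \<open>S\<close> gives the largest of
  them.\<close>

lemma ex_maximal:
  assumes S: "S \<subseteq> grid" and Q: "Q \<in> S"
  shows "\<exists>P. maximal_in S P \<and> Q \<subseteq> P"
proof -
  obtain k x where Qk: "Q = q k x" using S Q unfolding grid_def by auto
  define j where "j = (LEAST j. q j x \<in> S)"
  have j: "q j x \<in> S" "j \<le> k"
    unfolding j_def using Q Qk by (auto intro: LeastI Least_le)
  have "P = q j x" if P: "P \<in> S" "q j x \<subseteq> P" for P
  proof -
    obtain i where i: "P = q i x" using grid_ex_q[of P x] S P q_mem[of x j] by blast
    then have "j \<le> i" using P unfolding j_def by (auto intro: Least_le)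
    then show ?thesis using i P(2) q_antimono[of j i x] by blast
  qed
  then have "maximal_in S (q j x)" unfolding maximal_in_def using j by auto
  then show ?thesis using q_antimono[OF j(2)] Qk by blast
qed

lemma maximal_inside:
  assumes S: "S \<subseteq> grid" and P: "maximal_in S P" and R: "R \<in> S" "x \<in> R" "x \<in> P"
  shows "R \<subseteq> P"
proof -
  have "P \<in> S" using P unfolding maximal_in_def by simp
  then have "P \<subseteq> R \<or> R \<subseteq> P" using grid_cases[of P R x] S R by (simp add: subset_iff)
  then show ?thesis using P R unfolding maximal_in_def by auto
qed

lemma maximal_disjoint:
  assumes S: "S \<subseteq> grid" and P: "maximal_in S P" and Q: "maximal_in S Q" and "P \<noteq> Q"
  shows "P \<inter> Q = {}"
proof (rule ccontr)
  assume "P \<inter> Q \<noteq> {}"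
  then obtain x where x: "x \<in> P" "x \<in> Q" by auto
  have "P \<in> S" "Q \<in> S" using P Q unfolding maximal_in_def by simp_all
  then have "Q \<subseteq> P" "P \<subseteq> Q" using maximal_inside[OF S P _ x(2,1)] maximal_inside[OF S Q _ x] by simp_all
  then show False using \<open>P \<noteq> Q\<close> by simp
qed

lemma Union_maximal: assumes S: "S \<subseteq> grid" shows "\<Union>S = \<Union>(Collect (maximal_in S))"
proof
  show "\<Union>S \<subseteq> \<Union>(Collect (maximal_in S))"
  proof
    fix x assume "x \<in> \<Union>S"
    then obtain Q where Q: "Q \<in> S" "x \<in> Q" by auto
    obtain P where "maximal_in S P" "Q \<subseteq> P" using ex_maximal[OF S Q(1)] by auto
    then show "x \<in> \<Union>(Collect (maximal_in S))" using Q by auto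
  qed
qed (auto simp: maximal_in_def)

lemma Union_grid_sets [measurable]: "S \<subseteq> grid \<Longrightarrow> \<Union>S \<in> sets lebesgue"
  using countable_subgrid grid_sets by (intro sets.countable_Union) auto

lemma nn_integral_Union_maximal:
  assumes S: "S \<subseteq> grid" and f [measurable]: "f \<in> borel_measurable lebesgue"
  shows "(\<integral>\<^sup>+x\<in>\<Union>S. f x \<partial>lebesgue) =
         (\<integral>\<^sup>+Q. (\<integral>\<^sup>+x\<in>Q. f x \<partial>lebesgue) \<partial>count_space (Collect (maximal_in S)))"
proof -
  let ?I = "Collect (maximal_in S)"
  have I: "?I \<subseteq> grid" using S unfolding maximal_in_def by auto
  have m: "X \<in> sets lebesgue" if "X \<in> ?I" for X using I that grid_sets by blast
  have "(\<integral>\<^sup>+x\<in>\<Union>S. f x \<partial>lebesgue) = emeasure (density lebesgue f) (\<Union>S)"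
    using Union_grid_sets[OF S] by (simp add: emeasure_density)
  also have "\<dots> = emeasure (density lebesgue f) (\<Union>Q\<in>?I. Q)"
    using Union_maximal[OF S] by simp
  also have "\<dots> = (\<integral>\<^sup>+Q. emeasure (density lebesgue f) Q \<partial>count_space ?I)"
    using countable_subgrid[OF I] m maximal_disjoint[OF S]
    by (intro emeasure_UN_countable) (auto simp: disjoint_family_on_def)
  also have "\<dots> = (\<integral>\<^sup>+Q. (\<integral>\<^sup>+x\<in>Q. f x \<partial>lebesgue) \<partial>count_space ?I)"
    using m by (intro nn_integral_cong) (simp add: emeasure_density)
  finally show ?thesis .
qed

text \<open>Maximal members are disjoint and exhaust the union, so an inequality on each of them
  adds up. The covering estimates below rest on this.\<close>

lemma cover_le:
  assumes S: "S \<subseteq> grid" and f: "f \<in> borel_measurable lebesgue" and g: "g \<in> borel_measurable lebesgue"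
    and le: "\<And>Q. maximal_in S Q \<Longrightarrow> (\<integral>\<^sup>+x\<in>Q. f x \<partial>lebesgue) \<le> (\<integral>\<^sup>+x\<in>Q. g x \<partial>lebesgue)"
  shows "(\<integral>\<^sup>+x\<in>\<Union>S. f x \<partial>lebesgue) \<le> (\<integral>\<^sup>+x\<in>\<Union>S. g x \<partial>lebesgue)"
  unfolding nn_integral_Union_maximal[OF S f] nn_integral_Union_maximal[OF S g]
  by (rule nn_integral_mono) (use le in simp)

text \<open>A one-sided form of Lebesgue differentiation, by covering. Let \<open>B\<close> be the
  exceptional set. Cells in \<open>Q0\<close> that meet \<open>B\<close> have average at most
  \<open>c\<close>; those inside an open \<open>T\<close> barely larger than \<open>B\<close> cover
  \<open>B\<close>, so the integral of \<open>f\<close> over \<open>B\<close> is at most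
  \<open>c\<close> times the measure of \<open>T\<close>. Hence \<open>f - c\<close>, which is
  positive on \<open>B\<close>, has integral zero there.\<close>

lemma AE_exceeds_some_average:
  fixes f :: "'a \<Rightarrow> ennreal"
  assumes f [measurable]: "f \<in> borel_measurable lebesgue"
    and Q0: "Q0 \<in> grid" and c: "c < \<infinity>"
    and fin: "(\<integral>\<^sup>+x\<in>Q0. f x \<partial>lebesgue) < \<infinity>"
  shows "AE x in lebesgue. x \<in> Q0 \<longrightarrow> c < f x \<longrightarrow>
    (\<exists>Q\<in>grid. Q \<subseteq> Q0 \<and> x \<in> Q \<and> c * leb Q < (\<integral>\<^sup>+y\<in>Q. f y \<partial>lebesgue))"
proof -
  define S where "S = {Q\<in>grid. Q \<subseteq> Q0 \<and> c * leb Q < (\<integral>\<^sup>+y\<in>Q. f y \<partial>lebesgue)}"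
  have S: "S \<subseteq> grid" unfolding S_def by auto
  note [measurable] = Union_grid_sets[OF S] grid_sets[OF Q0]
  define B where "B = {x\<in>Q0. c < f x} - \<Union>S"
  have B_eq: "B = (Q0 \<inter> {x\<in>space lebesgue. c < f x}) - \<Union>S" unfolding B_def by auto
  have Bm [measurable]: "B \<in> sets lebesgue" unfolding B_eq by measurable
  have BQ: "B \<subseteq> Q0" unfolding B_def by auto
  have Bfin: "leb B < \<infinity>"
    using emeasure_mono[OF BQ grid_sets[OF Q0]] grid_emeasure[OF Q0]
    by (metis ennreal_less_top infinity_ennreal_def le_less_trans)
  have bound: "(\<integral>\<^sup>+x\<in>B. f x \<partial>lebesgue) \<le> c * leb B + c * ennreal e" if e: "e > 0" for e :: real
  proof -
    obtain T where T: "open T" "B \<subseteq> T" "T - B \<in> lmeasurable" "leb (T - B) < ennreal e"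
      using sets_lebesgue_outer_open[OF Bm e] by blast
    define R where "R = {Q\<in>grid. Q \<subseteq> Q0 \<and> Q \<subseteq> T \<and> Q \<inter> B \<noteq> {}}"
    have R: "R \<subseteq> grid" unfolding R_def by auto
    note [measurable] = Union_grid_sets[OF R]
    have cov: "B \<subseteq> \<Union>R"
    proof
      fix x assume x: "x \<in> B"
      obtain k where k: "q k x \<subseteq> T" using q_small[of T x] T x by auto
      obtain k0 where k0: "Q0 = q k0 x" using grid_ex_q[OF Q0, of x] x BQ by auto
      have "q (max k k0) x \<in> R"
        unfolding R_def using q_antimono[of k "max k k0" x] q_antimono[of k0 "max k k0" x] k k0 x q_mem[of x "max k k0"] q_in_grid[of "max k k0" x]
        by auto
      then show "x \<in> \<Union>R" using q_mem[of x "max k k0"] by blast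
    qed
    have le: "(\<integral>\<^sup>+x\<in>Q. f x \<partial>lebesgue) \<le> (\<integral>\<^sup>+x\<in>Q. c \<partial>lebesgue)" if "maximal_in R Q" for Q
    proof -
      have "Q \<in> R" using that unfolding maximal_in_def by auto
      then have "Q \<notin> S" "Q \<in> grid" "Q \<subseteq> Q0" unfolding R_def B_def by auto
      then have "(\<integral>\<^sup>+x\<in>Q. f x \<partial>lebesgue) \<le> c * leb Q" unfolding S_def by auto
      then show ?thesis using grid_sets[OF \<open>Q \<in> grid\<close>] by (simp add: nn_integral_cmult_indicator)
    qed
    have "(\<integral>\<^sup>+x\<in>B. f x \<partial>lebesgue) \<le> (\<integral>\<^sup>+x\<in>\<Union>R. f x \<partial>lebesgue)"
      using cov by (rule nn_set_integral_set_mono)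
    also have "\<dots> \<le> (\<integral>\<^sup>+x\<in>\<Union>R. c \<partial>lebesgue)" by (rule cover_le[OF R f _ le]) auto
    also have "\<dots> = c * leb (\<Union>R)" by (simp add: nn_integral_cmult_indicator)
    also have "\<dots> \<le> c * leb (B \<union> (T - B))"
      by (intro mult_left_mono emeasure_mono) (use T R_def in auto)
    also have "\<dots> \<le> c * (leb B + leb (T - B))"
      by (intro mult_left_mono emeasure_subadditive) (use T in auto)
    also have "\<dots> \<le> c * (leb B + ennreal e)"
      using T(4) by (intro mult_left_mono add_left_mono) auto
    finally show ?thesis by (simp add: distrib_left)
  qed
  obtain c' where c': "c = ennreal c'" "c' \<ge> 0" using c by (cases c) auto
  have le: "(\<integral>\<^sup>+x\<in>B. f x \<partial>lebesgue) \<le> c * leb B"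
  proof (rule ennreal_le_epsilon)
    fix e :: real assume e: "e > 0"
    have "(\<integral>\<^sup>+x\<in>B. f x \<partial>lebesgue) \<le> c * leb B + c * ennreal (e / (c' + 1))"
      by (rule bound) (use c' e in auto)
    also have "c * ennreal (e / (c' + 1)) \<le> ennreal e"
      unfolding c' using c' e by (subst ennreal_mult[symmetric]) (auto simp: field_simps intro!: ennreal_leI)
    finally show "(\<integral>\<^sup>+x\<in>B. f x \<partial>lebesgue) \<le> c * leb B + ennreal e"
      by (simp add: add_left_mono)
  qed
  have "AE x in lebesgue. (f x - c) * indicator B x = 0"
  proof -
    have eq: "(\<integral>\<^sup>+x. c * indicator B x + (f x - c) * indicator B x \<partial>lebesgue) = (\<integral>\<^sup>+x\<in>B. f x \<partial>lebesgue)"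
      by (intro nn_integral_cong) (auto simp: indicator_def B_def less_imp_le add_diff_inverse_ennreal)
    have "c * leb B + (\<integral>\<^sup>+x. (f x - c) * indicator B x \<partial>lebesgue) \<le> c * leb B + 0"
      using le eq by (subst (asm) nn_integral_add) (auto simp: nn_integral_cmult_indicator)
    moreover have "c * leb B \<noteq> top"
      using c Bfin unfolding ennreal_mult_eq_top_iff infinity_ennreal_def by (metis less_irrefl)
    ultimately have "(\<integral>\<^sup>+x. (f x - c) * indicator B x \<partial>lebesgue) = 0"
      unfolding ennreal_add_left_cancel_le by simp
    then show ?thesis by (subst (asm) nn_integral_0_iff_AE) auto
  qed
  then show ?thesis
  proof eventually_elim
    case (elim x)
    have "x \<notin> B"
    proof
      assume x: "x \<in> B"
      then have "f x - c = 0" using elim by (simp add: indicator_def)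
      moreover have "c < f x" using x unfolding B_def by auto
      ultimately show False using diff_eq_0_iff_ennreal[of "f x" c] by auto
    qed
    then show ?case unfolding B_def S_def by blast
  qed
qed

end

section \<open>Layer-cake sums and the reverse Hoelder inequality\<close>

lemma geometric_suminf_ennreal:
  assumes "0 < x" "x \<le> (1::real)"
  shows "(\<Sum>k. ennreal (x * (1 - x) ^ k)) = 1"
proof -
  have "(\<lambda>k. x * (1 - x) ^ k) sums (x * (1 / (1 - (1 - x))))"
    using assms by (intro sums_mult geometric_sums) (simp add: abs_if)
  then have "(\<lambda>k. x * (1 - x) ^ k) sums 1" using assms by simp
  then show ?thesis using assms by (subst suminf_ennreal_eq) auto
qed

text \<open>A discrete layer-cake formula. If \<open>b ^ K < s \<le> b ^ (K + 1)\<close>, then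
  \<open>s powr e\<close> is at most the power of the upper end, which telescopes into 1 plus the
  jumps at the levels up to \<open>K\<close>; \<open>x\<close> lies in \<open>\<Omega> k\<close> for
  each of these.\<close>

lemma powr_le_level_sum:
  fixes \<Omega> :: "nat \<Rightarrow> 'a set"
  assumes b: "1 < b" and e: "0 < e" and s: "0 \<le> s"
    and lev: "\<And>k. b ^ k < s \<Longrightarrow> x \<in> \<Omega> k"
  shows "ennreal (s powr e) \<le>
    1 + (\<Sum>k. ennreal ((b powr e) ^ k * (b powr e - 1)) * indicator (\<Omega> k) x)"
proof (cases "s \<le> 1")
  case True
  then have "s powr e \<le> 1 powr e" using s e by (intro powr_mono2) auto
  then have "ennreal (s powr e) \<le> 1" by simp
  then show ?thesis by (simp add: add_increasing2)
next
  case False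
  let ?c = "b powr e"
  have c: "1 \<le> ?c" using b e by (simp add: ge_one_powr_ge_zero)
  obtain K where K: "b ^ K < s" "s \<le> b ^ Suc K"
  proof -
    obtain n where "s < b ^ n" using b real_arch_pow by blast
    then have ex: "\<exists>n. s \<le> b ^ n" by (auto intro: less_imp_le)
    define m where "m = (LEAST n. s \<le> b ^ n)"
    have m: "s \<le> b ^ m" unfolding m_def using ex by (rule LeastI_ex)
    then obtain K where "m = Suc K" using False by (cases m) auto
    moreover have "\<not> s \<le> b ^ K" using not_less_Least[of K "\<lambda>n. s \<le> b ^ n"] calculation m_def by auto
    ultimately show ?thesis using that[of K] m by auto
  qed
  have pw: "(b ^ k) powr e = ?c ^ k" for k
    using b by (simp add: powr_powr powr_realpow[symmetric] mult.commute)
  have "s powr e \<le> (b ^ Suc K) powr e" using K s e by (intro powr_mono2) auto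
  also have "\<dots> = ?c ^ Suc K" by (rule pw)
  also have "\<dots> = 1 + (\<Sum>k<Suc K. ?c ^ k * (?c - 1))"
  proof -
    have "(\<Sum>k<Suc K. ?c ^ k * (?c - 1)) = (\<Sum>k<Suc K. ?c ^ Suc k - ?c ^ k)"
      by (intro sum.cong) (auto simp: algebra_simps)
    also have "\<dots> = ?c ^ Suc K - 1" using sum_lessThan_telescope[of "\<lambda>k. ?c ^ k" "Suc K"] by simp
    finally show ?thesis by simp
  qed
  finally have "ennreal (s powr e) \<le> ennreal (1 + (\<Sum>k<Suc K. ?c ^ k * (?c - 1)))"
    by (rule ennreal_leI)
  also have "\<dots> = 1 + (\<Sum>k<Suc K. ennreal (?c ^ k * (?c - 1)))"
  proof -
    have "0 \<le> ?c ^ k * (?c - 1)" for k using c by simp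
    then show ?thesis
      by (simp del: sum.lessThan_Suc add: sum_nonneg ennreal_plus sum_ennreal)
  qed
  also have "(\<Sum>k<Suc K. ennreal (?c ^ k * (?c - 1))) =
      (\<Sum>k<Suc K. ennreal (?c ^ k * (?c - 1)) * indicator (\<Omega> k) x)"
  proof (intro sum.cong refl)
    fix k assume "k \<in> {..<Suc K}"
    then have "b ^ k \<le> b ^ K" using b by (intro power_increasing) auto
    then have "x \<in> \<Omega> k" using lev K by auto
    then show "ennreal (?c ^ k * (?c - 1)) = ennreal (?c ^ k * (?c - 1)) * indicator (\<Omega> k) x" by simp
  qed
  also have "\<dots> \<le> (\<Sum>k. ennreal (?c ^ k * (?c - 1)) * indicator (\<Omega> k) x)"
    by (intro sum_le_suminf) auto
  finally show ?thesis by (simp add: add_left_mono)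
qed

context dyadic_grid
begin

lemma D_ge_1: "1 \<le> D"
proof -
  fix x
  have "vol (q (Suc 0) x) \<le> vol (q 0 x)"
    by (rule measure_mono_fmeasurable) (use q_nest q_lmeasurable in auto)
  also have "\<dots> \<le> D * vol (q (Suc 0) x)" by (rule q_doubling)
  finally show ?thesis using q_pos[of "Suc 0" x] by simp
qed

lemma maximal_parent:
  assumes Q0: "Q0 \<in> grid" and S: "S \<subseteq> {Q\<in>grid. Q \<subseteq> Q0}" and Q: "maximal_in S Q" "Q \<noteq> Q0"
  obtains P where "P \<in> grid" "P \<subseteq> Q0" "P \<notin> S" "Q \<subseteq> P" "vol P \<le> D * vol Q"
proof -
  have Q': "Q \<in> S" "Q \<in> grid" "Q \<subseteq> Q0" using S Q unfolding maximal_in_def by auto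
  then obtain j x where jx: "Q = q j x" unfolding grid_def by auto
  \<comment> \<open>One set may be a cell of several generations; the cell just before its earliest
    generation is a genuine parent and not \<open>Q\<close> again.\<close>
  define i where "i = (LEAST i. q i x = Q)"
  have i: "q i x = Q" unfolding i_def by (rule LeastI[of _ j]) (simp add: jx)
  have x: "x \<in> Q0" using Q'(3) q_mem[of x i] i by auto
  obtain k0 where k0: "Q0 = q k0 x" using grid_ex_q[OF Q0 x] by auto
  have "\<not> i \<le> k0" using q_antimono[of i k0 x] i k0 Q' Q by auto
  then obtain i' where i': "i = Suc i'" "k0 \<le> i'" by (cases i) auto
  let ?P = "q i' x"
  have "?P \<noteq> Q" using not_less_Least[of i' "\<lambda>i. q i x = Q"] i' i_def by auto
  moreover have "Q \<subseteq> ?P" using q_nest[of i' x] i i' by auto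
  ultimately have "?P \<notin> S" using Q unfolding maximal_in_def by auto
  show ?thesis
    using that[of ?P] \<open>?P \<notin> S\<close> \<open>Q \<subseteq> ?P\<close> q_in_grid[of i' x] q_antimono[OF i'(2), of x] k0 q_doubling[of i' x] i i'
    by auto
qed

text \<open>Stop at the heights \<open>b ^ k\<close> with \<open>b = 2 * D\<close>. The parent of a
  maximal cube was not selected, so the cube has average at most \<open>D * b ^ k\<close>, and the
  next level fills at most half of it. The hypothesis \<open>A_infty\<close> then leaves a fraction
  \<open>\<delta>\<close> of the mass outside that level, so the mass of the levels decays like
  \<open>(1 - \<delta>) ^ k\<close>. The exponent \<open>e\<close> makes the powers of the heights
  grow more slowly than that.\<close>

theorem reverse_Hoelder:
  fixes \<sigma> :: "'a \<Rightarrow> real"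
  assumes \<sigma> [measurable]: "\<sigma> \<in> borel_measurable lebesgue" and \<sigma>0: "\<And>x. 0 \<le> \<sigma> x"
    and Q0: "Q0 \<in> grid" and \<delta>: "0 < \<delta>" "\<delta> \<le> 1"
    and A_infty: "\<And>Q E. Q \<in> grid \<Longrightarrow> Q \<subseteq> Q0 \<Longrightarrow> E \<in> sets lebesgue \<Longrightarrow> E \<subseteq> Q \<Longrightarrow>
        leb Q \<le> 2 * leb E \<Longrightarrow>
        ennreal \<delta> * (\<integral>\<^sup>+x\<in>Q. ennreal (\<sigma> x) \<partial>lebesgue) \<le> (\<integral>\<^sup>+x\<in>E. ennreal (\<sigma> x) \<partial>lebesgue)"
    and avg: "(\<integral>\<^sup>+x\<in>Q0. ennreal (\<sigma> x) \<partial>lebesgue) \<le> leb Q0"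
    and e: "0 < e" "(2 * D) powr e = 1 + \<delta> / 2"
  shows "(\<integral>\<^sup>+x\<in>Q0. ennreal (\<sigma> x powr (1 + e)) \<partial>lebesgue) \<le> 2 * leb Q0"
proof -
  define b where "b = 2 * D"
  have b: "2 \<le> b" unfolding b_def using D_ge_1 by simp
  define I where "I A = (\<integral>\<^sup>+x\<in>A. ennreal (\<sigma> x) \<partial>lebesgue)" for A
  have I_mono: "A \<subseteq> B \<Longrightarrow> I A \<le> I B" for A B unfolding I_def by (rule nn_set_integral_set_mono)
  have Q0m [measurable]: "Q0 \<in> sets lebesgue" using grid_sets[OF Q0] .
  have IQ0: "I Q0 < \<infinity>"
    using avg grid_emeasure(1)[OF Q0] unfolding I_def by (metis ennreal_less_top infinity_ennreal_def le_less_trans)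
  define S where "S k = {Q\<in>grid. Q \<subseteq> Q0 \<and> ennreal (b ^ k) * leb Q < I Q}" for k
  define \<Omega> where "\<Omega> k = \<Union>(S k)" for k
  have Sg: "S k \<subseteq> grid" and SQ0: "S k \<subseteq> {Q\<in>grid. Q \<subseteq> Q0}" for k unfolding S_def by auto
  have \<Omega>m [measurable]: "\<Omega> k \<in> sets lebesgue" for k unfolding \<Omega>_def by (rule Union_grid_sets[OF Sg])
  have Smono: "S (Suc k) \<subseteq> S k" for k
  proof
    fix Q assume "Q \<in> S (Suc k)"
    moreover have "ennreal (b ^ k) * leb Q \<le> ennreal (b ^ Suc k) * leb Q"
      using b by (intro mult_right_mono ennreal_leI power_increasing) auto
    ultimately show "Q \<in> S k" unfolding S_def by auto
  qed
  have \<Omega>Q0: "\<Omega> k \<subseteq> Q0" for k unfolding \<Omega>_def S_def by auto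
  have step_Q: "I (Q \<inter> \<Omega> (Suc k)) \<le> ennreal (1 - \<delta>) * I Q" if Q: "maximal_in (S k) Q" for Q k
  proof -
    have QS: "Q \<in> S k" using Q unfolding maximal_in_def by auto
    then have Qg: "Q \<in> grid" and QQ0: "Q \<subseteq> Q0" unfolding S_def by auto
    note [measurable] = grid_sets[OF Qg]
    \<comment> \<open>Since the average over \<open>Q0\<close> is at most 1, \<open>Q0\<close>
      belongs to no level; so \<open>Q\<close> has a parent inside \<open>Q0\<close>.\<close>
    have "Q \<noteq> Q0"
    proof
      assume "Q = Q0"
      then have "ennreal (b ^ k) * leb Q0 < I Q0" using QS unfolding S_def by auto
      moreover have "1 * leb Q0 \<le> ennreal (b ^ k) * leb Q0"
        using b by (intro mult_right_mono) (auto simp: one_le_power)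
      ultimately show False using avg unfolding I_def by simp
    qed
    then obtain P where P: "P \<in> grid" "P \<subseteq> Q0" "P \<notin> S k" "Q \<subseteq> P"
        "vol P \<le> D * vol Q"
      using maximal_parent[OF Q0 SQ0 Q] by blast
    have "I Q \<le> I P" using I_mono P by auto
    also have "\<dots> \<le> ennreal (b ^ k) * leb P" using P unfolding S_def by auto
    also have "\<dots> \<le> ennreal (b ^ k) * ennreal (D * vol Q)"
      using P grid_emeasure(1)[OF P(1)] by (intro mult_left_mono) (auto intro: ennreal_leI)
    also have "\<dots> = ennreal (b ^ k * D * vol Q)"
      using b D_ge_1 by (subst ennreal_mult[symmetric]) (auto simp: mult.assoc)
    finally have IQ: "I Q \<le> ennreal (b ^ k * D * vol Q)" .
    define R where "R = {R\<in>S (Suc k). R \<subseteq> Q}"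
    have Rg: "R \<subseteq> grid" unfolding R_def S_def by auto
    note [measurable] = Union_grid_sets[OF Rg]
    have QR: "Q \<inter> \<Omega> (Suc k) = \<Union>R"
    proof
      show "Q \<inter> \<Omega> (Suc k) \<subseteq> \<Union>R"
      proof
        fix x assume "x \<in> Q \<inter> \<Omega> (Suc k)"
        then obtain T where T: "x \<in> Q" "T \<in> S (Suc k)" "x \<in> T" unfolding \<Omega>_def by auto
        then have "T \<subseteq> Q" using maximal_inside[OF Sg Q, of T x] Smono by auto
        then show "x \<in> \<Union>R" using T unfolding R_def by auto
      qed
    qed (auto simp: R_def \<Omega>_def)
    have RQ: "\<Union>R \<subseteq> Q" unfolding R_def by auto
    have "ennreal (b ^ Suc k) * leb (\<Union>R) = (\<integral>\<^sup>+x\<in>\<Union>R. ennreal (b ^ Suc k) \<partial>lebesgue)"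
      by (simp add: nn_integral_cmult_indicator)
    also have "\<dots> \<le> I (\<Union>R)" unfolding I_def
    proof (rule cover_le[OF Rg])
      fix T assume "maximal_in R T"
      then have "T \<in> S (Suc k)" unfolding maximal_in_def R_def by auto
      then show "(\<integral>\<^sup>+x\<in>T. ennreal (b ^ Suc k) \<partial>lebesgue) \<le> (\<integral>\<^sup>+x\<in>T. ennreal (\<sigma> x) \<partial>lebesgue)"
        using grid_sets[of T] unfolding S_def I_def by (auto simp: nn_integral_cmult_indicator less_imp_le)
    qed auto
    also have "\<dots> \<le> I Q" by (rule I_mono[OF RQ])
    also note IQ
    finally have 1: "ennreal (b ^ Suc k) * leb (\<Union>R) \<le> ennreal (b ^ k * D * vol Q)" .
    have Qf: "Q \<in> lmeasurable" using Qg q_lmeasurable unfolding grid_def by auto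
    have Rf: "\<Union>R \<in> lmeasurable" using fmeasurableI2[OF Qf RQ] by auto
    have "b ^ Suc k * vol (\<Union>R) \<le> b ^ k * D * vol Q"
      using 1 b D_ge_1 Rf by (simp add: emeasure_eq_measure2 ennreal_mult[symmetric] ennreal_le_iff)
    then have "b ^ k * D * (2 * vol (\<Union>R)) \<le> b ^ k * D * vol Q"
      by (simp add: b_def mult_ac)
    moreover have "0 < b ^ k * D" using b D_ge_1 by auto
    ultimately have 2: "2 * vol (\<Union>R) \<le> vol Q"
      by (simp only: mult_le_cancel_left_pos)
    have "vol (Q - \<Union>R) = vol Q - vol (\<Union>R)"
      by (rule measurable_measure_Diff) (use Qf RQ in auto)
    then have "vol Q \<le> 2 * vol (Q - \<Union>R)" using 2 by simp
    moreover have "Q - \<Union>R \<in> lmeasurable" using fmeasurableI2[OF Qf, of "Q - \<Union>R"] by auto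
    ultimately have "leb Q \<le> 2 * leb (Q - \<Union>R)"
      using Qf by (simp add: emeasure_eq_measure2 ennreal_mult[symmetric] flip: ennreal_numeral)
    then have 3: "ennreal \<delta> * I Q \<le> I (Q - \<Union>R)"
      unfolding I_def by (intro A_infty) (use Qg QQ0 in auto)
    have "I (Q - \<Union>R) + I (\<Union>R) = I Q"
    proof -
      have "I ((Q - \<Union>R) \<union> \<Union>R) = I (Q - \<Union>R) + I (\<Union>R)"
        unfolding I_def by (intro nn_integral_disjoint_pair) auto
      then show ?thesis using RQ by (simp add: Un_absorb2)
    qed
    then have 4: "ennreal \<delta> * I Q + I (\<Union>R) \<le> I Q" using 3 by (metis add_right_mono)
    have fin: "I Q < \<infinity>" "I (\<Union>R) < \<infinity>"
      using I_mono[OF QQ0] I_mono[OF RQ] IQ0 by (auto intro: le_less_trans)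
    then obtain u v where uv: "I Q = ennreal u" "I (\<Union>R) = ennreal v" "0 \<le> u" "0 \<le> v"
      by (metis ennreal_cases infinity_ennreal_def less_irrefl)
    have "ennreal (\<delta> * u + v) \<le> ennreal u"
      using 4 uv \<delta> by (simp add: ennreal_mult)
    then have "v \<le> (1 - \<delta>) * u" using uv by (simp add: ennreal_le_iff algebra_simps)
    then have "I (\<Union>R) \<le> ennreal (1 - \<delta>) * I Q"
      using uv \<delta> by (simp add: ennreal_mult[symmetric] ennreal_leI)
    then show ?thesis unfolding QR .
  qed
  have step: "I (\<Omega> (Suc k)) \<le> ennreal (1 - \<delta>) * I (\<Omega> k)" for k
  proof -
    have "I (\<Omega> (Suc k)) = (\<integral>\<^sup>+x\<in>\<Union>(S k). (ennreal (\<sigma> x) * indicator (\<Omega> (Suc k)) x) \<partial>lebesgue)"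
      unfolding I_def by (intro nn_integral_cong) (use Smono in \<open>auto simp: \<Omega>_def indicator_def\<close>)
    also have "\<dots> \<le> (\<integral>\<^sup>+x\<in>\<Union>(S k). (ennreal (1 - \<delta>) * ennreal (\<sigma> x)) \<partial>lebesgue)"
    proof (rule cover_le[OF Sg])
      fix Q assume Q: "maximal_in (S k) Q"
      then have [measurable]: "Q \<in> sets lebesgue" using grid_sets Sg unfolding maximal_in_def by blast
      have "(\<integral>\<^sup>+x\<in>Q. (ennreal (\<sigma> x) * indicator (\<Omega> (Suc k)) x) \<partial>lebesgue) = I (Q \<inter> \<Omega> (Suc k))"
        unfolding I_def by (intro nn_integral_cong) (auto simp: indicator_def)
      also have "\<dots> \<le> ennreal (1 - \<delta>) * I Q" by (rule step_Q[OF Q])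
      also have "\<dots> = (\<integral>\<^sup>+x\<in>Q. (ennreal (1 - \<delta>) * ennreal (\<sigma> x)) \<partial>lebesgue)"
        unfolding I_def by (subst nn_integral_cmult[symmetric]) (auto simp: mult.assoc)
      finally show "(\<integral>\<^sup>+x\<in>Q. (ennreal (\<sigma> x) * indicator (\<Omega> (Suc k)) x) \<partial>lebesgue)
        \<le> (\<integral>\<^sup>+x\<in>Q. (ennreal (1 - \<delta>) * ennreal (\<sigma> x)) \<partial>lebesgue)" .
    qed auto
    also have "\<dots> = ennreal (1 - \<delta>) * I (\<Omega> k)"
      unfolding I_def \<Omega>_def[symmetric] by (subst nn_integral_cmult[symmetric]) (auto simp: mult.assoc)
    finally show ?thesis .
  qed
  have decay: "I (\<Omega> k) \<le> ennreal ((1 - \<delta>) ^ k) * I Q0" for k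
  proof (induction k)
    case 0
    then show ?case using I_mono[OF \<Omega>Q0, of 0] by simp
  next
    case (Suc k)
    have "I (\<Omega> (Suc k)) \<le> ennreal (1 - \<delta>) * I (\<Omega> k)" by (rule step)
    also have "\<dots> \<le> ennreal (1 - \<delta>) * (ennreal ((1 - \<delta>) ^ k) * I Q0)" by (intro mult_left_mono Suc) auto
    also have "\<dots> = ennreal ((1 - \<delta>) ^ Suc k) * I Q0" using \<delta> by (simp add: ennreal_mult mult.assoc)
    finally show ?case .
  qed
  let ?c = "1 + \<delta> / 2"
  have bc: "b powr e = ?c" using e unfolding b_def by simp
  have "AE x in lebesgue. \<forall>k. x \<in> Q0 \<longrightarrow> ennreal (b ^ k) < ennreal (\<sigma> x) \<longrightarrow> x \<in> \<Omega> k"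
    unfolding AE_all_countable
  proof
    fix k
    have "AE x in lebesgue. x \<in> Q0 \<longrightarrow> ennreal (b ^ k) < ennreal (\<sigma> x) \<longrightarrow>
      (\<exists>Q\<in>grid. Q \<subseteq> Q0 \<and> x \<in> Q \<and> ennreal (b ^ k) * leb Q < (\<integral>\<^sup>+y\<in>Q. ennreal (\<sigma> y) \<partial>lebesgue))"
      by (rule AE_exceeds_some_average) (use Q0 IQ0 in \<open>auto simp: I_def\<close>)
    then show "AE x in lebesgue. x \<in> Q0 \<longrightarrow> ennreal (b ^ k) < ennreal (\<sigma> x) \<longrightarrow> x \<in> \<Omega> k"
      by eventually_elim (auto simp: \<Omega>_def S_def I_def)
  qed
  then have ptw: "AE x in lebesgue. ennreal (\<sigma> x powr (1 + e)) * indicator Q0 x \<le>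
      ennreal (\<sigma> x) * indicator Q0 x + (\<Sum>k. ennreal (?c ^ k * (\<delta> / 2)) * (ennreal (\<sigma> x) * indicator (\<Omega> k) x))"
  proof eventually_elim
    case (elim x)
    show ?case
    proof (cases "x \<in> Q0")
      case True
      have "ennreal (\<sigma> x powr e) \<le> 1 + (\<Sum>k. ennreal (?c ^ k * (?c - 1)) * indicator (\<Omega> k) x)"
        unfolding bc[symmetric] using elim True b \<sigma>0 e
        by (intro powr_le_level_sum) (auto simp: ennreal_less_iff)
      then have "ennreal (\<sigma> x) * ennreal (\<sigma> x powr e) \<le>
          ennreal (\<sigma> x) * (1 + (\<Sum>k. ennreal (?c ^ k * (\<delta> / 2)) * indicator (\<Omega> k) x))"
        by (intro mult_left_mono) auto
      also have "\<dots> = ennreal (\<sigma> x) + (\<Sum>k. ennreal (?c ^ k * (\<delta> / 2)) * (ennreal (\<sigma> x) * indicator (\<Omega> k) x))"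
        unfolding distrib_left ennreal_suminf_cmult[symmetric] mult.right_neutral
        by (intro arg_cong2[where f="(+)"] suminf_cong refl) (simp only: mult_ac)
      also have "ennreal (\<sigma> x) * ennreal (\<sigma> x powr e) = ennreal (\<sigma> x powr (1 + e))"
        using \<sigma>0[of x] by (simp add: powr_add ennreal_mult)
      finally show ?thesis using True by simp
    qed simp
  qed
  have "(\<Sum>k. ennreal (?c ^ k * (\<delta> / 2)) * I (\<Omega> k)) \<le> (\<Sum>k. ennreal ((\<delta> / 2) * (1 - \<delta> / 2) ^ k) * I Q0)"
  proof (intro suminf_le)
    fix k
    \<comment> \<open>Growth \<open>1 + \<delta> / 2\<close> against decay
      \<open>1 - \<delta>\<close> leaves the ratio \<open>1 - \<delta> / 2\<close>, and the weight
      \<open>\<delta> / 2\<close> turns the geometric series into exactly 1.\<close>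
    have "?c * (1 - \<delta>) \<le> 1 - \<delta> / 2" using \<delta> by (simp add: algebra_simps)
    then have le: "(?c * (1 - \<delta>)) ^ k \<le> (1 - \<delta> / 2) ^ k" using \<delta> by (intro power_mono) auto
    have "ennreal (?c ^ k * (\<delta> / 2)) * I (\<Omega> k) \<le> ennreal (?c ^ k * (\<delta> / 2)) * (ennreal ((1 - \<delta>) ^ k) * I Q0)"
      by (intro mult_left_mono decay) auto
    also have "\<dots> = ennreal ((\<delta> / 2) * (?c * (1 - \<delta>)) ^ k) * I Q0"
    proof -
      have 1: "(\<delta> / 2) * (?c * (1 - \<delta>)) ^ k = ?c ^ k * (\<delta> / 2) * (1 - \<delta>) ^ k"
        by (simp only: power_mult_distrib mult_ac)
      have 2: "0 \<le> ?c ^ k * (\<delta> / 2)" "0 \<le> (1 - \<delta>) ^ k" using \<delta> by auto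
      show ?thesis unfolding 1 ennreal_mult[OF 2] by (simp only: mult.assoc)
    qed
    also have "\<dots> \<le> ennreal ((\<delta> / 2) * (1 - \<delta> / 2) ^ k) * I Q0"
      using le \<delta> by (intro mult_right_mono ennreal_leI mult_left_mono) auto
    finally show "ennreal (?c ^ k * (\<delta> / 2)) * I (\<Omega> k) \<le> ennreal ((\<delta> / 2) * (1 - \<delta> / 2) ^ k) * I Q0" .
  qed auto
  also have "\<dots> = I Q0"
    unfolding ennreal_suminf_multc using \<delta> by (subst geometric_suminf_ennreal) auto
  finally have sum_le: "(\<Sum>k. ennreal (?c ^ k * (\<delta> / 2)) * I (\<Omega> k)) \<le> I Q0" .
  have "(\<integral>\<^sup>+x\<in>Q0. ennreal (\<sigma> x powr (1 + e)) \<partial>lebesgue) \<le>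
      (\<integral>\<^sup>+x. ennreal (\<sigma> x) * indicator Q0 x +
        (\<Sum>k. ennreal (?c ^ k * (\<delta> / 2)) * (ennreal (\<sigma> x) * indicator (\<Omega> k) x)) \<partial>lebesgue)"
    by (rule nn_integral_mono_AE[OF ptw])
  also have "\<dots> = I Q0 + (\<Sum>k. ennreal (?c ^ k * (\<delta> / 2)) * I (\<Omega> k))"
    unfolding I_def by (simp add: nn_integral_add nn_integral_suminf nn_integral_cmult)
  also have "\<dots> \<le> I Q0 + I Q0" by (intro add_left_mono sum_le)
  also have "\<dots> \<le> 2 * leb Q0"
    using avg unfolding I_def mult_2 by (intro add_mono)
  finally show ?thesis .
qed

end

section \<open>Matrix weights on a dyadic grid\<close>

lemma sum_powr_le:
  fixes a :: "'i \<Rightarrow> real"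
  assumes "finite I" "\<And>i. i \<in> I \<Longrightarrow> 0 \<le> a i" "1 < r"
  shows "(\<Sum>i\<in>I. a i) powr r \<le> real (card I) powr r * (\<Sum>i\<in>I. a i powr r)"
proof (cases "I = {}")
  case False
  define m where "m = Max (a ` I)"
  have fin: "finite (a ` I)" "a ` I \<noteq> {}" using assms False by auto
  obtain k where k: "k \<in> I" "m = a k" using Max_in[OF fin] unfolding m_def by auto
  have m: "a i \<le> m" if "i \<in> I" for i unfolding m_def using fin that by (intro Max_ge) auto
  have "(\<Sum>i\<in>I. a i) \<le> real (card I) * m" using m by (intro sum_bounded_above)
  then have "(\<Sum>i\<in>I. a i) powr r \<le> (real (card I) * m) powr r"
    using assms by (intro powr_mono2 sum_nonneg) auto
  also have "\<dots> = real (card I) powr r * a k powr r" using assms(2)[OF k(1)] unfolding k(2) by (simp add: powr_mult)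
  also have "\<dots> \<le> real (card I) powr r * (\<Sum>i\<in>I. a i powr r)"
    using assms k by (intro mult_left_mono member_le_sum) auto
  finally show ?thesis .
qed simp

lemma matrix_vector_mult_sum_right:
  fixes A :: "real^'m^'k"
  shows "A *v (\<Sum>i\<in>I. g i) = (\<Sum>i\<in>I. A *v g i)"
  by (rule linear_sum[OF matrix_vector_mul_linear])

lemma norm_matrix_vector_le:
  fixes A :: "real^'m^'k"
  shows "norm (A *v x) \<le> (\<Sum>i\<in>UNIV. norm (A $ i)) * norm x"
proof -
  have "norm (A *v x) \<le> (\<Sum>i\<in>UNIV. \<bar>(A *v x) $ i\<bar>)" by (rule norm_le_l1_cart)
  also have "\<dots> \<le> (\<Sum>i\<in>UNIV. norm (A $ i) * norm x)"
    by (intro sum_mono) (simp add: matrix_vector_mul_component Cauchy_Schwarz_ineq2)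
  finally show ?thesis by (simp add: sum_distrib_right)
qed

lemma borel_measurable_matrix_vector_mult:
  fixes A :: "'a \<Rightarrow> real^'m^'k"
  assumes "A \<in> borel_measurable M"
  shows "(\<lambda>x. A x *v v) \<in> borel_measurable M"
proof -
  have "continuous_on UNIV (\<lambda>A::real^'m^'k. A *v v)"
    unfolding matrix_vector_mult_def by (intro continuous_intros)
  then show ?thesis using borel_measurable_continuous_on[OF _ assms] by blast
qed

lemma abs_det_le:
  fixes A :: "real^'d^'d"
  assumes "\<And>i j. \<bar>A $ i $ j\<bar> \<le> R"
  shows "\<bar>det A\<bar> \<le> real (card {p. p permutes (UNIV :: 'd set)}) * R ^ CARD('d)"
proof -
  have "\<bar>det A\<bar> \<le> (\<Sum>p\<in>{p. p permutes (UNIV :: 'd set)}. \<bar>of_int (sign p) * (\<Prod>i\<in>UNIV. A $ i $ p i)\<bar>)"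
    unfolding det_def by (rule sum_abs)
  also have "\<dots> \<le> (\<Sum>p\<in>{p. p permutes (UNIV :: 'd set)}. R ^ CARD('d))"
  proof (intro sum_mono)
    fix p :: "'d \<Rightarrow> 'd"
    have "(\<Prod>i\<in>UNIV. \<bar>A $ i $ p i\<bar>) \<le> (\<Prod>i\<in>(UNIV :: 'd set). R)"
      using assms by (intro prod_mono) auto
    then show "\<bar>of_int (sign p) * (\<Prod>i\<in>UNIV. A $ i $ p i)\<bar> \<le> R ^ CARD('d)"
      by (simp add: abs_mult abs_prod sign_def)
  qed
  finally show ?thesis by simp
qed

text \<open>An approximate Auerbach basis: nearly maximise the determinant over \<open>K\<close> and apply Cramer's rule.\<close>

lemma ex_near_Auerbach_basis:
  fixes K :: "(real^'d) set"
  assumes bdd: "bounded K" and absorb: "\<And>v. \<exists>c>0. c *\<^sub>R v \<in> K"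
  shows "\<exists>b :: 'd \<Rightarrow> real^'d. (\<forall>i. b i \<in> K) \<and>
    (\<forall>v\<in>K. \<exists>c. (\<forall>i. \<bar>c i\<bar> \<le> 2) \<and> v = (\<Sum>i\<in>UNIV. c i *\<^sub>R b i))"
proof -
  define M :: "('d \<Rightarrow> real^'d) \<Rightarrow> real^'d^'d" where "M b = (\<chi> i j. b j $ i)" for b
  define S where "S = {\<bar>det (M b)\<bar> | b. \<forall>i. b i \<in> K}"
  obtain R where R: "\<And>v. v \<in> K \<Longrightarrow> norm v \<le> R" using bdd unfolding bounded_iff by auto
  have S_bdd: "bdd_above S"
  proof (rule bdd_aboveI)
    fix s assume "s \<in> S"
    then obtain b where b: "s = \<bar>det (M b)\<bar>" "\<forall>i. b i \<in> K" unfolding S_def by auto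
    have "\<bar>M b $ i $ j\<bar> \<le> R" for i j
      unfolding M_def using b R[of "b j"] component_le_norm_cart[of "b j" i] by (auto intro: order_trans)
    then show "s \<le> real (card {p. p permutes (UNIV :: 'd set)}) * R ^ CARD('d)"
      unfolding b by (rule abs_det_le)
  qed
  have "\<forall>i::'d. \<exists>c>0. c *\<^sub>R axis i 1 \<in> K" using absorb by auto
  from choice[OF this] obtain c :: "'d \<Rightarrow> real" where c: "\<And>i. 0 < c i" "\<And>i. c i *\<^sub>R axis i 1 \<in> K"
    by blast
  have "det (M (\<lambda>i. c i *\<^sub>R axis i 1)) = (\<Prod>i\<in>UNIV. c i)"
    by (subst det_diagonal) (auto simp: M_def axis_def)
  then have "(\<Prod>i\<in>UNIV. c i) \<in> S"
    unfolding S_def using c by (intro CollectI exI[of _ "\<lambda>i. c i *\<^sub>R axis i 1"])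
      (simp add: prod_nonneg less_imp_le)
  note prod_in_S = this
  have "0 < (\<Prod>i\<in>UNIV. c i)" using c by (intro prod_pos) simp
  also have "\<dots> \<le> Sup S" by (rule cSup_upper[OF prod_in_S S_bdd])
  finally have S_pos: "0 < Sup S" "S \<noteq> {}" using prod_in_S by blast+
  \<comment> \<open>\<open>K\<close> need not be closed, so the supremum may not be attained. More
    than half of it is reached, which is where the coefficient bound 2 comes from.\<close>
  then obtain s where "s \<in> S" "Sup S / 2 < s" using less_cSupE[of "Sup S / 2" S] by auto
  then obtain b where b: "\<forall>i. b i \<in> K" "Sup S / 2 < \<bar>det (M b)\<bar>" unfolding S_def by auto
  have d0: "det (M b) \<noteq> 0" using b S_pos by auto
  have "\<exists>c. (\<forall>i. \<bar>c i\<bar> \<le> 2) \<and> v = (\<Sum>i\<in>UNIV. c i *\<^sub>R b i)" if v: "v \<in> K" for v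
  proof -
    define x :: "real^'d" where "x = (\<chi> k. det (\<chi> i j. if j = k then v $ i else M b $ i $ j) / det (M b))"
    have "M b *v x = v" using cramer[OF d0, of x v] x_def by auto
    then have "v = (\<Sum>i\<in>UNIV. x $ i *\<^sub>R b i)"
      by (simp add: matrix_mult_sum column_def M_def scalar_mult_eq_scaleR)
    moreover have "\<bar>x $ k\<bar> \<le> 2" for k
    proof -
      have eq: "(\<chi> i j. if j = k then v $ i else M b $ i $ j) = M (b(k := v))"
        unfolding M_def by (auto simp: vec_eq_iff)
      have "\<bar>det (M (b(k := v)))\<bar> \<le> Sup S"
        by (rule cSup_upper[OF _ S_bdd]) (use b v in \<open>auto simp: S_def\<close>)
      then have "\<bar>det (M (b(k := v)))\<bar> \<le> 2 * \<bar>det (M b)\<bar>" using b by linarith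
      then show ?thesis unfolding x_def using d0 eq by (simp add: abs_divide divide_le_eq)
    qed
    ultimately show ?thesis by blast
  qed
  then show ?thesis using b by blast
qed

section \<open>Averages of the scalar weights attached to vectors, and their A-infinity
  property\<close>

lemma sigma_finite_lebesgue: "sigma_finite_measure (lebesgue :: 'a::euclidean_space measure)"
proof
  show "\<exists>A::'a set set. countable A \<and> A \<subseteq> sets lebesgue \<and> \<Union>A = space lebesgue \<and>
      (\<forall>a\<in>A. leb a \<noteq> \<infinity>)"
  proof (intro exI conjI)
    show "\<Union>(range (\<lambda>n::nat. cball (0::'a) n)) = space lebesgue"
      using real_arch_simple by (auto simp: dist_norm)
  qed (use emeasure_lborel_cball_finite in \<open>auto simp: less_top\<close>)
qed

text \<open>The default 0 of \<open>enn2real\<close> at infinity is never met on grid cells, where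
  \<open>phi_finite\<close> below excludes it.\<close>

definition weight_avg :: "('a::euclidean_space \<Rightarrow> real^'d^'d) \<Rightarrow> real \<Rightarrow> 'a set \<Rightarrow> real^'d \<Rightarrow> real" where
  "weight_avg V r Q v =
     enn2real (\<integral>\<^sup>+y\<in>Q. ennreal (norm (V y *v v) powr r) \<partial>lebesgue) / vol Q"

text \<open>\<open>V\<close> stands for the inverse of \<open>W\<close>, at every point; a weight is
  first altered on a null set to achieve this. Since \<open>1 / (r - 1)\<close> is p / r = p - 1,
  \<open>muckenhoupt\<close> is the p-th power of the A_p condition, with the operator norm replaced
  by a sum over the standard basis; \<open>B\<close> is of order [W]^p.\<close>

locale dyadic_weight = dyadic_grid q D
  for q :: "nat \<Rightarrow> 'a::euclidean_space \<Rightarrow> 'a set" and D :: real +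
  fixes W V :: "'a \<Rightarrow> real^'d^'d" and r B :: real
  assumes W_measurable [measurable]: "W \<in> borel_measurable lebesgue"
    and V_measurable [measurable]: "V \<in> borel_measurable lebesgue"
    and WV: "W x ** V x = mat 1"
    and r_gt_1: "1 < r" and B_pos: "0 < B"
    and phi_finite: "Q \<in> grid \<Longrightarrow> (\<integral>\<^sup>+y\<in>Q. ennreal (norm (V y *v v) powr r) \<partial>lebesgue) < \<infinity>"
    and muckenhoupt: "Q \<in> grid \<Longrightarrow>
      (\<integral>\<^sup>+x\<in>Q. ennreal ((\<Sum>i\<in>UNIV. weight_avg V r Q (W x *v axis i 1)) powr (1 / (r - 1))) \<partial>lebesgue)
        \<le> ennreal B * leb Q"
begin

abbreviation \<phi> :: "'a set \<Rightarrow> real^'d \<Rightarrow> real" where "\<phi> \<equiv> weight_avg V r"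

definition N :: "'a set \<Rightarrow> 'a \<Rightarrow> real" where
  "N Q x = (\<Sum>i\<in>UNIV. \<phi> Q (W x *v axis i 1))"

text \<open>The p-th power of \<open>N Q x powr (1 / r)\<close>, because \<open>1 / (r - 1)\<close>
  equals p / r.\<close>

definition Np :: "'a set \<Rightarrow> 'a \<Rightarrow> real" where
  "Np Q x = N Q x powr (1 / (r - 1))"

lemma d_ge_1: "1 \<le> real CARD('d)" by (simp add: Suc_leI)

lemma VW: "V x ** W x = mat 1"
  using WV matrix_left_right_inverse by blast

lemma W_V_apply: "W x *v (V x *v v) = v" "V x *v (W x *v v) = v"
  by (simp_all add: matrix_vector_mul_assoc WV VW)

lemma V_apply_measurable [measurable]: "(\<lambda>y. V y *v v) \<in> borel_measurable lebesgue"
  by (rule borel_measurable_matrix_vector_mult) measurable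

lemma phi_eq:
  assumes "Q \<in> grid"
  shows "(\<integral>\<^sup>+y\<in>Q. ennreal (norm (V y *v v) powr r) \<partial>lebesgue) = ennreal (\<phi> Q v) * leb Q"
  unfolding weight_avg_def grid_emeasure(1)[OF assms]
  using phi_finite[OF assms, of v] grid_emeasure(2)[OF assms] by (simp add: ennreal_mult[symmetric])

lemma phi_nonneg: "0 \<le> \<phi> Q v"
  unfolding weight_avg_def by simp

lemma phi_scale: "\<phi> Q (c *\<^sub>R v) = \<bar>c\<bar> powr r * \<phi> Q v" if "Q \<in> grid"
proof -
  note [measurable] = grid_sets[OF that]
  have "(\<integral>\<^sup>+y\<in>Q. ennreal (norm (V y *v (c *\<^sub>R v)) powr r) \<partial>lebesgue) =
     (\<integral>\<^sup>+y. ennreal (\<bar>c\<bar> powr r) * (ennreal (norm (V y *v v) powr r) * indicator Q y) \<partial>lebesgue)"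
    by (intro nn_integral_cong)
       (simp add: matrix_vector_mult_scaleR powr_mult ennreal_mult mult.assoc)
  also have "\<dots> = ennreal (\<bar>c\<bar> powr r) * (\<integral>\<^sup>+y\<in>Q. ennreal (norm (V y *v v) powr r) \<partial>lebesgue)"
    by (rule nn_integral_cmult) measurable
  finally show ?thesis unfolding weight_avg_def by (simp add: enn2real_mult)
qed

lemma phi_pos: assumes Q: "Q \<in> grid" and v: "v \<noteq> 0" shows "0 < \<phi> Q v"
proof (rule ccontr)
  note [measurable] = grid_sets[OF Q]
  assume "\<not> 0 < \<phi> Q v"
  then have "(\<integral>\<^sup>+y\<in>Q. ennreal (norm (V y *v v) powr r) \<partial>lebesgue) = 0"
    using phi_eq[OF Q, of v] phi_nonneg[of Q v] by simp
  then have "AE y in lebesgue. ennreal (norm (V y *v v) powr r) * indicator Q y = 0"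
    by (subst (asm) nn_integral_0_iff_AE) auto
  moreover have "V y *v v \<noteq> 0" for y using W_V_apply(1)[of y v] v by auto
  ultimately have "AE y in lebesgue. y \<notin> Q"
    by (auto simp: indicator_def)
  then have "leb Q = 0" using AE_iff_measurable[of Q lebesgue "\<lambda>y. y \<notin> Q"] by auto
  then show False using grid_emeasure[OF Q] by simp
qed

lemma phi_sum_le:
  fixes b :: "'d \<Rightarrow> real^'d"
  assumes Q: "Q \<in> grid" and c: "\<And>i. \<bar>c i\<bar> \<le> m"
  shows "\<phi> Q (\<Sum>i\<in>UNIV. c i *\<^sub>R b i) \<le> (real CARD('d) * m) powr r * (\<Sum>i\<in>UNIV. \<phi> Q (b i))"
proof -
  note [measurable] = grid_sets[OF Q]
  have m: "0 \<le> m" using c abs_ge_zero order_trans by blast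
  have ptw: "norm (V y *v (\<Sum>i\<in>UNIV. c i *\<^sub>R b i)) powr r \<le> (real CARD('d) * m) powr r * (\<Sum>i\<in>UNIV. norm (V y *v b i) powr r)" for y
  proof -
    have "norm (V y *v (\<Sum>i\<in>UNIV. c i *\<^sub>R b i)) = norm (\<Sum>i\<in>UNIV. c i *\<^sub>R (V y *v b i))"
      by (simp add: matrix_vector_mult_sum_right matrix_vector_mult_scaleR)
    also have "\<dots> \<le> (\<Sum>i\<in>UNIV. m * norm (V y *v b i))"
      using c by (intro order_trans[OF norm_sum] sum_mono) (auto intro: mult_right_mono)
    finally have "norm (V y *v (\<Sum>i\<in>UNIV. c i *\<^sub>R b i)) powr r \<le> (m * (\<Sum>i\<in>UNIV. norm (V y *v b i))) powr r"
      using r_gt_1 by (intro powr_mono2) (auto simp: sum_distrib_left)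
    also have "\<dots> = m powr r * (\<Sum>i\<in>UNIV. norm (V y *v b i)) powr r"
      by (rule powr_mult)
    also have "\<dots> \<le> m powr r * (real CARD('d) powr r * (\<Sum>i\<in>UNIV. norm (V y *v b i) powr r))"
      using sum_powr_le[of UNIV "\<lambda>i. norm (V y *v b i)" r] r_gt_1 by (intro mult_left_mono) auto
    also have "\<dots> = (real CARD('d) * m) powr r * (\<Sum>i\<in>UNIV. norm (V y *v b i) powr r)"
      using m by (simp add: powr_mult)
    finally show ?thesis .
  qed
  have "ennreal (\<phi> Q (\<Sum>i\<in>UNIV. c i *\<^sub>R b i)) * leb Q =
      (\<integral>\<^sup>+y\<in>Q. ennreal (norm (V y *v (\<Sum>i\<in>UNIV. c i *\<^sub>R b i)) powr r) \<partial>lebesgue)"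
    by (rule phi_eq[OF Q, symmetric])
  also have "\<dots> \<le> (\<integral>\<^sup>+y. ennreal ((real CARD('d) * m) powr r) * (\<Sum>i\<in>UNIV. ennreal (norm (V y *v b i) powr r) * indicator Q y) \<partial>lebesgue)"
  proof (intro nn_integral_mono)
    fix y
    have "ennreal (norm (V y *v (\<Sum>i\<in>UNIV. c i *\<^sub>R b i)) powr r)
        \<le> ennreal ((real CARD('d) * m) powr r) * (\<Sum>i\<in>UNIV. ennreal (norm (V y *v b i) powr r))"
      using ennreal_leI[OF ptw[of y]] by (simp add: ennreal_mult sum_nonneg sum_ennreal)
    then show "ennreal (norm (V y *v (\<Sum>i\<in>UNIV. c i *\<^sub>R b i)) powr r) * indicator Q y
      \<le> ennreal ((real CARD('d) * m) powr r) * (\<Sum>i\<in>UNIV. ennreal (norm (V y *v b i) powr r) * indicator Q y)"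
      by (auto simp: indicator_def)
  qed
  also have "\<dots> = ennreal ((real CARD('d) * m) powr r) * (\<Sum>i\<in>UNIV. ennreal (\<phi> Q (b i)) * leb Q)"
    by (subst nn_integral_cmult, measurable, subst nn_integral_sum, measurable) (simp add: phi_eq[OF Q])
  also have "\<dots> = ennreal ((real CARD('d) * m) powr r * (\<Sum>i\<in>UNIV. \<phi> Q (b i))) * leb Q"
    by (simp add: sum_distrib_right[symmetric] sum_ennreal phi_nonneg ennreal_mult sum_nonneg mult.assoc)
  finally show ?thesis
    unfolding grid_emeasure(1)[OF Q] using grid_emeasure(2)[OF Q] phi_nonneg
    by (simp add: ennreal_mult[symmetric] sum_nonneg ennreal_le_iff)
qed

lemma N_nonneg: "0 \<le> N Q x"
  unfolding N_def by (intro sum_nonneg phi_nonneg)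

text \<open>With \<open>c = V x *v v\<close> one has \<open>v = W x *v c\<close>, and expanding
  \<open>c\<close> in the standard basis leads to the vectors that enter \<open>N\<close>. So a
  bound on \<open>N Q x\<close> bounds the weight at \<open>x\<close> from below by a multiple of
  its average.\<close>

lemma phi_le_N: assumes Q: "Q \<in> grid"
  shows "\<phi> Q v \<le> real CARD('d) powr r * N Q x * norm (V x *v v) powr r"
proof -
  define c where "c = V x *v v"
  have "v = W x *v c" unfolding c_def W_V_apply ..
  also have "c = (\<Sum>i\<in>UNIV. c $ i *\<^sub>R axis i 1)"
    using basis_expansion[of c] by (simp add: scalar_mult_eq_scaleR)
  finally have v: "v = (\<Sum>i\<in>UNIV. c $ i *\<^sub>R (W x *v axis i 1))"
    by (simp add: matrix_vector_mult_sum_right matrix_vector_mult_scaleR)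
  have "\<phi> Q v \<le> (real CARD('d) * norm c) powr r * N Q x"
    unfolding N_def by (subst v, rule phi_sum_le[OF Q]) (rule component_le_norm_cart)
  then show ?thesis unfolding c_def by (simp add: powr_mult mult_ac)
qed

text \<open>By Tonelli from joint measurability. Borel measurability in \<open>v\<close> is what
  permits composition with \<open>W x *v axis i 1\<close>.\<close>

lemma phi_measurable [measurable]: assumes "Q \<in> grid" shows "\<phi> Q \<in> borel_measurable borel"
proof -
  interpret sigma_finite_measure "lebesgue :: 'a measure" by (rule sigma_finite_lebesgue)
  note [measurable] = grid_sets[OF assms]
  have "continuous_on UNIV (\<lambda>z::(real^'d) \<times> (real^'d^'d). snd z *v fst z)"
    unfolding matrix_vector_mult_def by (intro continuous_intros)
  then have [measurable]: "(\<lambda>z::(real^'d) \<times> (real^'d^'d). snd z *v fst z) \<in> borel_measurable borel"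
    by (rule borel_measurable_continuous_onI)
  have "(\<lambda>z::(real^'d) \<times> 'a. (fst z, V (snd z))) \<in> borel \<Otimes>\<^sub>M lebesgue \<rightarrow>\<^sub>M borel \<Otimes>\<^sub>M borel"
    by measurable
  then have "(\<lambda>z::(real^'d) \<times> 'a. (fst z, V (snd z))) \<in> borel \<Otimes>\<^sub>M lebesgue \<rightarrow>\<^sub>M borel"
    by (simp add: borel_prod)
  from measurable_compose[OF this \<open>(\<lambda>z. snd z *v fst z) \<in> borel_measurable borel\<close>]
  have [measurable]: "(\<lambda>z::(real^'d) \<times> 'a. V (snd z) *v fst z) \<in> borel_measurable (borel \<Otimes>\<^sub>M lebesgue)"
    by simp
  have "(\<lambda>v. \<integral>\<^sup>+y. (\<lambda>z. ennreal (norm (V (snd z) *v fst z) powr r) * indicator Q (snd z)) (v, y) \<partial>lebesgue)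
      \<in> borel_measurable borel"
    by (rule borel_measurable_nn_integral_fst) measurable
  then show ?thesis unfolding weight_avg_def by simp
qed

lemma W_apply_measurable [measurable]: "(\<lambda>y. W y *v v) \<in> borel_measurable lebesgue"
  by (rule borel_measurable_matrix_vector_mult) measurable

lemma N_measurable [measurable]: "Q \<in> grid \<Longrightarrow> N Q \<in> borel_measurable lebesgue"
  unfolding N_def by measurable

lemma Np_measurable [measurable]: "Q \<in> grid \<Longrightarrow> Np Q \<in> borel_measurable lebesgue"
  unfolding Np_def by measurable

lemma Np_integral: "Q \<in> grid \<Longrightarrow> (\<integral>\<^sup>+x\<in>Q. ennreal (Np Q x) \<partial>lebesgue) \<le> ennreal B * leb Q"
  unfolding Np_def N_def by (rule muckenhoupt)

definition \<delta> :: real where "\<delta> = 1 / (4 * real CARD('d) powr r * (4 * B) powr (r - 1))"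

lemma \<delta>_pos: "0 < \<delta>"
  unfolding \<delta>_def using d_ge_1 B_pos by auto

text \<open>Chebyshev's inequality gives \<open>Np Q x \<le> 4 * B\<close> outside a quarter of
  \<open>Q\<close>. A set \<open>E\<close> of at least half the measure therefore keeps a quarter of
  \<open>Q\<close> on which \<open>phi_le_N\<close> bounds the weight from below by its average.
  That quarter and the level \<open>4 * B\<close> make up \<open>\<delta>\<close>, which does not
  depend on \<open>v\<close>.\<close>

lemma A_infty:
  assumes Q: "Q \<in> grid" and E [measurable]: "E \<in> sets lebesgue" and EQ: "E \<subseteq> Q"
    and half: "leb Q \<le> 2 * leb E"
  shows "ennreal \<delta> * (\<integral>\<^sup>+x\<in>Q. ennreal (norm (V x *v v) powr r) \<partial>lebesgue)
    \<le> (\<integral>\<^sup>+x\<in>E. ennreal (norm (V x *v v) powr r) \<partial>lebesgue)"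
proof -
  note [measurable] = grid_sets[OF Q] Np_measurable[OF Q]
  define Bad where "Bad = {x\<in>space lebesgue. x \<in> Q \<and> 4 * B < Np Q x}"
  have Badm [measurable]: "Bad \<in> sets lebesgue" unfolding Bad_def by measurable
  have Qf: "Q \<in> lmeasurable" using Q q_lmeasurable unfolding grid_def by auto
  have Badf: "Bad \<in> lmeasurable" by (rule fmeasurableI2[OF Qf]) (auto simp: Bad_def)
  have Ef: "E \<in> lmeasurable" by (rule fmeasurableI2[OF Qf]) (use EQ in auto)
  define G where "G = E - Bad"
  have Gf: "G \<in> lmeasurable" unfolding G_def by (rule fmeasurableI2[OF Qf]) (use EQ in auto)
  then have [measurable]: "G \<in> sets lebesgue" by auto
  have "ennreal (4 * B) * leb Bad = (\<integral>\<^sup>+x. ennreal (4 * B) * indicator Bad x \<partial>lebesgue)"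
    by (simp add: nn_integral_cmult_indicator)
  also have "\<dots> \<le> (\<integral>\<^sup>+x\<in>Q. ennreal (Np Q x) \<partial>lebesgue)"
    by (intro nn_integral_mono) (auto simp: Bad_def indicator_def intro!: ennreal_leI)
  also have "\<dots> \<le> ennreal B * leb Q" by (rule Np_integral[OF Q])
  finally have "4 * B * vol Bad \<le> B * vol Q"
    using Badf Qf B_pos by (simp add: emeasure_eq_measure2 ennreal_mult[symmetric] ennreal_le_iff)
  then have bad: "4 * vol Bad \<le> vol Q" using B_pos by simp
  have half': "vol Q \<le> 2 * vol E"
    using half Qf Ef by (simp add: emeasure_eq_measure2 ennreal_mult[symmetric] ennreal_le_iff flip: ennreal_numeral)
  have "vol E \<le> vol (G \<union> Bad)"
    by (rule measure_mono_fmeasurable) (use Gf Badf Ef in \<open>auto simp: G_def\<close>)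
  also have "\<dots> \<le> vol G + vol Bad" by (rule measure_Un_le) auto
  finally have G: "vol Q \<le> 4 * vol G" using bad half' by linarith
  let ?c = "real CARD('d) powr r * (4 * B) powr (r - 1)"
  have c: "0 < ?c" using d_ge_1 B_pos by auto
  have ptw: "\<phi> Q v \<le> ?c * norm (V x *v v) powr r" if "x \<in> G" for x
  proof -
    have "Np Q x \<le> 4 * B" using that EQ unfolding G_def Bad_def by auto
    then have "(N Q x powr (1 / (r - 1))) powr (r - 1) \<le> (4 * B) powr (r - 1)"
      unfolding Np_def using r_gt_1 by (intro powr_mono2) auto
    then have "N Q x \<le> (4 * B) powr (r - 1)" using r_gt_1 N_nonneg[of Q x] by (simp add: powr_powr)
    then have "real CARD('d) powr r * N Q x * norm (V x *v v) powr r \<le> ?c * norm (V x *v v) powr r"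
      by (intro mult_right_mono mult_left_mono) auto
    then show ?thesis using phi_le_N[OF Q, of v x] by linarith
  qed
  have "ennreal (\<phi> Q v * vol G) = (\<integral>\<^sup>+x. ennreal (\<phi> Q v) * indicator G x \<partial>lebesgue)"
    using Gf phi_nonneg by (simp add: nn_integral_cmult_indicator emeasure_eq_measure2 ennreal_mult)
  also have "\<dots> \<le> (\<integral>\<^sup>+x. ennreal ?c * (ennreal (norm (V x *v v) powr r) * indicator E x) \<partial>lebesgue)"
    using ptw G_def by (intro nn_integral_mono) (auto simp: indicator_def ennreal_mult[symmetric] intro!: ennreal_leI)
  also have "\<dots> = ennreal ?c * (\<integral>\<^sup>+x\<in>E. ennreal (norm (V x *v v) powr r) \<partial>lebesgue)"
    by (rule nn_integral_cmult) measurable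
  finally have 1: "ennreal (\<phi> Q v * vol G) \<le> ennreal ?c * (\<integral>\<^sup>+x\<in>E. ennreal (norm (V x *v v) powr r) \<partial>lebesgue)" .
  have "ennreal \<delta> * (\<integral>\<^sup>+x\<in>Q. ennreal (norm (V x *v v) powr r) \<partial>lebesgue) = ennreal (1 / ?c) * ennreal (\<phi> Q v * (vol Q / 4))"
    unfolding phi_eq[OF Q] grid_emeasure(1)[OF Q] \<delta>_def using c phi_nonneg[of Q v]
    by (simp add: ennreal_mult[symmetric] field_simps)
  also have "\<dots> \<le> ennreal (1 / ?c) * ennreal (\<phi> Q v * vol G)"
    using G phi_nonneg[of Q v] by (intro mult_left_mono ennreal_leI) auto
  also have "\<dots> \<le> ennreal (1 / ?c) * (ennreal ?c * (\<integral>\<^sup>+x\<in>E. ennreal (norm (V x *v v) powr r) \<partial>lebesgue))"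
    by (intro mult_left_mono 1) auto
  also have "\<dots> = (\<integral>\<^sup>+x\<in>E. ennreal (norm (V x *v v) powr r) \<partial>lebesgue)"
    unfolding mult.assoc[symmetric] using c by (subst ennreal_mult[symmetric]) auto
  finally show ?thesis .
qed

text \<open>Take \<open>E = Q\<close> in \<open>A_infty\<close> for a nonzero vector, whose average
  is positive and finite.\<close>

lemma \<delta>_le_1: "\<delta> \<le> 1"
proof -
  fix x :: 'a and i :: 'd
  let ?Q = "q 0 x" and ?v = "axis i 1 :: real^'d"
  have "?v \<noteq> 0" by (simp add: axis_eq_0_iff)
  have Q: "?Q \<in> grid" by (rule q_in_grid)
  have "ennreal \<delta> * (ennreal (\<phi> ?Q ?v) * leb ?Q) \<le> ennreal (\<phi> ?Q ?v) * leb ?Q"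
    using A_infty[OF Q grid_sets[OF Q], of ?v] unfolding phi_eq[OF Q] by (simp add: mult_2)
  then have "\<delta> * (\<phi> ?Q ?v * vol ?Q) \<le> 1 * (\<phi> ?Q ?v * vol ?Q)"
    unfolding grid_emeasure(1)[OF Q] using \<delta>_pos phi_nonneg[of ?Q ?v]
    by (simp add: ennreal_mult[symmetric] ennreal_le_iff)
  moreover have "0 < \<phi> ?Q ?v * vol ?Q"
    using phi_pos[OF Q \<open>?v \<noteq> 0\<close>] grid_emeasure(2)[OF Q] by simp
  ultimately show ?thesis by (simp only: mult_le_cancel_right_pos)
qed

end

section \<open>Goldberg's stopping-time argument\<close>

context dyadic_weight
begin

text \<open>The point is that the unit ball of \<open>\<phi> P\<close> is bounded: integrating
  \<open>norm v \<le> m y * norm (V y *v v)\<close> shows that \<open>\<phi> P v\<close> is at least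
  a positive multiple of \<open>norm v powr r\<close>.\<close>

lemma ex_reference_basis:
  assumes P: "P \<in> grid"
  shows "\<exists>b :: 'd \<Rightarrow> real^'d. (\<forall>i. \<phi> P (b i) \<le> 1) \<and>
    (\<forall>v. \<phi> P v \<le> 1 \<longrightarrow> (\<exists>c. (\<forall>i. \<bar>c i\<bar> \<le> 2) \<and> v = (\<Sum>i\<in>UNIV. c i *\<^sub>R b i)))"
proof -
  note [measurable] = grid_sets[OF P]
  \<comment> \<open>The summand 1 keeps \<open>m y powr (- r)\<close> at most 1, so its integral
    over \<open>P\<close> is finite even if \<open>W\<close> is not integrable there.\<close>
  define m where "m y = 1 + (\<Sum>i\<in>UNIV. norm (W y $ i))" for y
  have m1: "1 \<le> m y" for y unfolding m_def by (simp add: sum_nonneg)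
  have "continuous_on UNIV (\<lambda>A::real^'d^'d. 1 + (\<Sum>i\<in>UNIV. norm (A $ i)))"
    by (intro continuous_intros)
  then have [measurable]: "m \<in> borel_measurable lebesgue"
    unfolding m_def using borel_measurable_continuous_on[OF _ W_measurable] by blast
  define I where "I = (\<integral>\<^sup>+y\<in>P. ennreal (m y powr (- r)) \<partial>lebesgue)"
  have "I \<le> (\<integral>\<^sup>+y\<in>P. 1 \<partial>lebesgue)" unfolding I_def
  proof (intro nn_integral_mono mult_right_mono)
    fix y
    have "m y powr (- r) \<le> 1 powr (- r)" using m1[of y] r_gt_1 by (intro powr_mono2') auto
    then show "ennreal (m y powr - r) \<le> 1" using ennreal_leI by fastforce
  qed auto
  also have "\<dots> = leb P" by simp
  finally have I_fin: "I < \<infinity>"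
    using grid_emeasure(1)[OF P] by (metis ennreal_less_top infinity_ennreal_def le_less_trans)
  have "I \<noteq> 0"
  proof
    assume "I = 0"
    then have "AE y in lebesgue. ennreal (m y powr (- r)) * indicator P y = 0"
      unfolding I_def by (subst (asm) nn_integral_0_iff_AE) auto
    moreover have "0 < m y powr (- r)" for y using m1[of y] by auto
    ultimately have "AE y in lebesgue. y \<notin> P" by (auto simp: indicator_def)
    then have "leb P = 0" using AE_iff_measurable[of P lebesgue "\<lambda>y. y \<notin> P"] by auto
    then show False using grid_emeasure[OF P] by simp
  qed
  then obtain t where t: "I = ennreal t" "0 < t"
    using I_fin by (metis ennreal_cases ennreal_eq_0_iff infinity_ennreal_def less_irrefl not_less)
  have lower: "norm v powr r * t \<le> \<phi> P v * vol P" for v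
  proof -
    have "ennreal (norm v powr r) * I = (\<integral>\<^sup>+y. ennreal (norm v powr r) * (ennreal (m y powr (- r)) * indicator P y) \<partial>lebesgue)"
      unfolding I_def by (rule nn_integral_cmult[symmetric]) measurable
    also have "\<dots> \<le> (\<integral>\<^sup>+y\<in>P. ennreal (norm (V y *v v) powr r) \<partial>lebesgue)"
    proof (intro nn_integral_mono)
      fix y
      have "norm v = norm (W y *v (V y *v v))" by (simp add: W_V_apply)
      also have "\<dots> \<le> (\<Sum>i\<in>UNIV. norm (W y $ i)) * norm (V y *v v)" by (rule norm_matrix_vector_le)
      also have "\<dots> \<le> m y * norm (V y *v v)" unfolding m_def by (intro mult_right_mono) auto
      finally have "norm v powr r \<le> (m y * norm (V y *v v)) powr r" using r_gt_1 by (intro powr_mono2) auto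
      then have "norm v powr r \<le> m y powr r * norm (V y *v v) powr r" by (simp add: powr_mult)
      then have "norm v powr r * m y powr (- r) \<le> norm (V y *v v) powr r"
        using m1[of y] by (simp add: powr_minus field_simps)
      then have "ennreal (norm v powr r) * ennreal (m y powr (- r)) \<le> ennreal (norm (V y *v v) powr r)"
        by (simp add: ennreal_mult[symmetric] ennreal_leI)
      then show "ennreal (norm v powr r) * (ennreal (m y powr (- r)) * indicator P y)
          \<le> ennreal (norm (V y *v v) powr r) * indicator P y"
        by (auto simp: indicator_def)
    qed
    also have "\<dots> = ennreal (\<phi> P v) * leb P" by (rule phi_eq[OF P])
    finally show ?thesis
      unfolding t grid_emeasure(1)[OF P] using t phi_nonneg[of P v]
      by (simp add: ennreal_mult[symmetric] ennreal_le_iff)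
  qed
  have bdd: "bounded {v. \<phi> P v \<le> 1}"
    unfolding bounded_iff
  proof (intro exI ballI)
    fix v assume "v \<in> {v. \<phi> P v \<le> 1}"
    then have "\<phi> P v * vol P \<le> 1 * vol P" by (intro mult_right_mono) auto
    then have "norm v powr r * t \<le> vol P" using lower[of v] by linarith
    then have "norm v powr r \<le> vol P / t" using t by (simp add: field_simps)
    then have "(norm v powr r) powr (1 / r) \<le> (vol P / t) powr (1 / r)"
      using r_gt_1 by (intro powr_mono2) auto
    then show "norm v \<le> (vol P / t) powr (1 / r)" using r_gt_1 by (simp add: powr_powr)
  qed
  have absorb: "\<exists>c>0. c *\<^sub>R v \<in> {v. \<phi> P v \<le> 1}" for v
  proof -
    define c where "c = (1 / (1 + \<phi> P v)) powr (1 / r)"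
    have c: "0 < c" unfolding c_def using phi_nonneg[of P v] by simp
    have "\<bar>c\<bar> powr r = 1 / (1 + \<phi> P v)"
      unfolding c_def using phi_nonneg[of P v] r_gt_1 by (simp add: powr_powr)
    then have "\<phi> P (c *\<^sub>R v) \<le> 1" using phi_scale[OF P, of c v] phi_nonneg[of P v] by simp
    then show ?thesis using c by auto
  qed
  show ?thesis using ex_near_Auerbach_basis[OF bdd absorb] by simp
qed

text \<open>Coefficients of size 2 on d vectors give the first factor of the bound, d averages of
  size at most 2 d the second.\<close>

definition \<Lambda> :: real where
  "\<Lambda> = (real CARD('d) * 2) powr r * (real CARD('d) * (2 * real CARD('d)))"

text \<open>Twice the cost \<open>\<mu> = \<Lambda> powr (1 / (r - 1))\<close> of one stopping step:
  the stopped part fills at most half of the cube, so the constant solves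
  \<open>C = \<mu> + C / 2\<close>.\<close>

definition C\<^sub>G :: real where "C\<^sub>G = 2 * \<Lambda> powr (1 / (r - 1))"

lemma \<Lambda>_ge_1: "1 \<le> \<Lambda>"
proof -
  have "1 \<le> (real CARD('d) * 2) powr r" using d_ge_1 r_gt_1 by (intro ge_one_powr_ge_zero) linarith+
  moreover have "1 \<le> real CARD('d) * (2 * real CARD('d))"
    using mult_mono[OF d_ge_1, of 1 "2 * real CARD('d)"] d_ge_1 by auto
  ultimately show ?thesis unfolding \<Lambda>_def using mult_mono[of 1 "(real CARD('d) * 2) powr r" 1] by auto
qed

lemma C\<^sub>G_pos: "0 < C\<^sub>G"
  unfolding C\<^sub>G_def using \<Lambda>_ge_1 by auto

text \<open>Normalised to \<open>\<phi> P w = 1\<close>, a vector has coefficients at most 2 in the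
  reference basis. Controlling d vectors over \<open>R\<close> thus controls all directions, which
  is what the stopping rule relies on.\<close>

lemma phi_comparison:
  fixes b :: "'d \<Rightarrow> real^'d"
  assumes P: "P \<in> grid" and R: "R \<in> grid"
    and b: "\<And>v. \<phi> P v \<le> 1 \<Longrightarrow> \<exists>c. (\<forall>i. \<bar>c i\<bar> \<le> 2) \<and> v = (\<Sum>i\<in>UNIV. c i *\<^sub>R b i)"
    and small: "\<And>i. \<phi> R (b i) \<le> 2 * real CARD('d)"
  shows "\<phi> R w \<le> \<Lambda> * \<phi> P w"
proof (cases "w = 0")
  case True
  then show ?thesis using phi_scale[OF R, of 0 w] phi_nonneg[of P w] \<Lambda>_ge_1 r_gt_1 by simp
next
  case False
  define c where "c = (1 / \<phi> P w) powr (1 / r)"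
  have pos: "0 < \<phi> P w" by (rule phi_pos[OF P False])
  have c: "\<bar>c\<bar> powr r = 1 / \<phi> P w" unfolding c_def using pos r_gt_1 by (simp add: powr_powr)
  then have "\<phi> P (c *\<^sub>R w) \<le> 1" using phi_scale[OF P, of c w] pos by simp
  then obtain a where a: "\<And>i. \<bar>a i\<bar> \<le> 2" "c *\<^sub>R w = (\<Sum>i\<in>UNIV. a i *\<^sub>R b i)" using b by blast
  have "\<phi> R (c *\<^sub>R w) \<le> (real CARD('d) * 2) powr r * (\<Sum>i\<in>UNIV. \<phi> R (b i))"
    unfolding a(2) by (rule phi_sum_le[OF R a(1)])
  also have "\<dots> \<le> (real CARD('d) * 2) powr r * (real CARD('d) * (2 * real CARD('d)))"
    using sum_bounded_above[of UNIV "\<lambda>i. \<phi> R (b i)" "2 * real CARD('d)"] small by (intro mult_left_mono) auto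
  finally have "\<bar>c\<bar> powr r * \<phi> R w \<le> \<Lambda>" unfolding \<Lambda>_def phi_scale[OF R] .
  then show ?thesis unfolding c using pos by (simp add: field_simps)
qed

lemma q_piecewise_measurable:
  assumes "\<And>Q. Q \<in> grid \<Longrightarrow> F Q \<in> borel_measurable lebesgue"
  shows "(\<lambda>x. F (q i x) x) \<in> borel_measurable lebesgue"
proof (rule measurable_compose_countable'[where I="range (q i)"])
  show "F Q \<in> borel_measurable lebesgue" if "Q \<in> range (q i)" for Q
    using that assms q_in_grid by auto
  show "q i \<in> lebesgue \<rightarrow>\<^sub>M count_space (range (q i))"
  proof (subst measurable_count_space_eq_countable[OF q_countable], intro conjI ballI)
    fix Q assume "Q \<in> range (q i)"
    then obtain z where z: "Q = q i z" by auto
    have "q i -` {Q} \<inter> space lebesgue = Q" using q_mem q_eq unfolding z by auto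
    then show "q i -` {Q} \<inter> space lebesgue \<in> sets lebesgue" using grid_sets[OF q_in_grid, of i z] z by simp
  qed auto
qed (rule q_countable)

text \<open>Cut off at generation \<open>m\<close> so that the recursion from \<open>k\<close>
  towards \<open>m\<close> ends; monotone convergence removes the cut-off later.\<close>

definition Hmax :: "nat \<Rightarrow> nat \<Rightarrow> 'a \<Rightarrow> ennreal" where
  "Hmax k m x = (SUP i\<in>{k..m}. ennreal (Np (q i x) x))"

lemma Hmax_measurable [measurable]: "Hmax k m \<in> borel_measurable lebesgue"
proof -
  have [measurable]: "(\<lambda>x. Np (q i x) x) \<in> borel_measurable lebesgue" for i
    by (rule q_piecewise_measurable) (rule Np_measurable)
  have "(\<lambda>x. SUP i\<in>{k..m}. ennreal (Np (q i x) x)) \<in> borel_measurable lebesgue"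
    by (rule borel_measurable_SUP) auto
  then show ?thesis unfolding Hmax_def[abs_def] .
qed

text \<open>Goldberg's stopping-time argument: once the average over \<open>R \<subseteq> P\<close> is not dominated by the one over
  \<open>P\<close>, stop and recurse; the stopping cubes fill at most half of \<open>P\<close>.\<close>

lemma nn_integral_Hmax_le:
  assumes "P \<in> range (q k)"
  shows "(\<integral>\<^sup>+x\<in>P. Hmax k m x \<partial>lebesgue) \<le> ennreal (C\<^sub>G * B) * leb P"
  using assms
proof (induction "m + 1 - k" arbitrary: k P rule: less_induct)
  case less
  show ?case
  proof (cases "k \<le> m")
    case False
    then show ?thesis unfolding Hmax_def by (simp add: bot_ennreal)
  next
    case True
    obtain z0 where z0: "P = q k z0" using less.prems by auto
    have P: "P \<in> grid" unfolding z0 by (rule q_in_grid)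
    have qP: "q k x = P" if "x \<in> P" for x using that q_eq unfolding z0 by auto
    note [measurable] = grid_sets[OF P] Np_measurable[OF P]
    obtain b :: "'d \<Rightarrow> real^'d" where b: "\<forall>i. \<phi> P (b i) \<le> 1"
      "\<forall>v. \<phi> P v \<le> 1 \<longrightarrow> (\<exists>c. (\<forall>i. \<bar>c i\<bar> \<le> 2) \<and> v = (\<Sum>i\<in>UNIV. c i *\<^sub>R b i))"
      using ex_reference_basis[OF P] by (elim exE conjE)
    \<comment> \<open>The averages over \<open>P\<close> of the d basis weights add up to at most d,
      so the threshold 2 d makes the stopping cubes fill at most half of \<open>P\<close>.\<close>
    define L where "L = 2 * real CARD('d)"
    define S where "S = {q i x | i x. k < i \<and> i \<le> m \<and> x \<in> P \<and> (\<exists>l. L < \<phi> (q i x) (b l))}"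
    have Sg: "S \<subseteq> grid" unfolding S_def by (auto simp: q_in_grid)
    note [measurable] = Union_grid_sets[OF Sg]
    let ?\<Omega> = "\<Union>S"
    have \<Omega>P: "?\<Omega> \<subseteq> P"
    proof
      fix y assume "y \<in> ?\<Omega>"
      then obtain i x where "k < i" "x \<in> P" "y \<in> q i x" unfolding S_def by auto
      then show "y \<in> P" using q_antimono[of k i x] qP[of x] by auto
    qed
    let ?g = "\<lambda>y. \<Sum>l\<in>UNIV. ennreal (norm (V y *v b l) powr r)"
    have "ennreal L * leb ?\<Omega> = (\<integral>\<^sup>+x\<in>?\<Omega>. ennreal L \<partial>lebesgue)"
      by (simp add: nn_integral_cmult_indicator)
    also have "\<dots> \<le> (\<integral>\<^sup>+x\<in>?\<Omega>. ?g x \<partial>lebesgue)"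
    proof (rule cover_le[OF Sg])
      fix Q assume "maximal_in S Q"
      then have "Q \<in> S" unfolding maximal_in_def by auto
      then obtain l where l: "L < \<phi> Q (b l)" unfolding S_def by auto
      have Q: "Q \<in> grid" using \<open>Q \<in> S\<close> Sg by auto
      note [measurable] = grid_sets[OF Q]
      have "(\<integral>\<^sup>+x\<in>Q. ennreal L \<partial>lebesgue) = ennreal L * leb Q"
        by (simp add: nn_integral_cmult_indicator)
      also have "\<dots> \<le> ennreal (\<phi> Q (b l)) * leb Q"
        using l by (intro mult_right_mono ennreal_leI) auto
      also have "\<dots> = (\<integral>\<^sup>+x\<in>Q. ennreal (norm (V x *v b l) powr r) \<partial>lebesgue)" by (rule phi_eq[OF Q, symmetric])
      also have "\<dots> \<le> (\<integral>\<^sup>+x\<in>Q. ?g x \<partial>lebesgue)"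
        by (intro nn_integral_mono mult_right_mono member_le_sum) auto
      finally show "(\<integral>\<^sup>+x\<in>Q. ennreal L \<partial>lebesgue) \<le> (\<integral>\<^sup>+x\<in>Q. ?g x \<partial>lebesgue)" .
    qed measurable
    also have "\<dots> \<le> (\<integral>\<^sup>+x\<in>P. ?g x \<partial>lebesgue)" by (rule nn_set_integral_set_mono[OF \<Omega>P])
    also have "\<dots> = (\<Sum>l\<in>UNIV. \<integral>\<^sup>+x\<in>P. ennreal (norm (V x *v b l) powr r) \<partial>lebesgue)"
      unfolding sum_distrib_right by (rule nn_integral_sum) measurable
    also have "\<dots> \<le> (\<Sum>l\<in>(UNIV :: 'd set). 1 * leb P)"
      unfolding phi_eq[OF P] using b(1) by (intro sum_mono mult_right_mono) (auto simp: ennreal_le_1)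
    also have "\<dots> = ennreal (real CARD('d)) * leb P" by (simp add: ennreal_of_nat_eq_real_of_nat)
    finally have 1: "ennreal L * leb ?\<Omega> \<le> ennreal (real CARD('d)) * leb P" .
    have Pf: "P \<in> lmeasurable" using z0 q_lmeasurable by simp
    have \<Omega>f: "?\<Omega> \<in> lmeasurable" by (rule fmeasurableI2[OF Pf \<Omega>P]) measurable
    have "L * vol ?\<Omega> \<le> real CARD('d) * vol P"
      using 1 Pf \<Omega>f by (simp add: emeasure_eq_measure2 ennreal_mult[symmetric] ennreal_le_iff L_def)
    then have half: "2 * vol ?\<Omega> \<le> vol P"
      unfolding L_def using d_ge_1 by simp
    let ?\<mu> = "\<Lambda> powr (1 / (r - 1))"
    have \<mu>: "1 \<le> ?\<mu>" using \<Lambda>_ge_1 r_gt_1 by (intro ge_one_powr_ge_zero) auto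
    \<comment> \<open>Off \<open>S\<close> no reference vector exceeds the threshold, so
      \<open>phi_comparison\<close> bounds every direction by its average over
      \<open>P\<close>.\<close>
    have calm: "Np (q i x) x \<le> ?\<mu> * Np P x" if i: "k \<le> i" "i \<le> m" and x: "x \<in> P" and nS: "q i x \<notin> S" for i x
    proof (cases "i = k")
      case True
      then show ?thesis using qP[OF x] \<mu> mult_right_mono[OF \<mu>, of "Np P x"] unfolding Np_def by auto
    next
      case False
      have "\<phi> (q i x) (b l) \<le> L" for l
      proof (rule ccontr)
        assume "\<not> \<phi> (q i x) (b l) \<le> L"
        then have "q i x \<in> S"
          unfolding S_def using i x False by (intro CollectI exI[of _ i] exI[of _ x] conjI exI[of _ l]) auto
        then show False using nS by simp
      qed
      then have "\<phi> (q i x) w \<le> \<Lambda> * \<phi> P w" for w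
        using phi_comparison[OF P q_in_grid b(2)[rule_format]] unfolding L_def by simp
      then have "N (q i x) x \<le> \<Lambda> * N P x" unfolding N_def sum_distrib_left by (intro sum_mono)
      then have "Np (q i x) x \<le> (\<Lambda> * N P x) powr (1 / (r - 1))"
        unfolding Np_def using N_nonneg r_gt_1 by (intro powr_mono2) auto
      then show ?thesis unfolding Np_def by (simp add: powr_mult)
    qed
    have on_\<Omega>: "(\<integral>\<^sup>+x\<in>?\<Omega>. Hmax k m x \<partial>lebesgue) \<le> (\<integral>\<^sup>+x\<in>?\<Omega>. (ennreal (?\<mu> * Np P x) + ennreal (C\<^sub>G * B)) \<partial>lebesgue)"
    proof (rule cover_le[OF Sg])
      fix R assume max: "maximal_in S R"
      then have "R \<in> S" unfolding maximal_in_def by auto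
      then obtain j z where j: "R = q j z" "k < j" "j \<le> m" unfolding S_def by auto
      have Rg: "R \<in> grid" using \<open>R \<in> S\<close> Sg by auto
      note [measurable] = grid_sets[OF Rg]
      have RP: "R \<subseteq> P" using \<open>R \<in> S\<close> \<Omega>P by auto
      have ptw: "Hmax k m x \<le> ennreal (?\<mu> * Np P x) + Hmax j m x" if x: "x \<in> R" for x
        unfolding Hmax_def[of k]
      proof (rule SUP_least)
        fix i assume i: "i \<in> {k..m}"
        have Rx: "R = q j x" using q_eq[of x j z] x j by auto
        have upper: "ennreal (Np (q i' x) x) \<le> Hmax j m x" if "j \<le> i'" "i' \<le> m" for i'
          unfolding Hmax_def using that by (intro SUP_upper) auto
        show "ennreal (Np (q i x) x) \<le> ennreal (?\<mu> * Np P x) + Hmax j m x"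
        proof (cases "j \<le> i")
          case True
          then show ?thesis using upper[of i] i by (simp add: add_increasing)
        next
          case False
          show ?thesis
          \<comment> \<open>A selected cell of a generation before \<open>j\<close> contains
            \<open>R\<close>, hence equals it by maximality although the generations differ.\<close>
          proof (cases "q i x \<in> S")
            case True
            have "R \<subseteq> q i x" unfolding Rx using False by (intro q_antimono) auto
            then have "q i x = q j x" using max True Rx unfolding maximal_in_def by auto
            then show ?thesis using upper[of j] j by (simp add: add_increasing)
          next
            case False
            then show ?thesis using calm[of i x] i x RP by (intro add_increasing2) (auto intro!: ennreal_leI)
          qed
        qed
      qed
      have "(\<integral>\<^sup>+x\<in>R. Hmax k m x \<partial>lebesgue)
          \<le> (\<integral>\<^sup>+x. ennreal (?\<mu> * Np P x) * indicator R x + Hmax j m x * indicator R x \<partial>lebesgue)"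
        using ptw by (intro nn_integral_mono) (auto simp: indicator_def)
      also have "\<dots> = (\<integral>\<^sup>+x\<in>R. ennreal (?\<mu> * Np P x) \<partial>lebesgue) + (\<integral>\<^sup>+x\<in>R. Hmax j m x \<partial>lebesgue)"
        by (rule nn_integral_add) measurable
      also have "\<dots> \<le> (\<integral>\<^sup>+x\<in>R. ennreal (?\<mu> * Np P x) \<partial>lebesgue) + ennreal (C\<^sub>G * B) * leb R"
        using j by (intro add_left_mono less.hyps) auto
      also have "\<dots> = (\<integral>\<^sup>+x. ennreal (?\<mu> * Np P x) * indicator R x + ennreal (C\<^sub>G * B) * indicator R x \<partial>lebesgue)"
        by (subst nn_integral_add) (auto simp: nn_integral_cmult_indicator)
      finally show "(\<integral>\<^sup>+x\<in>R. Hmax k m x \<partial>lebesgue) \<le> (\<integral>\<^sup>+x\<in>R. (ennreal (?\<mu> * Np P x) + ennreal (C\<^sub>G * B)) \<partial>lebesgue)"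
        by (simp add: distrib_right)
    qed measurable
    have off_\<Omega>: "Hmax k m x \<le> ennreal (?\<mu> * Np P x)" if x: "x \<in> P - ?\<Omega>" for x
      unfolding Hmax_def
    proof (rule SUP_least)
      fix i assume "i \<in> {k..m}"
      moreover have "q i x \<notin> S" using x q_mem[of x i] by auto
      ultimately show "ennreal (Np (q i x) x) \<le> ennreal (?\<mu> * Np P x)"
        using calm[of i x] x by (intro ennreal_leI) auto
    qed
    have "(\<integral>\<^sup>+x\<in>P. Hmax k m x \<partial>lebesgue) = (\<integral>\<^sup>+x\<in>(P - ?\<Omega>) \<union> ?\<Omega>. Hmax k m x \<partial>lebesgue)"
      using \<Omega>P by (simp add: Un_absorb2)
    also have "\<dots> = (\<integral>\<^sup>+x\<in>P - ?\<Omega>. Hmax k m x \<partial>lebesgue) + (\<integral>\<^sup>+x\<in>?\<Omega>. Hmax k m x \<partial>lebesgue)"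
      by (intro nn_integral_disjoint_pair) auto
    also have "\<dots> \<le> (\<integral>\<^sup>+x\<in>P - ?\<Omega>. ennreal (?\<mu> * Np P x) \<partial>lebesgue) +
        (\<integral>\<^sup>+x\<in>?\<Omega>. (ennreal (?\<mu> * Np P x) + ennreal (C\<^sub>G * B)) \<partial>lebesgue)"
    proof (rule add_mono[OF _ on_\<Omega>])
      show "(\<integral>\<^sup>+x\<in>P - ?\<Omega>. Hmax k m x \<partial>lebesgue) \<le> (\<integral>\<^sup>+x\<in>P - ?\<Omega>. ennreal (?\<mu> * Np P x) \<partial>lebesgue)"
      proof (rule nn_integral_mono)
        fix x
        show "Hmax k m x * indicator (P - ?\<Omega>) x \<le> ennreal (?\<mu> * Np P x) * indicator (P - ?\<Omega>) x"
        proof (cases "x \<in> P - ?\<Omega>")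
          case True
          then show ?thesis using off_\<Omega>[OF True] by (simp only: indicator_simps(1) mult_1_right)
        next
          case False
          show ?thesis by (simp only: indicator_simps(2)[OF False] mult_zero_right order_refl)
        qed
      qed
    qed
    also have "\<dots> = (\<integral>\<^sup>+x. ennreal (?\<mu> * Np P x) * indicator (P - ?\<Omega>) x +
        (ennreal (?\<mu> * Np P x) + ennreal (C\<^sub>G * B)) * indicator ?\<Omega> x \<partial>lebesgue)"
      by (rule nn_integral_add[symmetric]) measurable
    also have "\<dots> = (\<integral>\<^sup>+x. (ennreal (?\<mu> * Np P x) * indicator P x + ennreal (C\<^sub>G * B) * indicator ?\<Omega> x) \<partial>lebesgue)"
    proof (rule nn_integral_cong)
      fix x
      have split: "indicator P x = (indicator (P - ?\<Omega>) x + indicator ?\<Omega> x :: ennreal)"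
        using \<Omega>P unfolding indicator_def by (cases "x \<in> ?\<Omega>") (simp_all add: subset_iff)
      show "ennreal (?\<mu> * Np P x) * indicator (P - ?\<Omega>) x +
          (ennreal (?\<mu> * Np P x) + ennreal (C\<^sub>G * B)) * indicator ?\<Omega> x =
          ennreal (?\<mu> * Np P x) * indicator P x + ennreal (C\<^sub>G * B) * indicator ?\<Omega> x"
        unfolding split distrib_left distrib_right by (simp only: add.assoc)
    qed
    also have "\<dots> = (\<integral>\<^sup>+x\<in>P. ennreal (?\<mu> * Np P x) \<partial>lebesgue) + ennreal (C\<^sub>G * B) * leb ?\<Omega>"
      by (subst nn_integral_add) (auto simp: nn_integral_cmult_indicator)
    also have "(\<integral>\<^sup>+x\<in>P. ennreal (?\<mu> * Np P x) \<partial>lebesgue) = ennreal ?\<mu> * (\<integral>\<^sup>+x\<in>P. ennreal (Np P x) \<partial>lebesgue)"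
    proof (subst nn_integral_cmult[symmetric])
      show "(\<lambda>x. ennreal (Np P x) * indicator P x) \<in> borel_measurable lebesgue" by measurable
    qed (auto intro!: nn_integral_cong simp: ennreal_mult Np_def mult.assoc)
    also have "ennreal ?\<mu> * (\<integral>\<^sup>+x\<in>P. ennreal (Np P x) \<partial>lebesgue) + ennreal (C\<^sub>G * B) * leb ?\<Omega>
        \<le> ennreal ?\<mu> * (ennreal B * leb P) + ennreal (C\<^sub>G * B) * leb ?\<Omega>"
      by (intro add_right_mono mult_left_mono Np_integral P) auto
    also have "\<dots> = ennreal (?\<mu> * B * vol P + C\<^sub>G * B * vol ?\<Omega>)"
      using \<mu> B_pos C\<^sub>G_pos Pf \<Omega>f
      by (simp add: emeasure_eq_measure2 ennreal_mult[symmetric] mult.assoc)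
    also have "\<dots> \<le> ennreal (C\<^sub>G * B * vol P)"
    proof (rule ennreal_leI)
      have "?\<mu> * B * (2 * vol ?\<Omega>) \<le> ?\<mu> * B * vol P"
        using half B_pos \<mu> by (intro mult_left_mono) auto
      then show "?\<mu> * B * vol P + C\<^sub>G * B * vol ?\<Omega> \<le> C\<^sub>G * B * vol P"
        unfolding C\<^sub>G_def by (simp add: algebra_simps)
    qed
    also have "\<dots> = ennreal (C\<^sub>G * B) * leb P"
      using B_pos C\<^sub>G_pos Pf by (simp add: emeasure_eq_measure2 ennreal_mult)
    finally show ?thesis .
  qed
qed

definition Hs :: "'a set set \<Rightarrow> 'a \<Rightarrow> ennreal" where
  "Hs S x = (SUP Q\<in>S. ennreal (Np Q x) * indicator Q x)"

lemma Hs_measurable [measurable]: assumes "S \<subseteq> grid" shows "Hs S \<in> borel_measurable lebesgue"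
proof -
  have "(\<lambda>x. ennreal (Np Q x) * indicator Q x) \<in> borel_measurable lebesgue" if "Q \<in> S" for Q
  proof -
    have "Q \<in> grid" using that assms by auto
    note [measurable] = grid_sets[OF this] Np_measurable[OF this]
    show ?thesis by measurable
  qed
  then show ?thesis unfolding Hs_def[abs_def] using countable_subgrid[OF assms] by (intro borel_measurable_SUP) auto
qed

text \<open>The members of \<open>S\<close> that meet a maximal \<open>P\<close> lie inside it, so
  the bound for chains starting at \<open>P\<close> applies, and the disjoint maximal cubes add up.
  The measure of the union on the right is what suits families selected by level.\<close>

lemma nn_integral_Hs_le:
  assumes S: "S \<subseteq> grid"
  shows "(\<integral>\<^sup>+x. Hs S x \<partial>lebesgue) \<le> ennreal (C\<^sub>G * B) * leb (\<Union>S)"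
proof -
  note [measurable] = Union_grid_sets[OF S] Hs_measurable[OF S]
  have out: "Hs S x = 0" if "x \<notin> \<Union>S" for x
  proof -
    have "Hs S x \<le> 0" unfolding Hs_def using that by (intro SUP_least) (auto simp: indicator_def)
    then show ?thesis by simp
  qed
  then have "(\<integral>\<^sup>+x. Hs S x \<partial>lebesgue) = (\<integral>\<^sup>+x\<in>\<Union>S. Hs S x \<partial>lebesgue)"
    by (intro nn_integral_cong) (auto simp: indicator_def)
  also have "\<dots> \<le> (\<integral>\<^sup>+x\<in>\<Union>S. ennreal (C\<^sub>G * B) \<partial>lebesgue)"
  proof (rule cover_le[OF S])
    fix P assume max: "maximal_in S P"
    then have "P \<in> S" unfolding maximal_in_def by auto
    then have Pg: "P \<in> grid" using S by auto
    then obtain k where k: "P \<in> range (q k)" unfolding grid_def by auto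
    have qP: "q k x = P" if "x \<in> P" for x using that k q_eq by auto
    note [measurable] = grid_sets[OF Pg]
    have "Hs S x \<le> (SUP m. Hmax k m x)" if x: "x \<in> P" for x
      unfolding Hs_def
    proof (rule SUP_least)
      fix Q assume Q: "Q \<in> S"
      show "ennreal (Np Q x) * indicator Q x \<le> (SUP m. Hmax k m x)"
      proof (cases "x \<in> Q")
        case True
        obtain i where i: "Q = q i x" using grid_ex_q[of Q x] Q S True by blast
        \<comment> \<open>If \<open>Q\<close> carries an index before that of \<open>P\<close>, then
          \<open>Q\<close> and \<open>P\<close> coincide and the index of \<open>P\<close>
          serves.\<close>
        define i' where "i' = max i k"
        have "Q \<subseteq> P" using maximal_inside[OF S max Q True x] .
        have "Q = q i' x"
        proof (cases "k \<le> i")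
          case False
          then have "P \<subseteq> Q" using q_antimono[of i k x] qP[OF x] i by auto
          then show ?thesis using \<open>Q \<subseteq> P\<close> qP[OF x] False i'_def by auto
        qed (use i i'_def in auto)
        then have "ennreal (Np Q x) \<le> Hmax k i' x"
          unfolding Hmax_def i'_def by (intro SUP_upper2[of "max i k"]) auto
        also have "\<dots> \<le> (SUP m. Hmax k m x)" by (rule SUP_upper) auto
        finally show ?thesis using True by simp
      qed simp
    qed
    then have "(\<integral>\<^sup>+x\<in>P. Hs S x \<partial>lebesgue) \<le> (\<integral>\<^sup>+x. (SUP m. Hmax k m x * indicator P x) \<partial>lebesgue)"
      by (intro nn_integral_mono) (auto simp: indicator_def)
    also have "\<dots> = (SUP m. \<integral>\<^sup>+x\<in>P. Hmax k m x \<partial>lebesgue)"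
    proof (rule nn_integral_monotone_convergence_SUP)
      show "incseq (\<lambda>m x. Hmax k m x * indicator P x)"
        unfolding Hmax_def by (intro incseq_SucI le_funI mult_right_mono SUP_subset_mono) auto
    qed measurable
    also have "\<dots> \<le> ennreal (C\<^sub>G * B) * leb P"
      using nn_integral_Hmax_le[OF k] by (intro SUP_least)
    also have "\<dots> = (\<integral>\<^sup>+x\<in>P. ennreal (C\<^sub>G * B) \<partial>lebesgue)" by (simp add: nn_integral_cmult_indicator)
    finally show "(\<integral>\<^sup>+x\<in>P. Hs S x \<partial>lebesgue) \<le> (\<integral>\<^sup>+x\<in>P. ennreal (C\<^sub>G * B) \<partial>lebesgue)" .
  qed measurable
  also have "\<dots> = ennreal (C\<^sub>G * B) * leb (\<Union>S)" by (simp add: nn_integral_cmult_indicator)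
  finally show ?thesis .
qed

end

section \<open>The dyadic maximal estimate\<close>

lemma Young_weighted:
  fixes \<tau> h \<eta> q :: real
  assumes "0 \<le> \<tau>" "0 \<le> h" "0 < \<eta>" "1 < q"
  shows "\<tau> * h \<le> \<eta> * \<tau> powr q + (1 / \<eta>) powr (1 / (q - 1)) * h powr (q / (q - 1))"
proof (cases "h \<le> \<eta> * \<tau> powr (q - 1)")
  \<comment> \<open>No optimal constants are sought: in each of the two cases one term on the right
    suffices.\<close>
  case True
  then have "\<tau> * h \<le> \<tau> * (\<eta> * \<tau> powr (q - 1))" using assms by (intro mult_left_mono) auto
  also have "\<tau> * (\<eta> * \<tau> powr (q - 1)) = \<eta> * (\<tau> powr 1 * \<tau> powr (q - 1))" using assms by simp
  also have "\<dots> = \<eta> * \<tau> powr q" unfolding powr_add[symmetric] by simp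
  finally show ?thesis using assms by (simp add: add_increasing2)
next
  case False
  then have "\<tau> powr (q - 1) \<le> 1 / \<eta> * h" using assms by (simp add: field_simps)
  then have "(\<tau> powr (q - 1)) powr (1 / (q - 1)) \<le> (1 / \<eta> * h) powr (1 / (q - 1))"
    using assms by (intro powr_mono2) auto
  then have "\<tau> \<le> (1 / \<eta>) powr (1 / (q - 1)) * h powr (1 / (q - 1))"
    using assms unfolding powr_mult powr_powr by simp
  then have "\<tau> * h \<le> (1 / \<eta>) powr (1 / (q - 1)) * h powr (1 / (q - 1)) * h"
    using assms by (intro mult_right_mono) auto
  also have "\<dots> = (1 / \<eta>) powr (1 / (q - 1)) * (h powr (1 / (q - 1)) * h powr 1)" using assms by simp
  also have "\<dots> = (1 / \<eta>) powr (1 / (q - 1)) * h powr (q / (q - 1))"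
    unfolding powr_add[symmetric] using assms by (simp add: field_simps)
  finally show ?thesis using assms by (simp add: add_increasing)
qed

lemma le_one_plus_powr:
  fixes x r :: real
  assumes "0 \<le> x" "1 \<le> r"
  shows "x \<le> 1 + x powr r"
proof (cases "x \<le> 1")
  case False
  then have "x powr 1 \<le> x powr r" using assms by (intro powr_mono) auto
  then show ?thesis using False by simp
qed (simp add: add_increasing2)

lemma superlevel_sets:
  fixes g :: "'a::euclidean_space \<Rightarrow> real"
  assumes [measurable]: "g \<in> borel_measurable lebesgue"
  shows "{y. t < 8 * g y} \<in> sets lebesgue"
proof -
  have "{y\<in>space lebesgue. t < 8 * g y} \<in> sets lebesgue" by measurable
  then show ?thesis by simp
qed

text \<open>Strictness on the left, hence the ceiling minus 1, matches the strict inequality that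
  defines the level families.\<close>

lemma dyadic_level:
  fixes y :: real
  assumes "0 < y"
  obtains j :: int where "2 powr j < y" "y \<le> 2 powr (real_of_int j + 1)"
proof -
  define j where "j = \<lceil>log 2 y\<rceil> - 1"
  have "real_of_int j < log 2 y" "log 2 y \<le> real_of_int j + 1" unfolding j_def by linarith+
  then have "2 powr j < y" "y \<le> 2 powr (real_of_int j + 1)"
    using assms by (simp_all add: less_log_iff log_le_iff)
  then show ?thesis using that by simp
qed

text \<open>Below the largest admissible index the series is geometric with ratio
  \<open>2 powr (- \<theta>)\<close>. The estimate
  \<open>\<theta> * ln 2 \<le> 2 powr \<theta> - 1\<close> isolates the growth 1 / \<theta> for
  small \<theta>, the source of the second power of the weight constant.\<close>

lemma dyadic_geometric_sum:
  fixes y \<theta> :: real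
  assumes y: "0 \<le> y" and \<theta>: "0 < \<theta>"
  shows "(\<integral>\<^sup>+j. ennreal (2 powr (j * \<theta>)) * indicator {j::int. 2 powr real_of_int j < y} j \<partial>count_space (UNIV :: int set))
    \<le> ennreal (y powr \<theta> * (2 powr \<theta> / (\<theta> * ln 2)))"
proof (cases "y = 0")
  case True
  then have "{j::int. 2 powr j < y} = {}" by (auto simp: not_less)
  then show ?thesis by simp
next
  case False
  then obtain k :: int where k: "2 powr k < y" "y \<le> 2 powr (real_of_int k + 1)" using y dyadic_level[of y] by auto
  have le_k: "j \<le> k" if "2 powr j < y" for j :: int
  proof -
    have "2 powr j < (2::real) powr (real_of_int k + 1)" using that k by linarith
    then show ?thesis by simp
  qed
  define x where "x = (2::real) powr (- \<theta>)"
  have x: "0 < x" "x < 1" unfolding x_def using \<theta> powr_less_mono[of "-\<theta>" 0 2] by auto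
  have bij: "bij_betw (\<lambda>i. k - int i) UNIV {..k}"
    by (rule bij_betwI[where g="\<lambda>j. nat (k - j)"]) auto
  have "(\<integral>\<^sup>+j. ennreal (2 powr (j * \<theta>)) * indicator {j::int. 2 powr real_of_int j < y} j \<partial>count_space (UNIV :: int set))
      \<le> (\<integral>\<^sup>+j. ennreal (2 powr (j * \<theta>)) * indicator {..k} j \<partial>count_space (UNIV :: int set))"
    by (intro nn_integral_mono mult_left_mono) (auto simp: indicator_def dest: le_k)
  also have "\<dots> = (\<integral>\<^sup>+j. ennreal (2 powr (j * \<theta>)) \<partial>count_space {..k})"
    by (rule nn_integral_count_space_indicator[symmetric]) simp
  also have "\<dots> = (\<integral>\<^sup>+i. ennreal (2 powr ((k - int i) * \<theta>)) \<partial>count_space (UNIV :: nat set))"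
    by (rule nn_integral_bij_count_space[OF bij, symmetric])
  also have "\<dots> = (\<Sum>i. ennreal (2 powr ((k - int i) * \<theta>)))" by (rule nn_integral_count_space_nat)
  also have "\<dots> = (\<Sum>i. ennreal (2 powr (k * \<theta>) * x ^ i))"
  proof (intro suminf_cong arg_cong[where f=ennreal])
    fix i :: nat
    have "x ^ i = 2 powr (- \<theta> * i)" unfolding x_def by (simp add: powr_realpow[symmetric] powr_powr)
    then show "2 powr (real_of_int (k - int i) * \<theta>) = 2 powr (k * \<theta>) * x ^ i"
      by (simp add: powr_add[symmetric] algebra_simps)
  qed
  also have "\<dots> = ennreal (2 powr (k * \<theta>) * (1 / (1 - x)))"
    using x by (intro suminf_ennreal_eq sums_mult geometric_sums) auto
  also have "\<dots> \<le> ennreal (y powr \<theta> * (2 powr \<theta> / (\<theta> * ln 2)))"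
  proof (intro ennreal_leI mult_mono)
    have "(2 powr k) powr \<theta> \<le> y powr \<theta>" using k \<theta> by (intro powr_mono2) auto
    then show "2 powr (k * \<theta>) \<le> y powr \<theta>" by (simp add: powr_powr)
    have "2 powr \<theta> = exp (\<theta> * ln 2)" by (simp add: powr_def)
    then have ge: "\<theta> * ln 2 \<le> 2 powr \<theta> - 1" using exp_ge_add_one_self[of "\<theta> * ln 2"] by linarith
    have pos: "0 < \<theta> * ln 2" using \<theta> by simp
    have "1 / (1 - x) = 2 powr \<theta> / (2 powr \<theta> - 1)"
      unfolding x_def powr_minus using ge pos by (simp add: field_simps)
    also have "\<dots> \<le> 2 powr \<theta> / (\<theta> * ln 2)" using ge pos by (intro divide_left_mono) auto
    finally show "1 / (1 - x) \<le> 2 powr \<theta> / (\<theta> * ln 2)" .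
  qed (use x in auto)
  finally show ?thesis .
qed

text \<open>The factors are, in order: \<open>C\<^sub>G\<close>; the constant of
  \<open>lev_emeasure_le\<close>; \<open>2 powr p\<close> from rounding up to the end of a level;
  \<open>8 powr p\<close> and \<open>2 powr p / ln 2\<close> from the geometric sum; and, in the
  last bracket, the bound for 1 / (p - s) without its power of \<open>B\<close>. Here p is r / (r -
  1).\<close>

definition dyadic_const :: "real \<Rightarrow> real \<Rightarrow> real \<Rightarrow> real" where
  "dyadic_const m D r =
    2 * ((m * 2) powr r * (m * (2 * m))) powr (1 / (r - 1)) * (2 * 8 powr (1 / (r - 1))) *
    2 powr (r / (r - 1)) * 8 powr (r / (r - 1)) * 2 powr (r / (r - 1)) / ln 2 *
    (8 * (r - 1) * ln (2 * D) * (4 * m powr r * 4 powr (r - 1)))"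

context dyadic_weight
begin

definition p :: real where "p = r / (r - 1)"

definition \<epsilon> :: real where "\<epsilon> = ln (1 + \<delta> / 2) / ln (2 * D)"

text \<open>The improved integrability exponent of \<open>V y *v v\<close> from
  \<open>reverse_Hoelder\<close>; its conjugate \<open>s\<close> therefore falls below
  \<open>p\<close>.\<close>

definition q\<^sub>\<epsilon> :: real where "q\<^sub>\<epsilon> = r * (1 + \<epsilon>)"

definition s :: real where "s = q\<^sub>\<epsilon> / (q\<^sub>\<epsilon> - 1)"

lemma \<epsilon>_bounds: "\<delta> / (4 * ln (2 * D)) \<le> \<epsilon>" "\<epsilon> \<le> 1" "0 < \<epsilon>" "(2 * D) powr \<epsilon> = 1 + \<delta> / 2"
proof -
  have lnD: "0 < ln (2 * D)" using D_ge_1 by auto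
  have "\<delta> / 2 - (\<delta> / 2)\<^sup>2 \<le> ln (1 + \<delta> / 2)"
    using \<delta>_pos \<delta>_le_1 by (intro ln_one_plus_pos_lower_bound) auto
  moreover have "(\<delta> / 2)\<^sup>2 \<le> \<delta> / 2 * (1 / 2)"
    unfolding power2_eq_square using \<delta>_pos \<delta>_le_1 by (intro mult_left_mono) auto
  ultimately have ln: "\<delta> / 4 \<le> ln (1 + \<delta> / 2)" by simp
  then have "\<delta> / 4 / ln (2 * D) \<le> \<epsilon>"
    unfolding \<epsilon>_def using lnD by (intro divide_right_mono) auto
  then show ge: "\<delta> / (4 * ln (2 * D)) \<le> \<epsilon>" by simp
  have "0 < \<delta> / (4 * ln (2 * D))" using lnD \<delta>_pos by (intro divide_pos_pos) auto
  then show "0 < \<epsilon>" using ge by linarith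
  have "ln (1 + \<delta> / 2) \<le> ln (2 * D)" using \<delta>_pos \<delta>_le_1 D_ge_1 by simp
  then show "\<epsilon> \<le> 1" unfolding \<epsilon>_def using lnD by (simp add: divide_le_eq)
  show "(2 * D) powr \<epsilon> = 1 + \<delta> / 2"
    unfolding \<epsilon>_def powr_def using lnD D_ge_1 \<delta>_pos by simp
qed

lemma q_gt_1: "1 < q\<^sub>\<epsilon>"
proof -
  have "1 * 1 < r * (1 + \<epsilon>)" using r_gt_1 \<epsilon>_bounds by (intro mult_strict_mono) auto
  then show ?thesis unfolding q\<^sub>\<epsilon>_def by simp
qed

lemma p_gt_1: "1 < p"
  unfolding p_def using r_gt_1 by (simp add: field_simps)

text \<open>The gap equals \<open>r * \<epsilon> / ((r - 1) * (q\<^sub>\<epsilon> - 1))\<close>, and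
  \<open>\<epsilon> \<le> 1\<close> bounds the last factor by \<open>2 * r\<close>.\<close>

lemma p_minus_s: "\<epsilon> / (2 * (r - 1)) \<le> p - s"
proof -
  have "p - s = (q\<^sub>\<epsilon> - r) / ((r - 1) * (q\<^sub>\<epsilon> - 1))"
    unfolding p_def s_def using r_gt_1 q_gt_1 by (simp add: divide_simps) (simp add: algebra_simps)
  also have "\<dots> = r * \<epsilon> / ((r - 1) * (q\<^sub>\<epsilon> - 1))" unfolding q\<^sub>\<epsilon>_def by (simp add: algebra_simps)
  also have "\<dots> \<ge> r * \<epsilon> / ((r - 1) * (2 * r))"
  proof (intro divide_left_mono mult_left_mono)
    have "r * \<epsilon> \<le> r * 1" using r_gt_1 \<epsilon>_bounds by (intro mult_left_mono) auto
    then show "q\<^sub>\<epsilon> - 1 \<le> 2 * r" unfolding q\<^sub>\<epsilon>_def by (simp add: distrib_left)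
  qed (use r_gt_1 \<epsilon>_bounds q_gt_1 in auto)
  also have "r * \<epsilon> / ((r - 1) * (2 * r)) = \<epsilon> / (2 * (r - 1))" using r_gt_1 by (simp add: field_simps)
  finally show ?thesis .
qed

lemma s_lt_p: "s < p" and s_gt_1: "1 < s"
proof -
  have "0 < \<epsilon> / (2 * (r - 1))" using r_gt_1 \<epsilon>_bounds by (intro divide_pos_pos) auto
  then show "s < p" using p_minus_s by linarith
  show "1 < s" unfolding s_def using q_gt_1 by (simp add: field_simps)
qed

text \<open>The cubes with a_Q > t. No point of the cube enters, so \<open>nn_integral_Hs_le\<close>
  applies to the whole family.\<close>

definition lev :: "('a \<Rightarrow> real) \<Rightarrow> real \<Rightarrow> 'a set set" where
  "lev g t = {Q\<in>grid. \<exists>v. \<phi> Q v \<le> 1 \<and>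
     ennreal t * leb Q < (\<integral>\<^sup>+y\<in>Q. ennreal (norm (V y *v v) * g y) \<partial>lebesgue)}"

lemma lev_grid: "lev g t \<subseteq> grid"
  unfolding lev_def by auto

text \<open>The reverse Hoelder gain turns \<open>L\<^sup>p\<close>- into \<open>L\<^sup>s\<close>-control with \<open>s < p\<close>.\<close>

lemma lev_emeasure_le:
  assumes g [measurable]: "g \<in> borel_measurable lebesgue" and g0: "\<And>y. 0 \<le> g y"
    and t: "0 < t" and Q: "Q \<in> lev g t"
  shows "leb Q \<le>
    ennreal (2 * 8 powr (p - 1)) * (\<integral>\<^sup>+y\<in>Q. ennreal ((g y / t) powr s * indicator {y. t < 8 * g y} y) \<partial>lebesgue)"
proof -
  obtain v where v: "\<phi> Q v \<le> 1"
      "ennreal t * leb Q < (\<integral>\<^sup>+y\<in>Q. ennreal (norm (V y *v v) * g y) \<partial>lebesgue)"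
    and Qg: "Q \<in> grid" using Q unfolding lev_def by auto
  note [measurable] = grid_sets[OF Qg]
  define \<tau> where "\<tau> y = norm (V y *v v)" for y
  have [measurable]: "\<tau> \<in> borel_measurable lebesgue" unfolding \<tau>_def by measurable
  have \<tau>0: "0 \<le> \<tau> y" for y unfolding \<tau>_def by simp
  note [measurable] = superlevel_sets[OF g]
  have I1: "(\<integral>\<^sup>+y\<in>Q. ennreal (\<tau> y powr r) \<partial>lebesgue) \<le> 1 * leb Q"
    unfolding \<tau>_def phi_eq[OF Qg] using v(1) by (intro mult_right_mono) (auto simp: ennreal_le_1)
  have "(\<integral>\<^sup>+y\<in>Q. ennreal ((\<tau> y powr r) powr (1 + \<epsilon>)) \<partial>lebesgue) \<le> 2 * leb Q"
  proof (rule reverse_Hoelder[OF _ _ Qg \<delta>_pos \<delta>_le_1 _ _ \<epsilon>_bounds(3,4)])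
    fix R E assume "R \<in> grid" "E \<in> sets lebesgue" "E \<subseteq> R" "leb R \<le> 2 * leb E"
    then show "ennreal \<delta> * (\<integral>\<^sup>+x\<in>R. ennreal (\<tau> x powr r) \<partial>lebesgue) \<le> (\<integral>\<^sup>+x\<in>E. ennreal (\<tau> x powr r) \<partial>lebesgue)"
      unfolding \<tau>_def by (rule A_infty)
  qed (use I1 in auto)
  then have I2: "(\<integral>\<^sup>+y\<in>Q. ennreal (\<tau> y powr q\<^sub>\<epsilon>) \<partial>lebesgue) \<le> 2 * leb Q"
    unfolding powr_powr q\<^sub>\<epsilon>_def .
  let ?h = "\<lambda>y. (g y / t) powr s * indicator {y. t < 8 * g y} y"
  define X where "X = (\<integral>\<^sup>+y\<in>Q. ennreal (?h y) \<partial>lebesgue)"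
  \<comment> \<open>Where \<open>8 * g y \<le> t\<close>, the bound
    \<open>\<tau> y \<le> 1 + \<tau> y powr r\<close> suffices; elsewhere Young's inequality with
    parameter 1 / 8 does. The error terms average to at most (1 + 1 + 2) t / 8 = t / 2 and are
    absorbed on the left. The cut-off in \<open>?h\<close> makes the later sum over levels
    converge.\<close>
  have ptw: "\<tau> y * g y \<le> t / 8 * (1 + \<tau> y powr r) + t / 8 * \<tau> y powr q\<^sub>\<epsilon> + t * 8 powr (p - 1) * ?h y" for y
  proof (cases "t < 8 * g y")
    case False
    have "\<tau> y * g y \<le> (1 + \<tau> y powr r) * (t / 8)"
      using False g0 \<tau>0 r_gt_1 by (intro mult_mono le_one_plus_powr) auto
    then show ?thesis using False t by (simp add: add_increasing2 mult.commute)
  next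
    case True
    have "\<tau> y * (g y / t) \<le> 1 / 8 * \<tau> y powr q\<^sub>\<epsilon> + (1 / (1 / 8)) powr (1 / (q\<^sub>\<epsilon> - 1)) * (g y / t) powr s"
      unfolding s_def using \<tau>0 g0 t q_gt_1 by (intro Young_weighted) auto
    also have "(1 / (1 / 8)) powr (1 / (q\<^sub>\<epsilon> - 1)) = (8::real) powr (s - 1)"
      unfolding s_def using q_gt_1 by (simp add: field_simps)
    also have "1 / 8 * \<tau> y powr q\<^sub>\<epsilon> + 8 powr (s - 1) * (g y / t) powr s \<le>
        1 / 8 * \<tau> y powr q\<^sub>\<epsilon> + 8 powr (p - 1) * (g y / t) powr s"
      using s_lt_p by (intro add_left_mono mult_right_mono powr_mono) auto
    finally have "t * (\<tau> y * (g y / t)) \<le> t * (1 / 8 * \<tau> y powr q\<^sub>\<epsilon> + 8 powr (p - 1) * (g y / t) powr s)"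
      using t by (intro mult_left_mono) auto
    then have "\<tau> y * g y \<le> t / 8 * \<tau> y powr q\<^sub>\<epsilon> + t * 8 powr (p - 1) * ?h y"
      using t True by (simp add: distrib_left mult.assoc)
    moreover have "0 \<le> t / 8 * (1 + \<tau> y powr r)" using t by simp
    ultimately show ?thesis by linarith
  qed
  have "ennreal t * leb Q < (\<integral>\<^sup>+y\<in>Q. ennreal (\<tau> y * g y) \<partial>lebesgue)"
    using v(2) unfolding \<tau>_def .
  also have "\<dots> \<le> (\<integral>\<^sup>+y. ennreal (t / 8) * indicator Q y + ennreal (t / 8) * (ennreal (\<tau> y powr r) * indicator Q y) +
      ennreal (t / 8) * (ennreal (\<tau> y powr q\<^sub>\<epsilon>) * indicator Q y) +
      ennreal (t * 8 powr (p - 1)) * (ennreal (?h y) * indicator Q y) \<partial>lebesgue)"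
  proof (rule nn_integral_mono)
    fix y
    have "ennreal (\<tau> y * g y) \<le> ennreal (t / 8 * (1 + \<tau> y powr r) + t / 8 * \<tau> y powr q\<^sub>\<epsilon> + t * 8 powr (p - 1) * ?h y)"
      by (intro ennreal_leI ptw)
    also have "\<dots> = ennreal (t / 8) + ennreal (t / 8) * ennreal (\<tau> y powr r) +
        ennreal (t / 8) * ennreal (\<tau> y powr q\<^sub>\<epsilon>) + ennreal (t * 8 powr (p - 1)) * ennreal (?h y)"
      using t by (simp add: ennreal_mult[symmetric] ennreal_plus[symmetric] distrib_left del: ennreal_plus)
    finally show "ennreal (\<tau> y * g y) * indicator Q y \<le> ennreal (t / 8) * indicator Q y + ennreal (t / 8) * (ennreal (\<tau> y powr r) * indicator Q y) +
      ennreal (t / 8) * (ennreal (\<tau> y powr q\<^sub>\<epsilon>) * indicator Q y) +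
      ennreal (t * 8 powr (p - 1)) * (ennreal (?h y) * indicator Q y)"
      by (cases "y \<in> Q") simp_all
  qed
  also have "\<dots> = ennreal (t / 8) * leb Q + ennreal (t / 8) * (\<integral>\<^sup>+y\<in>Q. ennreal (\<tau> y powr r) \<partial>lebesgue) +
      ennreal (t / 8) * (\<integral>\<^sup>+y\<in>Q. ennreal (\<tau> y powr q\<^sub>\<epsilon>) \<partial>lebesgue) + ennreal (t * 8 powr (p - 1)) * X"
    unfolding X_def by (simp add: nn_integral_add nn_integral_cmult nn_integral_cmult_indicator)
  also have "\<dots> \<le> ennreal (t / 8) * leb Q + ennreal (t / 8) * (1 * leb Q) +
      ennreal (t / 8) * (2 * leb Q) + ennreal (t * 8 powr (p - 1)) * X"
    by (intro add_mono mult_left_mono I1 I2 order_refl) auto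
  finally have main: "ennreal t * leb Q < ennreal (t / 8) * leb Q +
      ennreal (t / 8) * (1 * leb Q) +
      ennreal (t / 8) * (2 * leb Q) + ennreal (t * 8 powr (p - 1)) * X" .
  show ?thesis
  proof (cases "X = top")
    case True
    then show ?thesis unfolding X_def[symmetric] by (simp add: ennreal_mult_top)
  next
    case False
    then obtain x where x: "X = ennreal x" "0 \<le> x" by (cases X) auto
    let ?m = "vol Q"
    have m: "0 < ?m" by (rule grid_emeasure(2)[OF Qg])
    have "ennreal (t * ?m) < ennreal (t / 8 * ?m + t / 8 * ?m + t / 8 * (2 * ?m) + t * 8 powr (p - 1) * x)"
      using main t m x unfolding grid_emeasure(1)[OF Qg]
      by (simp add: ennreal_mult[symmetric] ennreal_plus[symmetric] del: ennreal_plus flip: ennreal_numeral)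
    then have "t * ?m < t / 8 * ?m + t / 8 * ?m + t / 8 * (2 * ?m) + t * 8 powr (p - 1) * x"
      using t m by (subst (asm) ennreal_less_iff) auto
    then have "t * ?m < t * (?m / 2 + 8 powr (p - 1) * x)" by (simp add: algebra_simps)
    then have "?m \<le> 2 * 8 powr (p - 1) * x" using t by simp
    then show ?thesis
      unfolding X_def[symmetric] x grid_emeasure(1)[OF Qg] using x
      by (simp add: ennreal_mult[symmetric] ennreal_leI)
  qed
qed

lemma emeasure_Union_lev_le:
  assumes g [measurable]: "g \<in> borel_measurable lebesgue" and g0: "\<And>y. 0 \<le> g y" and t: "0 < t"
  shows "leb (\<Union>(lev g t)) \<le>
    ennreal (2 * 8 powr (p - 1)) * (\<integral>\<^sup>+y. ennreal ((g y / t) powr s * indicator {y. t < 8 * g y} y) \<partial>lebesgue)"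
proof -
  note [measurable] = Union_grid_sets[OF lev_grid, of g t]
  note [measurable] = superlevel_sets[OF g]
  let ?h = "\<lambda>y. ennreal ((g y / t) powr s * indicator {y. t < 8 * g y} y)"
  have "leb (\<Union>(lev g t)) = (\<integral>\<^sup>+y\<in>\<Union>(lev g t). 1 \<partial>lebesgue)" by simp
  also have "\<dots> \<le> (\<integral>\<^sup>+y\<in>\<Union>(lev g t). (ennreal (2 * 8 powr (p - 1)) * ?h y) \<partial>lebesgue)"
  proof (rule cover_le[OF lev_grid])
    fix Q assume "maximal_in (lev g t) Q"
    then have Q: "Q \<in> lev g t" unfolding maximal_in_def by auto
    then have "Q \<in> grid" using lev_grid by auto
    note [measurable] = grid_sets[OF this]
    have "(\<integral>\<^sup>+y\<in>Q. 1 \<partial>lebesgue) \<le> ennreal (2 * 8 powr (p - 1)) * (\<integral>\<^sup>+y\<in>Q. ?h y \<partial>lebesgue)"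
      using lev_emeasure_le[OF g g0 t Q] by simp
    also have "\<dots> = (\<integral>\<^sup>+y\<in>Q. (ennreal (2 * 8 powr (p - 1)) * ?h y) \<partial>lebesgue)"
      unfolding mult.assoc by (rule nn_integral_cmult[symmetric]) measurable
    finally show "(\<integral>\<^sup>+y\<in>Q. 1 \<partial>lebesgue) \<le> (\<integral>\<^sup>+y\<in>Q. (ennreal (2 * 8 powr (p - 1)) * ?h y) \<partial>lebesgue)" .
  qed measurable
  also have "\<dots> \<le> (\<integral>\<^sup>+y. ennreal (2 * 8 powr (p - 1)) * ?h y \<partial>lebesgue)"
    by (intro nn_integral_mono) (auto simp: indicator_def)
  also have "\<dots> = ennreal (2 * 8 powr (p - 1)) * (\<integral>\<^sup>+y. ?h y \<partial>lebesgue)"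
    by (rule nn_integral_cmult) measurable
  finally show ?thesis .
qed

text \<open>A sum over levels instead of a supremum, so that it can be integrated term by term; the
  power of 2 belongs to the upper end of the level. Up to the dimensional factors, it majorises the
  p-th power of the dyadic maximal function.\<close>

definition U :: "('a \<Rightarrow> real) \<Rightarrow> 'a \<Rightarrow> ennreal" where
  "U g x = (\<integral>\<^sup>+j. ennreal (2 powr ((real_of_int j + 1) * p)) * Hs (lev g (2 powr j)) x \<partial>count_space (UNIV :: int set))"

lemma U_measurable: "U g \<in> borel_measurable lebesgue"
proof -
  note [measurable] = Hs_measurable[OF lev_grid]
  have "(\<lambda>x. \<integral>\<^sup>+i. ennreal (2 powr ((real_of_int (int_decode i) + 1) * p)) * Hs (lev g (2 powr int_decode i)) x \<partial>count_space UNIV)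
      \<in> borel_measurable lebesgue"
    unfolding nn_integral_count_space_nat by measurable
  moreover have "bij_betw int_decode UNIV UNIV" using bij_int_decode by (simp add: bij_def bij_betw_def)
  ultimately show ?thesis
    unfolding U_def[abs_def] by (subst (asm) nn_integral_bij_count_space) auto
qed

text \<open>Each level costs \<open>C\<^sub>G * B\<close> times the measure of its union. After sum
  and integral are exchanged, only levels with \<open>2 powr j < 8 * g y\<close> occur at
  \<open>y\<close>, and they sum to a multiple of \<open>g y powr s * g y powr (p - s)\<close> with
  a factor 1 / (p - s). That factor is at most of order \<open>B powr (r - 1)\<close>, which
  together with \<open>B\<close> gives \<open>B powr r\<close>.\<close>

lemma nn_integral_U_le:
  assumes g [measurable]: "g \<in> borel_measurable lebesgue" and g0: "\<And>y. 0 \<le> g y"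
  shows "(\<integral>\<^sup>+x. U g x \<partial>lebesgue) \<le>
    ennreal (dyadic_const CARD('d) D r * B powr r) * (\<integral>\<^sup>+x. ennreal (g x powr p) \<partial>lebesgue)"
proof -
  note [measurable] = Hs_measurable[OF lev_grid]
  let ?\<theta> = "p - s"
  have \<theta>: "0 < ?\<theta>" using s_lt_p by simp
  let ?h = "\<lambda>j::int. \<lambda>y. ennreal ((g y / 2 powr j) powr s * indicator {y. 2 powr j < 8 * g y} y)"
  note [measurable] = superlevel_sets[OF g]
  define c where "c = C\<^sub>G * B * (2 * 8 powr (p - 1))"
  have c: "0 \<le> c" unfolding c_def using C\<^sub>G_pos B_pos by simp
  have "(\<integral>\<^sup>+x. U g x \<partial>lebesgue) =
      (\<integral>\<^sup>+j. \<integral>\<^sup>+x. ennreal (2 powr ((real_of_int j + 1) * p)) * Hs (lev g (2 powr j)) x \<partial>lebesgue \<partial>count_space (UNIV :: int set))"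
    unfolding U_def by (rule nn_integral_count_space_nn_integral) auto
  also have "\<dots> \<le> (\<integral>\<^sup>+j. \<integral>\<^sup>+y. ennreal (c * 2 powr ((real_of_int j + 1) * p)) * ?h j y \<partial>lebesgue \<partial>count_space (UNIV :: int set))"
  proof (rule nn_integral_mono)
    fix j :: int
    have "(\<integral>\<^sup>+x. ennreal (2 powr ((real_of_int j + 1) * p)) * Hs (lev g (2 powr j)) x \<partial>lebesgue) =
        ennreal (2 powr ((real_of_int j + 1) * p)) * (\<integral>\<^sup>+x. Hs (lev g (2 powr j)) x \<partial>lebesgue)"
      by (rule nn_integral_cmult) measurable
    also have "\<dots> \<le> ennreal (2 powr ((real_of_int j + 1) * p)) * (ennreal (C\<^sub>G * B) * leb (\<Union>(lev g (2 powr j))))"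
      by (intro mult_left_mono nn_integral_Hs_le lev_grid) auto
    also have "\<dots> \<le> ennreal (2 powr ((real_of_int j + 1) * p)) * (ennreal (C\<^sub>G * B) * (ennreal (2 * 8 powr (p - 1)) * (\<integral>\<^sup>+y. ?h j y \<partial>lebesgue)))"
      by (intro mult_left_mono emeasure_Union_lev_le g g0) auto
    also have "\<dots> = ennreal (c * 2 powr ((real_of_int j + 1) * p)) * (\<integral>\<^sup>+y. ?h j y \<partial>lebesgue)"
      unfolding c_def using C\<^sub>G_pos B_pos by (simp add: ennreal_mult mult_ac)
    also have "\<dots> = (\<integral>\<^sup>+y. ennreal (c * 2 powr ((real_of_int j + 1) * p)) * ?h j y \<partial>lebesgue)"
      by (rule nn_integral_cmult[symmetric]) measurable
    finally show "(\<integral>\<^sup>+x. ennreal (2 powr ((real_of_int j + 1) * p)) * Hs (lev g (2 powr j)) x \<partial>lebesgue) \<le>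
        (\<integral>\<^sup>+y. ennreal (c * 2 powr ((real_of_int j + 1) * p)) * ?h j y \<partial>lebesgue)" .
  qed
  also have "\<dots> = (\<integral>\<^sup>+y. \<integral>\<^sup>+j. ennreal (c * 2 powr ((real_of_int j + 1) * p)) * ?h j y \<partial>count_space (UNIV :: int set) \<partial>lebesgue)"
    by (rule nn_integral_count_space_nn_integral[symmetric]) auto
  also have "\<dots> \<le> (\<integral>\<^sup>+y. ennreal (c * 2 powr p * 8 powr p * (2 powr p / (?\<theta> * ln 2))) * ennreal (g y powr p) \<partial>lebesgue)"
  proof (rule nn_integral_mono)
    fix y
    have eq: "ennreal (c * 2 powr ((real_of_int j + 1) * p)) * ?h j y =
      ennreal (c * 2 powr p * g y powr s) * (ennreal (2 powr (j * ?\<theta>)) * indicator {j::int. 2 powr real_of_int j < 8 * g y} j)" for j :: int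
    proof (cases "2 powr j < 8 * g y")
      case True
      have "2 powr ((real_of_int j + 1) * p) * (g y / 2 powr j) powr s = 2 powr p * g y powr s * 2 powr (j * ?\<theta>)"
        by (simp add: powr_divide powr_powr powr_add powr_diff algebra_simps)
      then have "c * 2 powr ((real_of_int j + 1) * p) * (g y / 2 powr j) powr s = c * 2 powr p * g y powr s * 2 powr (j * ?\<theta>)"
        by (simp add: mult.assoc)
      then show ?thesis using True c by (simp add: ennreal_mult[symmetric])
    qed simp
    have "(\<integral>\<^sup>+j. ennreal (c * 2 powr ((real_of_int j + 1) * p)) * ?h j y \<partial>count_space (UNIV :: int set)) =
        ennreal (c * 2 powr p * g y powr s) * (\<integral>\<^sup>+j. ennreal (2 powr (j * ?\<theta>)) * indicator {j::int. 2 powr real_of_int j < 8 * g y} j \<partial>count_space (UNIV :: int set))"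
      unfolding eq by (rule nn_integral_cmult) simp
    also have "\<dots> \<le> ennreal (c * 2 powr p * g y powr s) * ennreal ((8 * g y) powr ?\<theta> * (2 powr ?\<theta> / (?\<theta> * ln 2)))"
      by (intro mult_left_mono dyadic_geometric_sum \<theta>) (use g0 in auto)
    also have "\<dots> = ennreal (c * 2 powr p * 8 powr ?\<theta> * (2 powr ?\<theta> / (?\<theta> * ln 2)) * (g y powr s * g y powr ?\<theta>))"
      using c \<theta> by (simp add: ennreal_mult[symmetric] powr_mult mult_ac)
    also have "g y powr s * g y powr ?\<theta> = g y powr p" unfolding powr_add[symmetric] by simp
    also have "ennreal (c * 2 powr p * 8 powr ?\<theta> * (2 powr ?\<theta> / (?\<theta> * ln 2)) * g y powr p) \<le>
        ennreal (c * 2 powr p * 8 powr p * (2 powr p / (?\<theta> * ln 2)) * g y powr p)"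
      using s_gt_1 \<theta> c by (intro ennreal_leI mult_right_mono mult_mono powr_mono divide_right_mono) auto
    also have "\<dots> = ennreal (c * 2 powr p * 8 powr p * (2 powr p / (?\<theta> * ln 2))) * ennreal (g y powr p)"
      using c \<theta> by (intro ennreal_mult) auto
    finally show "(\<integral>\<^sup>+j. ennreal (c * 2 powr ((real_of_int j + 1) * p)) * ?h j y \<partial>count_space (UNIV :: int set)) \<le>
       ennreal (c * 2 powr p * 8 powr p * (2 powr p / (?\<theta> * ln 2))) * ennreal (g y powr p)" .
  qed
  also have "\<dots> = ennreal (c * 2 powr p * 8 powr p * (2 powr p / (?\<theta> * ln 2))) * (\<integral>\<^sup>+y. ennreal (g y powr p) \<partial>lebesgue)"
    by (rule nn_integral_cmult) measurable
  also have "\<dots> \<le> ennreal (dyadic_const CARD('d) D r * B powr r) * (\<integral>\<^sup>+y. ennreal (g y powr p) \<partial>lebesgue)"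
  proof (intro mult_right_mono ennreal_leI)
    have lnD: "0 < ln (2 * D)" using D_ge_1 by simp
    \<comment> \<open>The reciprocal of the lower bound for \<open>p - s\<close> given by
      \<open>\<epsilon>_bounds\<close> and \<open>p_minus_s\<close>, with \<open>\<delta>\<close>
      written out.\<close>
    define z where "z = 8 * (r - 1) * ln (2 * D) * (4 * real CARD('d) powr r * (4 * B) powr (r - 1))"
    have \<delta>z: "\<delta> * z = 8 * (r - 1) * ln (2 * D)"
      unfolding \<delta>_def z_def using d_ge_1 B_pos by simp
    have z: "0 < z" unfolding z_def using d_ge_1 B_pos lnD r_gt_1 by simp
    have "1 = \<delta> / (4 * ln (2 * D)) / (2 * (r - 1)) * z"
      using \<delta>z lnD r_gt_1 by (simp add: field_simps)
    also have "\<dots> \<le> ?\<theta> * z"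
    proof (rule mult_right_mono)
      have "\<delta> / (4 * ln (2 * D)) / (2 * (r - 1)) \<le> \<epsilon> / (2 * (r - 1))"
        using \<epsilon>_bounds(1) r_gt_1 by (intro divide_right_mono) auto
      then show "\<delta> / (4 * ln (2 * D)) / (2 * (r - 1)) \<le> ?\<theta>" using p_minus_s by linarith
    qed (use z in simp)
    finally have "1 / ?\<theta> \<le> z" using \<theta> by (simp add: field_simps)
    then have "c * 2 powr p * 8 powr p * 2 powr p / ln 2 * (1 / ?\<theta>) \<le> c * 2 powr p * 8 powr p * 2 powr p / ln 2 * z"
      using c by (intro mult_left_mono) auto
    also have "\<dots> = dyadic_const CARD('d) D r * B powr r"
    proof -
      have "B * (4 * B) powr (r - 1) = 4 powr (r - 1) * (B powr 1 * B powr (r - 1))"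
        using B_pos by (simp add: powr_mult)
      also have "\<dots> = 4 powr (r - 1) * B powr r" unfolding powr_add[symmetric] by simp
      finally have Bpow: "B * (4 * B) powr (r - 1) = 4 powr (r - 1) * B powr r" .
      have p1: "p - 1 = 1 / (r - 1)" unfolding p_def using r_gt_1 by (simp add: field_simps)
      have "c * 2 powr p * 8 powr p * 2 powr p / ln 2 * z =
          C\<^sub>G * (2 * 8 powr (p - 1)) * 2 powr p * 8 powr p * 2 powr p / ln 2 *
          (8 * (r - 1) * ln (2 * D) * (4 * real CARD('d) powr r * (B * (4 * B) powr (r - 1))))"
        unfolding c_def z_def by (simp only: mult_ac times_divide_eq_left times_divide_eq_right)
      then show ?thesis
        unfolding Bpow dyadic_const_def C\<^sub>G_def \<Lambda>_def p1 unfolding p_def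
        by (simp only: mult_ac times_divide_eq_left times_divide_eq_right)
    qed
    finally show "c * 2 powr p * 8 powr p * (2 powr p / (?\<theta> * ln 2)) \<le> dyadic_const CARD('d) D r * B powr r"
      by (simp add: mult_ac)
  qed auto
  finally show ?thesis .
qed

text \<open>Scaling \<open>w = W x *v axis i 1\<close> by \<open>c\<close> to average 1 makes it a
  competitor in a_Q. Then \<open>Q\<close> lies in the family of the dyadic level just below the
  scaled average, and this single term of \<open>U\<close> suffices;
  \<open>\<phi> Q w \<le> N Q x\<close> undoes the scaling.\<close>

lemma average_le_U:
  assumes g [measurable]: "g \<in> borel_measurable lebesgue" and g0: "\<And>y. 0 \<le> g y"
    and gp: "(\<integral>\<^sup>+x. ennreal (g x powr p) \<partial>lebesgue) < \<infinity>"
    and Q: "Q \<in> grid" and x: "x \<in> Q" and u: "U g x \<le> ennreal u" "0 \<le> u"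
  shows "(\<integral>\<^sup>+y\<in>Q. ennreal (norm (V y *v (W x *v axis i 1)) * g y) \<partial>lebesgue) \<le>
    ennreal (u powr (1 / p)) * leb Q"
proof -
  note [measurable] = grid_sets[OF Q]
  define w where "w = W x *v axis i 1"
  let ?I = "\<integral>\<^sup>+y\<in>Q. ennreal (norm (V y *v w) * g y) \<partial>lebesgue"
  let ?m = "vol Q"
  have m: "0 < ?m" by (rule grid_emeasure(2)[OF Q])
  have "w \<noteq> 0"
  proof
    assume "w = 0"
    then have "V x *v (W x *v axis i 1) = 0" unfolding w_def by simp
    then show False unfolding W_V_apply by (simp add: axis_eq_0_iff)
  qed
  then have pos: "0 < \<phi> Q w" by (rule phi_pos[OF Q])
  \<comment> \<open>Young's inequality shows that \<open>?I\<close> is finite; otherwise no dyadic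
    level could be chosen.\<close>
  have "?I \<le> (\<integral>\<^sup>+y. ennreal (norm (V y *v w) powr r) * indicator Q y + ennreal (g y powr p) \<partial>lebesgue)"
  proof (rule nn_integral_mono)
    fix y
    have "norm (V y *v w) * g y \<le> norm (V y *v w) powr r + g y powr p"
      using Young_weighted[of "norm (V y *v w)" "g y" 1 r] g0 r_gt_1 unfolding p_def by simp
    then have "ennreal (norm (V y *v w) * g y) \<le> ennreal (norm (V y *v w) powr r) + ennreal (g y powr p)"
      by (simp add: ennreal_plus[symmetric] ennreal_leI del: ennreal_plus)
    then show "ennreal (norm (V y *v w) * g y) * indicator Q y \<le>
        ennreal (norm (V y *v w) powr r) * indicator Q y + ennreal (g y powr p)"
      by (cases "y \<in> Q") simp_all
  qed
  also have "\<dots> = (\<integral>\<^sup>+y\<in>Q. ennreal (norm (V y *v w) powr r) \<partial>lebesgue) + (\<integral>\<^sup>+y. ennreal (g y powr p) \<partial>lebesgue)"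
    by (rule nn_integral_add) measurable
  also have "\<dots> < \<infinity>" using phi_finite[OF Q, of w] gp by simp
  finally obtain \<iota> where \<iota>: "?I = ennreal \<iota>" "0 \<le> \<iota>" by (cases ?I) auto
  show ?thesis
  proof (cases "\<iota> = 0")
    case True
    then show ?thesis unfolding w_def[symmetric] \<iota> by simp
  next
    case False
    define c where "c = (1 / \<phi> Q w) powr (1 / r)"
    have c: "0 < c" unfolding c_def using pos by simp
    have cr: "c powr r = 1 / \<phi> Q w" unfolding c_def using pos r_gt_1 by (simp add: powr_powr)
    define \<alpha> where "\<alpha> = c * \<iota> / ?m"
    have \<alpha>: "0 < \<alpha>" unfolding \<alpha>_def using c m False \<iota> by (intro divide_pos_pos mult_pos_pos) auto
    obtain j :: int where j: "2 powr j < \<alpha>" "\<alpha> \<le> 2 powr (real_of_int j + 1)" using dyadic_level[OF \<alpha>] by auto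
    have "\<phi> Q (c *\<^sub>R w) \<le> 1" using phi_scale[OF Q, of c w] c cr pos by simp
    moreover have "ennreal (2 powr j) * leb Q < (\<integral>\<^sup>+y\<in>Q. ennreal (norm (V y *v (c *\<^sub>R w)) * g y) \<partial>lebesgue)"
    proof -
      have "(\<integral>\<^sup>+y\<in>Q. ennreal (norm (V y *v (c *\<^sub>R w)) * g y) \<partial>lebesgue) =
          (\<integral>\<^sup>+y. ennreal c * (ennreal (norm (V y *v w) * g y) * indicator Q y) \<partial>lebesgue)"
        using c g0 by (intro nn_integral_cong) (simp add: matrix_vector_mult_scaleR ennreal_mult mult.assoc)
      also have "\<dots> = ennreal c * ?I" by (rule nn_integral_cmult) measurable
      also have "\<dots> = ennreal (\<alpha> * ?m)" unfolding \<iota> \<alpha>_def using c m \<iota> by (simp add: ennreal_mult)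
      finally show ?thesis
        unfolding grid_emeasure(1)[OF Q] using j m
        by (simp add: ennreal_mult[symmetric] ennreal_less_iff)
    qed
    ultimately have "Q \<in> lev g (2 powr j)" unfolding lev_def using Q by blast
    then have "ennreal (Np Q x) * indicator Q x \<le> Hs (lev g (2 powr j)) x"
      unfolding Hs_def by (rule SUP_upper)
    then have "ennreal (2 powr ((real_of_int j + 1) * p)) * ennreal (Np Q x) \<le> ennreal (2 powr ((real_of_int j + 1) * p)) * Hs (lev g (2 powr j)) x"
      using x by (intro mult_left_mono) auto
    also have "\<dots> \<le> U g x"
      unfolding U_def
      by (rule nn_integral_ge_point[where p="\<lambda>j::int. ennreal (2 powr ((real_of_int j + 1) * p)) * Hs (lev g (2 powr j)) x"]) simp
    also note u(1)
    finally have le_u: "2 powr ((real_of_int j + 1) * p) * Np Q x \<le> u"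
      using u(2) unfolding Np_def by (simp add: ennreal_mult[symmetric] ennreal_le_iff)
    have "\<phi> Q w \<le> N Q x" unfolding N_def w_def by (intro member_le_sum) (auto simp: phi_nonneg)
    then have 1: "\<phi> Q w powr (1 / (r - 1)) \<le> Np Q x"
      unfolding Np_def using pos r_gt_1 by (intro powr_mono2) auto
    have "(\<iota> / ?m) powr p = (\<alpha> * (1 / c)) powr p" unfolding \<alpha>_def using c by simp
    also have "\<dots> = \<alpha> powr p * (1 / c) powr p" by (rule powr_mult)
    also have "(1 / c) powr p = \<phi> Q w powr (1 / (r - 1))"
    proof -
      have "1 / c = \<phi> Q w powr (1 / r)" unfolding c_def using pos by (simp add: powr_divide)
      then show ?thesis unfolding p_def using r_gt_1 by (simp add: powr_powr)
    qed
    also have "\<alpha> powr p * \<phi> Q w powr (1 / (r - 1)) \<le> 2 powr ((real_of_int j + 1) * p) * Np Q x"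
    proof (rule mult_mono[OF _ 1])
      have "\<alpha> powr p \<le> (2 powr (real_of_int j + 1)) powr p" using j \<alpha> p_gt_1 by (intro powr_mono2) auto
      then show "\<alpha> powr p \<le> 2 powr ((real_of_int j + 1) * p)" by (simp add: powr_powr)
    qed auto
    also note le_u
    finally have "((\<iota> / ?m) powr p) powr (1 / p) \<le> u powr (1 / p)" using p_gt_1 by (intro powr_mono2) auto
    then have "\<iota> / ?m \<le> u powr (1 / p)" using p_gt_1 \<iota> m by (simp add: powr_powr)
    then have "\<iota> \<le> u powr (1 / p) * ?m" using m by (simp add: field_simps)
    then show ?thesis
      unfolding w_def[symmetric] \<iota> grid_emeasure(1)[OF Q] by (simp add: ennreal_mult[symmetric] ennreal_leI)
  qed
qed

end

section \<open>Shifted dyadic grids and matrix inverses\<close>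

text \<open>Floors give half-open cells of side \<open>h / 2 ^ k\<close>, which partition the space
  at each generation, as closed cubes would not; \<open>t\<close> shifts the grid, and generation 0
  has side \<open>h\<close>.\<close>

definition dyq :: "real^'n \<Rightarrow> real \<Rightarrow> nat \<Rightarrow> real^'n \<Rightarrow> (real^'n) set" where
  "dyq t h k x = {y. \<forall>i. \<lfloor>(y $ i - t $ i) * 2 ^ k / h\<rfloor> = \<lfloor>(x $ i - t $ i) * 2 ^ k / h\<rfloor>}"

definition cube :: "real^'n \<Rightarrow> real \<Rightarrow> (real^'n) set" where
  "cube a l = cbox a (\<chi> i. a $ i + l)"

lemma mem_cube: "x \<in> cube a l \<longleftrightarrow> (\<forall>i. a $ i \<le> x $ i \<and> x $ i \<le> a $ i + l)"
  unfolding cube_def by (simp add: mem_box_cart)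

lemma cube_in_cubes: "0 < l \<Longrightarrow> cube a l \<in> cubes"
  unfolding cube_def cubes_def by blast

lemma cubesE: assumes "Q \<in> cubes" obtains a l where "Q = cube a l" "0 < l"
  using assms unfolding cubes_def cube_def by blast

lemma cube_lmeasurable: "cube a l \<in> lmeasurable"
  unfolding cube_def by simp

lemma measure_cube: assumes "0 < l" shows "vol (cube (a::real^'n) l) = l ^ CARD('n)"
proof -
  have "cbox a (\<chi> i. a $ i + l) \<noteq> {}" using assms by (auto simp: interval_ne_empty_cart)
  then show ?thesis unfolding cube_def using content_cbox_cart[of a "\<chi> i. a $ i + l"] by simp
qed

lemma emeasure_cube: assumes "0 < l" shows "leb (cube (a::real^'n) l) = ennreal (l ^ CARD('n))"
  using emeasure_eq_measure2[OF cube_lmeasurable, of a l] measure_cube[OF assms, of a] by simp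

lemma dyq_eq_cell:
  fixes t :: "real^'n"
  assumes "0 < h"
  shows "dyq t h k x = {y. \<forall>i. t $ i + \<lfloor>(x $ i - t $ i) * 2 ^ k / h\<rfloor> * (h / 2 ^ k) \<le> y $ i \<and>
    y $ i < t $ i + \<lfloor>(x $ i - t $ i) * 2 ^ k / h\<rfloor> * (h / 2 ^ k) + h / 2 ^ k}"
proof -
  have "(\<lfloor>(u - s) * 2 ^ k / h\<rfloor> = m) = (s + m * (h / 2 ^ k) \<le> u \<and> u < s + m * (h / 2 ^ k) + h / 2 ^ k)"
    for u s :: real and m :: int
    unfolding floor_eq_iff using assms by (simp add: field_simps)
  then show ?thesis unfolding dyq_def by simp
qed

lemma dyq_cube:
  fixes t x :: "real^'n"
  assumes h: "0 < h"
  shows "dyq t h k x \<in> lmeasurable" "vol (dyq t h k x) = (h / 2 ^ k) ^ CARD('n)"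
    "\<exists>c. dyq t h k x \<subseteq> cube c (h / 2 ^ k)"
proof -
  define l where "l = h / 2 ^ k"
  have l: "0 < l" unfolding l_def using h by simp
  define c :: "real^'n" where "c = (\<chi> i. t $ i + \<lfloor>(x $ i - t $ i) * 2 ^ k / h\<rfloor> * (h / 2 ^ k))"
  have eq: "dyq t h k x = {y. \<forall>i. c $ i \<le> y $ i \<and> y $ i < c $ i + l}"
    unfolding dyq_eq_cell[OF h] c_def l_def by simp
  have sub: "dyq t h k x \<subseteq> cube c l" unfolding eq by (auto simp: mem_cube less_imp_le)
  then show "\<exists>c. dyq t h k x \<subseteq> cube c (h / 2 ^ k)" unfolding l_def by blast
  have sub2: "box c (\<chi> i. c $ i + l) \<subseteq> dyq t h k x"
    unfolding eq by (auto simp: mem_box_cart less_imp_le)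
  have nth [measurable]: "(\<lambda>y::real^'n. y $ i) \<in> borel_measurable borel" for i
    by (intro borel_measurable_continuous_onI continuous_intros)
  have "{y\<in>space (borel :: (real^'n) measure). \<forall>i. c $ i \<le> y $ i \<and> y $ i < c $ i + l} \<in> sets borel"
    by measurable
  then have "dyq t h k x \<in> sets borel" unfolding eq by simp
  then have "dyq t h k x \<in> sets lebesgue" by (simp add: sets_completionI_sets)
  then show m: "dyq t h k x \<in> lmeasurable"
    by (rule fmeasurableI2[OF cube_lmeasurable sub])
  have "vol (dyq t h k x) \<le> l ^ CARD('n)"
    using measure_mono_fmeasurable[OF sub _ cube_lmeasurable] m measure_cube[OF l, of c] by auto
  moreover have "vol (box c (\<chi> i. c $ i + l)) = vol (cube c l)"
    unfolding cube_def by (simp add: measure_lborel_box_eq measure_lborel_cbox_eq)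
  then have "l ^ CARD('n) \<le> vol (dyq t h k x)"
    using measure_mono_fmeasurable[OF sub2 _ m] measure_cube[OF l, of c] by auto
  ultimately show "vol (dyq t h k x) = (h / 2 ^ k) ^ CARD('n)" unfolding l_def by simp
qed

lemma dyq_dist:
  assumes "0 < h" "y \<in> dyq t h k x" shows "\<bar>y $ i - x $ i\<bar> < h / 2 ^ k"
proof -
  have "\<lfloor>(y $ i - t $ i) * 2 ^ k / h\<rfloor> = \<lfloor>(x $ i - t $ i) * 2 ^ k / h\<rfloor>" using assms(2) unfolding dyq_def by simp
  then have "\<bar>(y $ i - t $ i) * 2 ^ k / h - (x $ i - t $ i) * 2 ^ k / h\<bar> < 1" by linarith
  also have "(y $ i - t $ i) * 2 ^ k / h - (x $ i - t $ i) * 2 ^ k / h = (y $ i - x $ i) * (2 ^ k / h)"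
    by (simp add: algebra_simps diff_divide_distrib)
  finally have "\<bar>y $ i - x $ i\<bar> * (2 ^ k / h) < 1" using assms(1) by (simp add: abs_mult)
  then show ?thesis using assms(1) by (simp add: field_simps)
qed

lemma floor_double_cong:
  fixes a b :: real assumes "\<lfloor>2 * a\<rfloor> = \<lfloor>2 * b\<rfloor>" shows "\<lfloor>a\<rfloor> = \<lfloor>b\<rfloor>"
proof -
  have "2 * \<lfloor>a\<rfloor> \<le> \<lfloor>2 * a\<rfloor>" "\<lfloor>2 * a\<rfloor> \<le> 2 * \<lfloor>a\<rfloor> + 1" "2 * \<lfloor>b\<rfloor> \<le> \<lfloor>2 * b\<rfloor>" "\<lfloor>2 * b\<rfloor> \<le> 2 * \<lfloor>b\<rfloor> + 1"
    by linarith+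
  then show ?thesis using assms by linarith
qed

lemma dyadic_grid_dyq:
  fixes t :: "real^'n"
  assumes h: "0 < h"
  shows "dyadic_grid (dyq t h) (2 ^ CARD('n))"
proof
  fix k and x y :: "real^'n"
  show "x \<in> dyq t h k x" unfolding dyq_def by simp
  show "y \<in> dyq t h k x \<Longrightarrow> dyq t h k y = dyq t h k x" unfolding dyq_def by simp
  show "dyq t h (Suc k) x \<subseteq> dyq t h k x"
  proof
    fix y assume y: "y \<in> dyq t h (Suc k) x"
    have scale: "(z $ i - t $ i) * 2 ^ Suc k / h = 2 * ((z $ i - t $ i) * 2 ^ k / h)" for z :: "real^'n" and i
      by simp
    have "\<lfloor>(y $ i - t $ i) * 2 ^ Suc k / h\<rfloor> = \<lfloor>(x $ i - t $ i) * 2 ^ Suc k / h\<rfloor>" for i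
      using y[unfolded dyq_def, THEN CollectD, THEN spec] .
    then have "\<lfloor>(y $ i - t $ i) * 2 ^ k / h\<rfloor> = \<lfloor>(x $ i - t $ i) * 2 ^ k / h\<rfloor>" for i
      unfolding scale by (rule floor_double_cong)
    then show "y \<in> dyq t h k x" unfolding dyq_def by simp
  qed
  show "dyq t h k x \<in> lmeasurable" by (rule dyq_cube(1)[OF h])
  show "0 < vol (dyq t h k x)" unfolding dyq_cube(2)[OF h] using h by simp
  show "vol (dyq t h k x) \<le> 2 ^ CARD('n) * vol (dyq t h (Suc k) x)"
    unfolding dyq_cube(2)[OF h] power_mult_distrib[symmetric] using h by simp
  show "countable (range (dyq t h k))"
  proof (rule countable_subset)
    show "range (dyq t h k) \<subseteq> range (\<lambda>m::'n \<Rightarrow> int. {y. \<forall>i. \<lfloor>(y $ i - t $ i) * 2 ^ k / h\<rfloor> = m i})"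
      unfolding dyq_def by auto
  qed simp
  fix U :: "(real^'n) set" assume U: "open U" "x \<in> U"
  then obtain e where e: "0 < e" "ball x e \<subseteq> U" using openE by blast
  obtain k where k: "real CARD('n) * h / e < 2 ^ k" using real_arch_pow[of 2] by auto
  then have k': "real CARD('n) * (h / 2 ^ k) < e" using e by (simp add: field_simps)
  have "dyq t h k x \<subseteq> ball x e"
  proof
    fix y assume y: "y \<in> dyq t h k x"
    have "norm (y - x) \<le> (\<Sum>i\<in>UNIV. \<bar>(y - x) $ i\<bar>)" by (rule norm_le_l1_cart)
    also have "\<dots> \<le> (\<Sum>i\<in>(UNIV::'n set). h / 2 ^ k)"
      using dyq_dist[OF h y] by (intro sum_mono) (auto simp: less_imp_le)
    also have "\<dots> < e" using k' by simp
    finally show "y \<in> ball x e" by (simp add: dist_norm norm_minus_commute)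
  qed
  then show "\<exists>k. dyq t h k x \<subseteq> U" using e by blast
qed

text \<open>Closing a half-open cell adds no measure, so the weight constant over closed cubes
  passes to cells.\<close>

lemma grid_cubes:
  fixes t :: "real^'n"
  assumes h: "0 < h" and P: "P \<in> dyadic_grid.grid (dyq t h)"
  shows "\<exists>Q\<in>cubes. P \<subseteq> Q \<and> leb Q = leb P"
proof -
  obtain k x where P: "P = dyq t h k x"
    using P unfolding dyadic_grid.grid_def[OF dyadic_grid_dyq[OF h]] by auto
  have l: "0 < h / 2 ^ k" using h by simp
  obtain c where c: "dyq t h k x \<subseteq> cube c (h / 2 ^ k)" using dyq_cube(3)[OF h] by blast
  show ?thesis
  proof (intro bexI[of _ "cube c (h / 2 ^ k)"] conjI)
    show "leb (cube c (h / 2 ^ k)) = leb P"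
      unfolding P emeasure_cube[OF l] emeasure_eq_measure2[OF dyq_cube(1)[OF h]] dyq_cube(2)[OF h] ..
  qed (use c P cube_in_cubes[OF l] in auto)
qed

text \<open>Coordinates are shifted independently, as a cube may be cut by the grid in some
  coordinates only; this makes 2 ^ n grids per scale.\<close>

definition shift_vec :: "real \<Rightarrow> 'n set \<Rightarrow> real^'n" where
  "shift_vec h A = (\<chi> i. if i \<in> A then h / 3 else 0)"

text \<open>Measured in cell sides, the endpoints of the two grids are m and m' + 2 ^ k / 3 with
  integers m and m'. If both lay in a half-open interval of length at most 1 / 3, then 3 (m - m') -
  2 ^ k would have absolute value below 1 and vanish; but 3 does not divide a power of 2.\<close>

lemma no_common_endpoint:
  fixes a l h :: real
  assumes h: "0 < h" and small: "3 * l \<le> h / 2 ^ k"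
    and u: "\<lfloor>a * 2 ^ k / h\<rfloor> \<noteq> \<lfloor>b * 2 ^ k / h\<rfloor>" "a \<le> b" "b \<le> a + l"
    and v: "\<lfloor>(a - h / 3) * 2 ^ k / h\<rfloor> \<noteq> \<lfloor>(c - h / 3) * 2 ^ k / h\<rfloor>" "a \<le> c" "c \<le> a + l"
  shows False
proof -
  define w where "w = 2 ^ k / h"
  have w: "0 < w" unfolding w_def using h by simp
  have lw: "3 * (l * w) \<le> 1" unfolding w_def using small h by (simp add: field_simps)
  have bw: "a * w \<le> b * w" "b * w \<le> a * w + l * w" "a * w \<le> c * w" "c * w \<le> a * w + l * w"
    using u v w by (simp_all add: mult_right_mono distrib_right[symmetric])
  have hw: "h / 3 * w = 2 ^ k / 3" unfolding w_def using h by simp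
  have "\<lfloor>a * w\<rfloor> < \<lfloor>b * w\<rfloor>"
    using u(1) floor_mono[OF bw(1)] unfolding w_def by simp
  then have m: "a * w < \<lfloor>b * w\<rfloor>" "\<lfloor>b * w\<rfloor> \<le> a * w + l * w" using bw by linarith+
  have aw: "(a - h / 3) * 2 ^ k / h = a * w - 2 ^ k / 3" "(c - h / 3) * 2 ^ k / h = c * w - 2 ^ k / 3"
    using hw unfolding w_def by (simp_all add: left_diff_distrib diff_divide_distrib)
  have "\<lfloor>a * w - 2 ^ k / 3\<rfloor> < \<lfloor>c * w - 2 ^ k / 3\<rfloor>"
    using v(1) floor_mono[of "a * w - 2 ^ k / 3" "c * w - 2 ^ k / 3"] bw unfolding aw by simp
  then have m': "a * w - 2 ^ k / 3 < \<lfloor>c * w - 2 ^ k / 3\<rfloor>" "\<lfloor>c * w - 2 ^ k / 3\<rfloor> \<le> a * w + l * w - 2 ^ k / 3"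
    using bw by linarith+
  define z where "z = \<lfloor>b * w\<rfloor> - \<lfloor>c * w - 2 ^ k / 3\<rfloor>"
  have "\<bar>3 * real_of_int z - 2 ^ k\<bar> < 1" unfolding z_def using m m' lw by (simp add: abs_less_iff)
  then have "\<bar>real_of_int (3 * z - 2 ^ k)\<bar> < 1" by simp
  then have "3 * z - 2 ^ k = 0" by linarith
  then have "(3::int) dvd 2 ^ k" by (metis dvd_triv_left eq_iff_diff_eq_0)
  moreover have "coprime (3::int) (2 ^ k)" by simp
  ultimately have "is_unit (3::int)" by (metis coprime_absorb_left)
  then show False by simp
qed

text \<open>The one-third trick: the grid endpoints at each scale of the two shifts stay at least one third of the side apart.\<close>

lemma cube_in_shifted_grid:
  fixes a :: "real^'n"
  assumes l: "0 < l" and h: "3 * l \<le> h"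
  obtains A k where "\<And>x. x \<in> cube a l \<Longrightarrow> cube a l \<subseteq> dyq (shift_vec h A) h k x" "h / 2 ^ k \<le> 6 * l"
proof -
  have h0: "0 < h" using l h by linarith
  obtain n where n: "h / (3 * l) < 2 ^ n" using real_arch_pow[of 2] by auto
  \<comment> \<open>\<open>m\<close> is the first generation with side below \<open>3 * l\<close>;
    the one before it has side between \<open>3 * l\<close> and \<open>6 * l\<close>.\<close>
  define m where "m = (LEAST m. h / 2 ^ m < 3 * l)"
  have "h / 2 ^ n < 3 * l" using n l by (simp add: field_simps)
  then have m: "h / 2 ^ m < 3 * l" unfolding m_def by (rule LeastI)
  have "m \<noteq> 0" using m h by (intro notI) simp
  then obtain k where k: "m = Suc k" by (cases m) auto
  have k1: "3 * l \<le> h / 2 ^ k" using not_less_Least[of k "\<lambda>m. h / 2 ^ m < 3 * l"] k m_def by auto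
  have k2: "h / 2 ^ k \<le> 6 * l" using m unfolding k by (simp add: field_simps)
  \<comment> \<open>The coordinates in which the unshifted grid cuts the cube; exactly these are
    shifted.\<close>
  define A where "A = {i. \<exists>b. a $ i \<le> b \<and> b \<le> a $ i + l \<and> \<lfloor>a $ i * 2 ^ k / h\<rfloor> \<noteq> \<lfloor>b * 2 ^ k / h\<rfloor>}"
  let ?t = "shift_vec h A"
  have same: "\<lfloor>(x $ i - ?t $ i) * 2 ^ k / h\<rfloor> = \<lfloor>(a $ i - ?t $ i) * 2 ^ k / h\<rfloor>" if x: "x \<in> cube a l" for x i
  proof (cases "i \<in> A")
    case True
    then obtain b where b: "a $ i \<le> b" "b \<le> a $ i + l" "\<lfloor>a $ i * 2 ^ k / h\<rfloor> \<noteq> \<lfloor>b * 2 ^ k / h\<rfloor>" unfolding A_def by auto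
    have "a $ i \<le> x $ i" "x $ i \<le> a $ i + l" using x by (auto simp: mem_cube)
    then have "\<lfloor>(a $ i - h / 3) * 2 ^ k / h\<rfloor> = \<lfloor>(x $ i - h / 3) * 2 ^ k / h\<rfloor>"
      using no_common_endpoint[OF h0 k1 b(3,1,2)] by blast
    then show ?thesis using True unfolding shift_vec_def by simp
  next
    case False
    then show ?thesis using x unfolding A_def shift_vec_def by (auto simp: mem_cube)
  qed
  have "cube a l \<subseteq> dyq ?t h k x" if "x \<in> cube a l" for x
    unfolding dyq_def using same that by auto
  then show ?thesis using that[of A k] k2 by blast
qed

section \<open>Powers of extended numbers and measurability of matrix inverses\<close>

lemma ennpowr_ennreal: "0 \<le> x \<Longrightarrow> ennpowr (ennreal x) a = ennreal (x powr a)"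
  unfolding ennpowr_def by simp

lemma ennpowr_top: "ennpowr top a = top"
  unfolding ennpowr_def by simp

lemma ennpowr_mono: "x \<le> y \<Longrightarrow> 0 < a \<Longrightarrow> ennpowr x a \<le> ennpowr y a"
  by (cases x; cases y) (auto simp: ennpowr_ennreal ennpowr_top top_unique intro!: ennreal_leI powr_mono2)

lemma ennpowr_ennpowr: "ennpowr (ennpowr x a) b = ennpowr x (a * b)"
  by (cases x) (auto simp: ennpowr_ennreal ennpowr_top powr_powr)

lemma ennpowr_one: "ennpowr x 1 = x"
  by (cases x) (auto simp: ennpowr_ennreal ennpowr_top)

lemma ennpowr_mult_ennreal: "0 < c \<Longrightarrow> ennpowr (ennreal c * x) a = ennreal (c powr a) * ennpowr x a"
  by (cases x) (auto simp: ennpowr_ennreal ennpowr_top ennreal_mult[symmetric] powr_mult ennreal_mult_top)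

lemma ennpowr_measurable [measurable]: "(\<lambda>x. ennpowr x a) \<in> borel_measurable borel"
  unfolding ennpowr_def by measurable

lemma borel_measurable_vecI:
  fixes f :: "'a \<Rightarrow> ('b::euclidean_space)^'n"
  assumes "\<And>i. (\<lambda>x. f x $ i) \<in> borel_measurable M"
  shows "f \<in> borel_measurable M"
  unfolding borel_measurable_euclidean_space[of f]
proof
  fix b :: "'b^'n" assume "b \<in> Basis"
  then obtain k u where b: "b = axis k u" unfolding Basis_vec_def by blast
  show "(\<lambda>x. f x \<bullet> b) \<in> borel_measurable M"
    unfolding b inner_axis by (rule borel_measurable_inner[OF assms borel_measurable_const])
qed

lemma borel_measurable_vec_nth:
  fixes f :: "'a \<Rightarrow> ('b::euclidean_space)^'n"
  assumes "f \<in> borel_measurable M"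
  shows "(\<lambda>x. f x $ i) \<in> borel_measurable M"
  using borel_measurable_continuous_on[OF _ assms, of "\<lambda>v. v $ i"] by (simp add: continuous_on_component continuous_on_id)

lemma borel_measurable_det:
  fixes A :: "'a \<Rightarrow> real^'d^'d"
  assumes "\<And>i j. (\<lambda>x. A x $ i $ j) \<in> borel_measurable M"
  shows "(\<lambda>x. det (A x)) \<in> borel_measurable M"
  unfolding det_def using assms by measurable

lemma matrix_inv_props:
  fixes A :: "real^'d^'d"
  assumes "invertible A"
  shows "A ** matrix_inv A = mat 1" "matrix_inv A ** A = mat 1"
proof -
  have "A ** matrix_inv A = mat 1 \<and> matrix_inv A ** A = mat 1"
    using assms unfolding invertible_def matrix_inv_def by (rule someI_ex)
  then show "A ** matrix_inv A = mat 1" "matrix_inv A ** A = mat 1" by auto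
qed

text \<open>Cramer's rule makes each entry of the inverse a quotient of determinants, which are
  polynomials in the entries.\<close>

lemma borel_measurable_matrix_inv:
  fixes A :: "'a \<Rightarrow> real^'d^'d"
  assumes A: "A \<in> borel_measurable M" and inv: "\<And>x. invertible (A x)"
  shows "(\<lambda>x. matrix_inv (A x)) \<in> borel_measurable M"
proof -
  have entry [measurable]: "(\<lambda>x. A x $ i $ j) \<in> borel_measurable M" for i j
    by (intro borel_measurable_vec_nth A)
  have eq: "matrix_inv (A x) $ i $ j =
      det (\<chi> k l. if l = i then (axis j 1 :: real^'d) $ k else A x $ k $ l) / det (A x)" for x i j
  proof -
    have "A x *v (matrix_inv (A x) *v axis j 1) = axis j 1"
      by (simp add: matrix_vector_mul_assoc matrix_inv_props[OF inv])
    moreover have "det (A x) \<noteq> 0" using inv invertible_det_nz by blast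
    ultimately have sol: "matrix_inv (A x) *v axis j 1 =
        (\<chi> k. det (\<chi> i l. if l = k then (axis j 1 :: real^'d) $ i else A x $ i $ l) / det (A x))"
      using cramer by blast
    have "matrix_inv (A x) $ i $ j = (matrix_inv (A x) *v axis j 1) $ i"
      by (simp add: matrix_vector_mult_basis column_def)
    also have "\<dots> = det (\<chi> k l. if l = i then (axis j 1 :: real^'d) $ k else A x $ k $ l) / det (A x)"
      unfolding sol vec_lambda_beta ..
    finally show ?thesis .
  qed
  show ?thesis
  proof (intro borel_measurable_vecI)
    fix i j
    have "(\<lambda>x. det (\<chi> k l. if l = i then (axis j 1 :: real^'d) $ k else A x $ k $ l)) \<in> borel_measurable M"
    proof (rule borel_measurable_det)
      fix k l
      show "(\<lambda>x. (\<chi> k l. if l = i then (axis j 1 :: real^'d) $ k else A x $ k $ l) $ k $ l) \<in> borel_measurable M"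
        by (cases "l = i") simp_all
    qed
    moreover have "(\<lambda>x. det (A x)) \<in> borel_measurable M" by (rule borel_measurable_det) (rule entry)
    ultimately show "(\<lambda>x. matrix_inv (A x) $ i $ j) \<in> borel_measurable M" unfolding eq by measurable
  qed
qed

lemma pos_def_invertible:
  fixes A :: "real^'d^'d"
  assumes "pos_def A" shows "invertible A"
proof -
  have "x = 0" if "A *v x = 0" for x
  proof (rule ccontr)
    assume "x \<noteq> 0"
    then have "0 < x \<bullet> (A *v x)" using assms unfolding pos_def_def by simp
    then show False using that by simp
  qed
  then show ?thesis
    using matrix_left_invertible_ker[of A] invertible_left_inverse[of A] by blast
qed

lemma transpose_matrix_inv:
  fixes A :: "real^'d^'d"
  assumes "invertible A" "transpose A = A"
  shows "transpose (matrix_inv A) = matrix_inv A"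
proof -
  have "transpose (A ** matrix_inv A) = mat 1"
    by (simp only: matrix_inv_props(1)[OF assms(1)] transpose_mat)
  then have "transpose (matrix_inv A) ** A = mat 1" unfolding matrix_transpose_mul assms(2) .
  then have "transpose (matrix_inv A) ** (A ** matrix_inv A) = matrix_inv A"
    by (simp add: matrix_mul_assoc)
  then show ?thesis using matrix_inv_props(1)[OF assms(1)] by simp
qed

text \<open>The weight constant contains \<open>W x ** matrix_inv (W y)\<close>, while duality
  produces the transpose. Its value at \<open>u\<close> is estimated through the inner product of
  \<open>u\<close> with \<open>A *v (transpose A *v u)\<close>.\<close>

lemma norm_transpose_le_op_norm:
  fixes A :: "real^'d^'d"
  shows "ennreal (norm (transpose A *v u)) \<le> op_norm A * ennreal (norm u)"
proof -
  let ?b = "transpose A *v u"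
  have "norm ?b * norm ?b = ?b \<bullet> ?b" by (simp add: power2_norm_eq_inner[symmetric] power2_eq_square)
  also have "\<dots> = u \<bullet> (A *v ?b)" unfolding transpose_matrix_vector dot_lmul_matrix ..
  also have "\<dots> \<le> norm u * norm (A *v ?b)" by (rule norm_cauchy_schwarz)
  also have "\<dots> \<le> norm u * (onorm (\<lambda>v. A *v v) * norm ?b)"
    by (intro mult_left_mono onorm matrix_vector_mul_bounded_linear) auto
  finally have "norm ?b * norm ?b \<le> (onorm (\<lambda>v. A *v v) * norm u) * norm ?b" by (simp add: mult_ac)
  then have "norm ?b \<le> onorm (\<lambda>v. A *v v) * norm u"
    using onorm_pos_le[OF matrix_vector_mul_bounded_linear[of A]]
    by (cases "norm ?b = 0") (auto simp: mult_le_cancel_right)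
  then show ?thesis
    unfolding op_norm_def using onorm_pos_le[OF matrix_vector_mul_bounded_linear[of A]]
    by (simp add: ennreal_mult[symmetric] ennreal_leI)
qed

text \<open>Taking the identity on the exceptional null set makes inverses exist everywhere and
  removes the unspecified values of \<open>matrix_inv\<close>, without affecting any
  integral.\<close>

definition reg :: "(real^'n \<Rightarrow> real^'d^'d) \<Rightarrow> real^'n \<Rightarrow> real^'d^'d" where
  "reg W x = (if pos_def (W x) then W x else mat 1)"

lemma pos_def_reg:
  fixes W :: "real^'n \<Rightarrow> real^'d^'d"
  shows "pos_def (reg W x)"
proof -
  have "pos_def (mat 1 :: real^'d^'d)" unfolding pos_def_def by (simp add: transpose_mat)
  then show ?thesis unfolding reg_def by simp
qed

lemma reg_measurable:
  assumes "matrix_weight W"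
  shows "reg W \<in> borel_measurable lebesgue" "(\<lambda>x. matrix_inv (reg W x)) \<in> borel_measurable lebesgue"
proof -
  have W: "W \<in> borel_measurable lebesgue" "AE x in lebesgue. pos_def (W x)"
    using assms unfolding matrix_weight_def by auto
  have "{x. \<not> pos_def (W x)} \<in> null_sets lebesgue"
    using W(2) unfolding completion.AE_iff_null_sets by simp
  then have "space lebesgue - {x. \<not> pos_def (W x)} \<in> sets lebesgue"
    by (intro sets.compl_sets null_setsD2)
  moreover have "{x. pos_def (W x)} \<inter> space lebesgue = space lebesgue - {x. \<not> pos_def (W x)}" by auto
  ultimately have "{x. pos_def (W x)} \<inter> space lebesgue \<in> sets lebesgue" by (simp only:)
  from measurable_If_set[OF W(1) measurable_const this, of "mat 1"]
  show "reg W \<in> borel_measurable lebesgue" unfolding reg_def[abs_def] by simp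
  then show "(\<lambda>x. matrix_inv (reg W x)) \<in> borel_measurable lebesgue"
    by (rule borel_measurable_matrix_inv) (rule pos_def_invertible[OF pos_def_reg])
qed

lemma norm_inv_mult_le:
  assumes "pos_def (W x)" "pos_def (W y)"
  shows "ennreal (norm (matrix_inv (reg W y) *v (reg W x *v u))) \<le>
    op_norm (W x ** matrix_inv (W y)) * ennreal (norm u)"
proof -
  have x: "reg W x = W x" "transpose (W x) = W x" and y: "reg W y = W y" "transpose (W y) = W y"
    using assms unfolding reg_def pos_def_def by auto
  have "matrix_inv (W y) ** W x = transpose (W x ** matrix_inv (W y))"
    unfolding matrix_transpose_mul x(2) transpose_matrix_inv[OF pos_def_invertible[OF assms(2)] y(2)] ..
  then show ?thesis
    using norm_transpose_le_op_norm[of "W x ** matrix_inv (W y)" u] x y by (simp add: matrix_vector_mul_assoc)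
qed

section \<open>Weight constants and convex-set valued functions\<close>

text \<open>\<open>f\<close> need not be measurable, so the inner averages in the weight constant require no measurability proof.\<close>

lemma nn_integral_cmult_le:
  fixes f :: "'a \<Rightarrow> ennreal"
  assumes c: "0 < c"
  shows "(\<integral>\<^sup>+x. ennreal c * f x \<partial>M) \<le> ennreal c * (\<integral>\<^sup>+x. f x \<partial>M)"
  unfolding nn_integral_def[of M "\<lambda>x. ennreal c * f x"]
proof (rule SUP_least)
  fix g assume "g \<in> {g. simple_function M g \<and> g \<le> (\<lambda>x. ennreal c * f x)}"
  then have g: "simple_function M g" "\<And>x. g x \<le> ennreal c * f x" by (auto simp: le_fun_def)
  have inv: "ennreal (1 / c) * (ennreal c * z) = z" "ennreal c * (ennreal (1 / c) * z) = z" for z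
    unfolding mult.assoc[symmetric] using c by (simp_all add: ennreal_mult[symmetric])
  have s: "simple_function M (\<lambda>x. ennreal (1 / c) * g x)" using g(1) by simp
  have "ennreal (1 / c) * g x \<le> f x" for x
    using mult_left_mono[OF g(2)[of x], of "ennreal (1 / c)"] unfolding inv by simp
  then have "(\<integral>\<^sup>+x. ennreal (1 / c) * g x \<partial>M) \<le> (\<integral>\<^sup>+x. f x \<partial>M)" by (intro nn_integral_mono)
  then have "ennreal c * (\<integral>\<^sup>+x. ennreal (1 / c) * g x \<partial>M) \<le> ennreal c * (\<integral>\<^sup>+x. f x \<partial>M)" by (intro mult_left_mono) auto
  moreover have "(\<integral>\<^sup>+x. ennreal (1 / c) * g x \<partial>M) = ennreal (1 / c) * (\<integral>\<^sup>+x. g x \<partial>M)"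
    by (rule nn_integral_cmult) (rule borel_measurable_simple_function[OF g(1)])
  ultimately show "integral\<^sup>S M g \<le> ennreal c * (\<integral>\<^sup>+x. f x \<partial>M)"
    unfolding nn_integral_eq_simple_integral[OF g(1), symmetric] by (simp only: inv)
qed

lemma ennreal_divide_mult_cancel:
  fixes x m :: ennreal
  assumes "m \<noteq> 0" "m < top"
  shows "x / m * m = x"
  using assms by (simp add: ennreal_divide_times ennreal_divide_self)

lemma cubes_props:
  assumes "Q \<in> cubes"
  shows "Q \<in> sets lebesgue" "leb Q \<noteq> 0" "leb Q < top" "Q \<in> lmeasurable"
    "0 < vol Q"
proof -
  obtain a l where Q: "Q = cube a l" "0 < l" using cubesE[OF assms] by blast
  show "Q \<in> lmeasurable" unfolding Q by (rule cube_lmeasurable)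
  then show "Q \<in> sets lebesgue" by simp
  show "leb Q \<noteq> 0" "leb Q < top"
    unfolding Q emeasure_cube[OF Q(2)] using Q(2) by simp_all
  show "0 < vol Q" unfolding Q measure_cube[OF Q(2)] using Q(2) by simp
qed

lemma inv_reg_apply: "reg W x *v (matrix_inv (reg W x) *v v) = v" "matrix_inv (reg W x) *v (reg W x *v v) = v"
  by (simp_all add: matrix_vector_mul_assoc matrix_inv_props[OF pos_def_invertible[OF pos_def_reg]])

definition inner_avg :: "(real^'n \<Rightarrow> real^'d^'d) \<Rightarrow> real \<Rightarrow> (real^'n) set \<Rightarrow> real^'n \<Rightarrow> ennreal" where
  "inner_avg W r Q x = navg Q (\<lambda>y. ennpowr (op_norm (W x ** matrix_inv (W y))) r)"

lemma nn_integral_inv_le_inner_avg: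
  assumes W: "matrix_weight W" and x: "pos_def (W x)" and Q: "Q \<in> cubes" and r: "0 < r"
  shows "(\<integral>\<^sup>+y\<in>Q. ennreal (norm (matrix_inv (reg W y) *v (reg W x *v u)) powr r) \<partial>lebesgue)
    \<le> ennreal (norm u powr r) * (inner_avg W r Q x * leb Q)"
proof (cases "u = 0")
  case False
  have "AE y in lebesgue. pos_def (W y)" using W unfolding matrix_weight_def by auto
  then have "AE y in lebesgue. ennreal (norm (matrix_inv (reg W y) *v (reg W x *v u)) powr r) * indicator Q y
      \<le> ennreal (norm u powr r) * (ennpowr (op_norm (W x ** matrix_inv (W y))) r * indicator Q y)"
  proof eventually_elim
    case (elim y)
    have "ennreal (norm (matrix_inv (reg W y) *v (reg W x *v u)) powr r) =
        ennpowr (ennreal (norm (matrix_inv (reg W y) *v (reg W x *v u)))) r"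
      by (simp add: ennpowr_ennreal)
    also have "\<dots> \<le> ennpowr (ennreal (norm u) * op_norm (W x ** matrix_inv (W y))) r"
      using norm_inv_mult_le[OF x elim, of u] r by (intro ennpowr_mono) (simp_all add: mult.commute)
    also have "\<dots> = ennreal (norm u powr r) * ennpowr (op_norm (W x ** matrix_inv (W y))) r"
      using False by (intro ennpowr_mult_ennreal) simp
    finally show ?case by (cases "y \<in> Q") simp_all
  qed
  then have "(\<integral>\<^sup>+y\<in>Q. ennreal (norm (matrix_inv (reg W y) *v (reg W x *v u)) powr r) \<partial>lebesgue) \<le>
      (\<integral>\<^sup>+y. ennreal (norm u powr r) * (ennpowr (op_norm (W x ** matrix_inv (W y))) r * indicator Q y) \<partial>lebesgue)"
    by (rule nn_integral_mono_AE)
  also have "\<dots> \<le> ennreal (norm u powr r) * (\<integral>\<^sup>+y\<in>Q. ennpowr (op_norm (W x ** matrix_inv (W y))) r \<partial>lebesgue)"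
    using False by (intro nn_integral_cmult_le) simp
  also have "(\<integral>\<^sup>+y\<in>Q. ennpowr (op_norm (W x ** matrix_inv (W y))) r \<partial>lebesgue) = inner_avg W r Q x * leb Q"
    unfolding inner_avg_def navg_def using cubes_props[OF Q] by (intro ennreal_divide_mult_cancel[symmetric])
  finally show ?thesis .
qed (use r in simp)

text \<open>A cell and its closed cube have equal measure, so averages over the cell are dominated
  by those over the cube. The factor \<open>real CARD('d) powr (pr - 1)\<close> comes from raising a
  sum of d terms to the power \<open>pr - 1\<close>.\<close>

lemma dyadic_weight_Ap:
  fixes W :: "real^'n \<Rightarrow> real^'d^'d" and t :: "real^'n"
  assumes W: "matrix_weight W" and pr: "1 < pr" and A: "0 < A" "Ap_const (ennreal pr) W \<le> ennreal A" and h: "0 < h"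
  shows "dyadic_weight (dyq t h) (2 ^ CARD('n)) (reg W) (\<lambda>x. matrix_inv (reg W x)) (pr / (pr - 1))
    (real CARD('d) powr (pr - 1) * A powr pr)"
proof -
  define r where "r = pr / (pr - 1)"
  have r: "1 < r" unfolding r_def using pr by (simp add: field_simps)
  have r1: "1 / (r - 1) = pr - 1" unfolding r_def using pr by (simp add: field_simps)
  have conj: "conj_exp (ennreal pr) = r" unfolding conj_exp_def r_def using pr by simp
  have prr: "pr / r = pr - 1" unfolding r_def using pr by simp
  interpret G: dyadic_grid "dyq t h" "2 ^ CARD('n)" by (rule dyadic_grid_dyq[OF h])
  have pd: "AE y in lebesgue. pos_def (W y)" using W unfolding matrix_weight_def by auto
  have Ap: "(\<integral>\<^sup>+x\<in>Q. ennpowr (inner_avg W r Q x) (pr - 1) \<partial>lebesgue) \<le> ennreal (A powr pr) * leb Q"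
    if Q: "Q \<in> cubes" for Q
  proof -
    let ?X = "navg Q (\<lambda>x. ennpowr (inner_avg W r Q x) (pr - 1))"
    have "ennpowr ?X (1 / pr) \<le> Ap_const (ennreal pr) W"
      unfolding Ap_const_def inner_avg_def conj using Q pr prr by (auto intro!: SUP_upper2[of Q])
    then have "ennpowr ?X (1 / pr) \<le> ennreal A" using A by auto
    then have "ennpowr (ennpowr ?X (1 / pr)) pr \<le> ennpowr (ennreal A) pr" using pr by (intro ennpowr_mono) auto
    then have "?X \<le> ennreal (A powr pr)"
      unfolding ennpowr_ennpowr using pr A by (simp add: ennpowr_one ennpowr_ennreal)
    then have "?X * leb Q \<le> ennreal (A powr pr) * leb Q" by (rule mult_right_mono) simp
    then show ?thesis
      unfolding navg_def ennreal_divide_mult_cancel[OF cubes_props(2,3)[OF Q]] .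
  qed
  \<comment> \<open>At each \<open>x\<close>, \<open>v\<close> is the image under
    \<open>reg W x\<close> of some vector. An infinite integral would therefore make the inner
    average infinite almost everywhere on \<open>Q\<close>, against \<open>Ap\<close>.\<close>
  have fin: "(\<integral>\<^sup>+y\<in>P. ennreal (norm (matrix_inv (reg W y) *v v) powr r) \<partial>lebesgue) < \<infinity>"
    if P: "P \<in> G.grid" for P v
  proof (rule ccontr)
    obtain Q where Q: "Q \<in> cubes" "P \<subseteq> Q" using grid_cubes[OF h P] by blast
    note [measurable] = cubes_props(1)[OF Q(1)]
    let ?I = "\<lambda>R. \<integral>\<^sup>+y\<in>R. ennreal (norm (matrix_inv (reg W y) *v v) powr r) \<partial>lebesgue"
    assume "\<not> ?I P < \<infinity>"
    then have "?I P = top" by (simp only: less_top[symmetric] infinity_ennreal_def not_not)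
    moreover have "?I P \<le> ?I Q" by (rule nn_set_integral_set_mono[OF Q(2)])
    ultimately have top: "?I Q = top" by (simp only: top_unique)
    have "AE x in lebesgue. top * indicator Q x \<le> ennpowr (inner_avg W r Q x) (pr - 1) * indicator Q x"
      using pd
    proof eventually_elim
      case (elim x)
      have "top \<le> ennreal (norm (matrix_inv (reg W x) *v v) powr r) * (inner_avg W r Q x * leb Q)"
        using nn_integral_inv_le_inner_avg[OF W elim Q(1), of r "matrix_inv (reg W x) *v v"] r top
        by (simp add: inv_reg_apply)
      then have "inner_avg W r Q x = top"
        using cubes_props(3)[OF Q(1)] by (auto simp: top_unique ennreal_mult_eq_top_iff)
      then show ?case by (simp add: ennpowr_top)
    qed
    then have "(\<integral>\<^sup>+x. top * indicator Q x \<partial>lebesgue) \<le> (\<integral>\<^sup>+x\<in>Q. ennpowr (inner_avg W r Q x) (pr - 1) \<partial>lebesgue)"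
      by (rule nn_integral_mono_AE)
    also note Ap[OF Q(1)]
    finally have "top * leb Q \<le> ennreal (A powr pr) * leb Q"
      by (simp add: nn_integral_cmult_indicator)
    then show False
      using cubes_props(2,3)[OF Q(1)] by (auto simp: ennreal_mult_eq_top_iff top_unique ennreal_top_mult)
  qed
  have muck: "(\<integral>\<^sup>+x\<in>P. ennreal ((\<Sum>i\<in>UNIV. weight_avg (\<lambda>x. matrix_inv (reg W x)) r P (reg W x *v axis i 1)) powr (1 / (r - 1))) \<partial>lebesgue)
      \<le> ennreal (real CARD('d) powr (pr - 1) * A powr pr) * leb P" if P: "P \<in> G.grid" for P
  proof -
    obtain Q where Q: "Q \<in> cubes" "P \<subseteq> Q" and eqm: "leb Q = leb P"
      using grid_cubes[OF h P] by blast
    let ?d = "real CARD('d)"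
    have "AE x in lebesgue. ennreal ((\<Sum>i\<in>UNIV. weight_avg (\<lambda>x. matrix_inv (reg W x)) r P (reg W x *v axis i 1)) powr (pr - 1)) * indicator P x
      \<le> ennreal (?d powr (pr - 1)) * (ennpowr (inner_avg W r Q x) (pr - 1) * indicator Q x)"
      using pd
    proof eventually_elim
      case (elim x)
      have "ennreal ((\<Sum>i\<in>UNIV. weight_avg (\<lambda>x. matrix_inv (reg W x)) r P (reg W x *v axis i 1)) powr (pr - 1))
        \<le> ennreal (?d powr (pr - 1)) * ennpowr (inner_avg W r Q x) (pr - 1)"
      proof (cases "inner_avg W r Q x")
        case (real \<nu>)
        have "weight_avg (\<lambda>x. matrix_inv (reg W x)) r P (reg W x *v axis i 1) \<le> \<nu>" for i
        proof -
          let ?J = "\<lambda>R. \<integral>\<^sup>+y\<in>R. ennreal (norm (matrix_inv (reg W y) *v (reg W x *v axis i 1)) powr r) \<partial>lebesgue"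
          have "?J P \<le> ?J Q" by (rule nn_set_integral_set_mono[OF Q(2)])
          also have "\<dots> \<le> ennreal (norm (axis i 1 :: real^'d) powr r) * (inner_avg W r Q x * leb Q)"
            using r by (intro nn_integral_inv_le_inner_avg[OF W elim Q(1)]) simp
          also have "\<dots> = ennreal (\<nu> * vol P)"
            unfolding real eqm G.grid_emeasure(1)[OF P] using real by (simp add: ennreal_mult)
          finally have "enn2real (?J P) \<le> \<nu> * vol P"
            using real by (intro enn2real_leI) auto
          then show ?thesis unfolding weight_avg_def using G.grid_emeasure(2)[OF P] by (simp add: divide_le_eq)
        qed
        then have "(\<Sum>i\<in>UNIV. weight_avg (\<lambda>x. matrix_inv (reg W x)) r P (reg W x *v axis i 1)) \<le> ?d * \<nu>"
          by (intro order_trans[OF sum_bounded_above[of UNIV _ \<nu>]]) simp_all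
        then have "(\<Sum>i\<in>UNIV. weight_avg (\<lambda>x. matrix_inv (reg W x)) r P (reg W x *v axis i 1)) powr (pr - 1) \<le> (?d * \<nu>) powr (pr - 1)"
          using pr by (intro powr_mono2) (auto intro!: sum_nonneg simp: weight_avg_def)
        then show ?thesis using real by (simp add: ennpowr_ennreal powr_mult ennreal_mult[symmetric] ennreal_leI)
      next
        case top
        then show ?thesis by (simp add: ennpowr_top ennreal_mult_top)
      qed
      then show ?case using Q(2) by (cases "x \<in> P") auto
    qed
    then have "(\<integral>\<^sup>+x\<in>P. ennreal ((\<Sum>i\<in>UNIV. weight_avg (\<lambda>x. matrix_inv (reg W x)) r P (reg W x *v axis i 1)) powr (pr - 1)) \<partial>lebesgue)
      \<le> (\<integral>\<^sup>+x. ennreal (?d powr (pr - 1)) * (ennpowr (inner_avg W r Q x) (pr - 1) * indicator Q x) \<partial>lebesgue)"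
      by (rule nn_integral_mono_AE)
    also have "\<dots> \<le> ennreal (?d powr (pr - 1)) * (\<integral>\<^sup>+x\<in>Q. ennpowr (inner_avg W r Q x) (pr - 1) \<partial>lebesgue)"
      by (rule nn_integral_cmult_le) simp
    also have "\<dots> \<le> ennreal (?d powr (pr - 1)) * (ennreal (A powr pr) * leb Q)"
      by (intro mult_left_mono Ap Q) simp
    also have "\<dots> = ennreal (?d powr (pr - 1) * A powr pr) * leb P"
      unfolding eqm by (simp add: ennreal_mult mult.assoc)
    finally show ?thesis unfolding r1 .
  qed
  show ?thesis
    unfolding r_def[symmetric]
  proof (intro dyadic_weight.intro dyadic_weight_axioms.intro)
    show "reg W x ** matrix_inv (reg W x) = mat 1" for x
      by (rule matrix_inv_props(1)[OF pos_def_invertible[OF pos_def_reg]])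
    show "0 < real CARD('d) powr (pr - 1) * A powr pr" using A by simp
  qed (use G.dyadic_grid_axioms reg_measurable[OF W] r fin muck in auto)
qed

section \<open>Measurability and values of the maximal operator\<close>

abbreviation wnorm :: "(real^'n \<Rightarrow> real^'d^'d) \<Rightarrow> (real^'n \<Rightarrow> (real^'d) set) \<Rightarrow> real^'n \<Rightarrow> ennreal" where
  "wnorm W F x \<equiv> set_norm ((\<lambda>v. W x *v v) ` F x)"

text \<open>The pairs (v, A) with \<open>t < ennreal (norm (A *v v))\<close> form an open set, hence
  a countable union of products of basic open sets. On a product the condition splits into one on
  \<open>F x\<close> and one on \<open>W x\<close>, which avoids measurable selections.\<close>

lemma set_norm_measurable:
  fixes W :: "real^'n \<Rightarrow> real^'d^'d"
  assumes F: "set_measurable F" and W: "W \<in> borel_measurable lebesgue"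
  shows "(\<lambda>x. wnorm W F x) \<in> borel_measurable lebesgue"
proof (rule borel_measurableI_greater)
  fix t :: ennreal
  define O1 :: "((real^'d) \<times> (real^'d^'d)) set" where "O1 = {z. t < ennreal (norm (snd z *v fst z))}"
  have "continuous_on UNIV (\<lambda>z::(real^'d) \<times> (real^'d^'d). snd z *v fst z)"
    unfolding matrix_vector_mult_def by (intro continuous_intros)
  then have "continuous_on UNIV (\<lambda>z::(real^'d) \<times> (real^'d^'d). ennreal (norm (snd z *v fst z)))"
    by (intro continuous_on_ennreal continuous_on_norm)
  then have O1: "open O1"
    unfolding O1_def by (rule open_Collect_less[OF continuous_on_const])
  obtain B1 :: "(real^'d) set set" where B1: "countable B1" "topological_basis B1"
    using ex_countable_basis by blast
  obtain B2 :: "(real^'d^'d) set set" where B2: "countable B2" "topological_basis B2"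
    using ex_countable_basis by blast
  let ?I = "{(U, T)\<in>B1 \<times> B2. U \<times> T \<subseteq> O1}"
  have I: "countable ?I" by (rule countable_subset[of _ "B1 \<times> B2"]) (use B1 B2 in auto)
  have "{x\<in>space lebesgue. t < wnorm W F x} =
      (\<Union>(U, T)\<in>?I. {x. F x \<inter> U \<noteq> {}} \<inter> (W -` T \<inter> space lebesgue))" (is "?L = ?R")
  proof
    show "?L \<subseteq> ?R"
    proof
      fix x assume "x \<in> ?L"
      then obtain v where v: "v \<in> F x" "(v, W x) \<in> O1"
        unfolding set_norm_def O1_def by (auto simp: less_SUP_iff)
      obtain U T where UT: "open U" "open T" "(v, W x) \<in> U \<times> T" "U \<times> T \<subseteq> O1"
        by (rule open_prod_elim[OF O1 v(2)])
      obtain U' where U': "U' \<in> B1" "v \<in> U'" "U' \<subseteq> U" using topological_basisE[OF B1(2) UT(1)] UT(3) by auto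
      obtain T' where T': "T' \<in> B2" "W x \<in> T'" "T' \<subseteq> T" using topological_basisE[OF B2(2) UT(2)] UT(3) by auto
      have "U' \<times> T' \<subseteq> O1" using U'(3) T'(3) UT(4) by blast
      then have "(U', T') \<in> ?I" using U' T' by auto
      then show "x \<in> ?R" using U' T' v by auto
    qed
    show "?R \<subseteq> ?L"
    proof
      fix x assume "x \<in> ?R"
      then obtain U T v where "U \<times> T \<subseteq> O1" "v \<in> F x" "v \<in> U" "W x \<in> T" by auto
      then have "(v, W x) \<in> O1" "v \<in> F x" by auto
      then show "x \<in> ?L" unfolding O1_def set_norm_def by (auto simp: less_SUP_iff)
    qed
  qed
  also have "\<dots> \<in> sets lebesgue"
  proof (rule sets.countable_UN'[OF I], rule image_subsetI)
    fix z assume "z \<in> ?I"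
    then obtain U T where z: "z = (U, T)" "U \<in> B1" "T \<in> B2" by blast
    have UT: "open U" "open T" using z B1 B2 topological_basis_open by blast+
    have "{x. F x \<inter> U \<noteq> {}} \<inter> (W -` T \<inter> space lebesgue) \<in> sets lebesgue"
    proof (rule sets.Int)
      show "{x. F x \<inter> U \<noteq> {}} \<in> sets lebesgue" using F UT unfolding set_measurable_def by simp
      show "W -` T \<inter> space lebesgue \<in> sets lebesgue" by (rule measurable_sets[OF W]) (simp add: UT)
    qed
    then show "(case z of (U, T) \<Rightarrow> {x. F x \<inter> U \<noteq> {}} \<inter> (W -` T \<inter> space lebesgue)) \<in> sets lebesgue"
      unfolding z(1) prod.case .
  qed
  finally show "{x\<in>space lebesgue. t < wnorm W F x} \<in> sets lebesgue" .
qed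

lemma Kbcs_zero: assumes "K \<in> Kbcs" shows "0 \<in> K"
proof -
  obtain v where v: "v \<in> K" using assms unfolding Kbcs_def by auto
  then have "- v \<in> K" using assms unfolding Kbcs_def by blast
  then have "(1 / 2) *\<^sub>R v + (1 / 2) *\<^sub>R (- v) \<in> K"
    using v assms unfolding Kbcs_def by (intro convexD) auto
  then show ?thesis by simp
qed

lemma Kbcs_uminus: "K \<in> Kbcs \<Longrightarrow> v \<in> K \<Longrightarrow> - v \<in> K"
  unfolding Kbcs_def by blast

lemma AE_lebesgue_on: "AE x in lebesgue. P x \<Longrightarrow> S \<in> sets lebesgue \<Longrightarrow> AE x in lebesgue_on S. P x"
  by (auto simp: AE_restrict_space_iff elim: eventually_mono)

lemma avg_op_subset_maximal_op: "Q \<in> cubes \<Longrightarrow> avg_op Q F x \<subseteq> maximal_op F x"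
  unfolding maximal_op_def by (meson UN_upper closure_subset hull_subset order_trans)

lemma zero_in_maximal_op:
  fixes x :: "real^'n"
  shows "0 \<in> maximal_op F x"
proof -
  define a :: "real^'n" where "a = (\<chi> i. x $ i + 1)"
  have "x \<notin> cube a 1" unfolding mem_cube a_def by simp
  then have "0 \<in> avg_op (cube a 1) F x" unfolding avg_op_def by simp
  then show ?thesis using avg_op_subset_maximal_op[OF cube_in_cubes[of 1 a]] by auto
qed

lemma convex_maximal_op: "convex (maximal_op F x)"
  unfolding maximal_op_def by (intro convex_closure convex_convex_hull)

text \<open>Closed convex conditions on the maximal operator are thereby checked on single averages;
  symmetry and the norm bound are obtained in this way.\<close>

lemma maximal_op_minimal:
  assumes "closed C" "convex C" "\<And>Q. Q \<in> cubes \<Longrightarrow> avg_op Q F x \<subseteq> C"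
  shows "maximal_op F x \<subseteq> C"
  unfolding maximal_op_def using assms by (intro closure_minimal hull_minimal) auto

lemma maximal_op_uminus:
  assumes F: "AE y in lebesgue. F y \<in> Kbcs" and v: "v \<in> maximal_op F x"
  shows "- v \<in> maximal_op F x"
proof -
  let ?C = "uminus -` maximal_op F x"
  have "closed ?C"
    by (rule closed_vimage) (auto simp: maximal_op_def intro: continuous_intros)
  moreover have "convex ?C"
    by (rule convex_linear_vimage[OF _ convex_maximal_op]) (auto intro: linearI)
  moreover have "avg_op Q F x \<subseteq> ?C" if Q: "Q \<in> cubes" for Q
  proof
    fix u assume u: "u \<in> avg_op Q F x"
    have "- u \<in> avg_op Q F x"
    proof (cases "x \<in> Q")
      case True
      then obtain f where f: "u = (1 / vol Q) *\<^sub>R integral\<^sup>L (lebesgue_on Q) f"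
          "integrable (lebesgue_on Q) f" "AE y in lebesgue_on Q. f y \<in> F y"
        using u unfolding avg_op_def aumann_integral_def by auto
      have "AE y in lebesgue_on Q. F y \<in> Kbcs" by (rule AE_lebesgue_on[OF F cubes_props(1)[OF Q]])
      with f(3) have "AE y in lebesgue_on Q. - f y \<in> F y" by eventually_elim (rule Kbcs_uminus)
      then have "integral\<^sup>L (lebesgue_on Q) (\<lambda>y. - f y) \<in> aumann_integral Q F"
        unfolding aumann_integral_def using f(2) by blast
      then have "(1 / vol Q) *\<^sub>R integral\<^sup>L (lebesgue_on Q) (\<lambda>y. - f y) \<in> avg_op Q F x"
        unfolding avg_op_def if_P[OF True] by (rule imageI)
      then show ?thesis unfolding f(1) by simp
    qed (use u in \<open>simp add: avg_op_def\<close>)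
    then show "u \<in> ?C" using avg_op_subset_maximal_op[OF Q] by auto
  qed
  ultimately have "maximal_op F x \<subseteq> ?C" by (rule maximal_op_minimal)
  then show ?thesis using v by auto
qed

text \<open>Averages survive a slight enlargement of the cube because \<open>0 \<in> F\<close>, so hitting an open set is an open
  condition on the base point.\<close>

lemma avg_op_enlarge:
  fixes x :: "real^'n"
  assumes F: "AE y in lebesgue. F y \<in> Kbcs" and Q: "Q \<in> cubes" and v: "v \<in> avg_op Q F x" and U: "open U" "v \<in> U"
  shows "\<exists>T. open T \<and> x \<in> T \<and> (\<forall>z\<in>T. maximal_op F z \<inter> U \<noteq> {})"
proof (cases "x \<in> Q")
  case False
  then have "v = 0" using v unfolding avg_op_def by simp
  then show ?thesis using zero_in_maximal_op U by (intro exI[of _ UNIV]) auto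
next
  case True
  obtain a l where al: "Q = cube a l" "0 < l" using cubesE[OF Q] by blast
  obtain f where f: "v = (1 / vol Q) *\<^sub>R integral\<^sup>L (lebesgue_on Q) f"
      "integrable (lebesgue_on Q) f" "AE y in lebesgue_on Q. f y \<in> F y"
    using v True unfolding avg_op_def aumann_integral_def by auto
  \<comment> \<open>Extending the selection by 0 to the cube enlarged by \<open>e\<close> on each
    side multiplies the average by this factor, which tends to 1.\<close>
  have "((\<lambda>e. (l / (l + 2 * e)) ^ CARD('n) *\<^sub>R v) \<longlongrightarrow> (l / (l + 2 * 0)) ^ CARD('n) *\<^sub>R v) (at_right 0)"
    using al by (intro tendsto_intros) auto
  then have "((\<lambda>e. (l / (l + 2 * e)) ^ CARD('n) *\<^sub>R v) \<longlongrightarrow> v) (at_right 0)" using al by simp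
  then have "eventually (\<lambda>e. (l / (l + 2 * e)) ^ CARD('n) *\<^sub>R v \<in> U) (at_right 0)"
    using U by (rule topological_tendstoD)
  moreover have "eventually (\<lambda>e::real. 0 < e) (at_right 0)" by (rule eventually_at_right_less)
  ultimately have "eventually (\<lambda>e::real. 0 < e \<and> (l / (l + 2 * e)) ^ CARD('n) *\<^sub>R v \<in> U) (at_right 0)"
    by eventually_elim simp
  then obtain e where e: "0 < e" "(l / (l + 2 * e)) ^ CARD('n) *\<^sub>R v \<in> U"
    using eventually_happens[of _ "at_right (0::real)"] by (auto simp: trivial_limit_at_right_real)
  define b :: "real^'n" where "b = (\<chi> i. a $ i - e)"
  define Q' where "Q' = cube b (l + 2 * e)"
  have l': "0 < l + 2 * e" using al e by simp
  have Q': "Q' \<in> cubes" unfolding Q'_def by (rule cube_in_cubes[OF l'])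
  have QQ': "Q \<subseteq> Q'"
  proof
    fix y assume "y \<in> Q"
    then have y: "a $ i \<le> y $ i" "y $ i \<le> a $ i + l" for i unfolding al mem_cube by auto
    have "b $ i \<le> y $ i \<and> y $ i \<le> b $ i + (l + 2 * e)" for i
      using y[of i] e unfolding b_def by simp
    then show "y \<in> Q'" unfolding Q'_def mem_cube by simp
  qed
  let ?f = "\<lambda>y. if y \<in> Q then f y else 0"
  have ind: "(\<lambda>y. indicator Q' y *\<^sub>R ?f y) = (\<lambda>y. indicator Q y *\<^sub>R f y)"
    using QQ' by (auto simp: indicator_def fun_eq_iff)
  have Qs: "Q \<inter> space lebesgue \<in> sets lebesgue" "Q' \<inter> space lebesgue \<in> sets lebesgue"
    using cubes_props(1)[OF Q] cubes_props(1)[OF Q'] by auto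
  have int: "integrable (lebesgue_on Q') ?f"
    using f(2) unfolding integrable_restrict_space[OF Qs(1)] integrable_restrict_space[OF Qs(2)] ind .
  have int_eq: "integral\<^sup>L (lebesgue_on Q') ?f = integral\<^sup>L (lebesgue_on Q) f"
    unfolding integral_restrict_space[OF Qs(1)] integral_restrict_space[OF Qs(2)] ind ..
  have "AE y in lebesgue. y \<in> Q \<longrightarrow> f y \<in> F y"
    using f(3) cubes_props(1)[OF Q] by (simp add: AE_restrict_space_iff)
  with F have "AE y in lebesgue. ?f y \<in> F y" by eventually_elim (auto intro: Kbcs_zero)
  then have ae: "AE y in lebesgue_on Q'. ?f y \<in> F y" by (rule AE_lebesgue_on[OF _ cubes_props(1)[OF Q']])
  have aum: "integral\<^sup>L (lebesgue_on Q) f \<in> aumann_integral Q' F"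
    unfolding aumann_integral_def using int ae int_eq by (intro CollectI exI[of _ ?f]) simp
  have avg: "(1 / vol Q') *\<^sub>R integral\<^sup>L (lebesgue_on Q) f \<in> avg_op Q' F z" if "z \<in> Q'" for z
    unfolding avg_op_def if_P[OF that] using aum by (rule imageI)
  have eq: "(1 / vol Q') *\<^sub>R integral\<^sup>L (lebesgue_on Q) f = (l / (l + 2 * e)) ^ CARD('n) *\<^sub>R v"
    unfolding f(1) al(1) Q'_def measure_cube[OF l'] measure_cube[OF al(2)] using al(2)
    by (simp add: power_divide)
  let ?T = "box b (\<chi> i. b $ i + (l + 2 * e))"
  show ?thesis
  proof (intro exI[of _ ?T] conjI ballI)
    show "x \<in> ?T"
    proof -
      have y: "a $ i \<le> x $ i" "x $ i \<le> a $ i + l" for i using True unfolding al mem_cube by auto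
      have "b $ i < x $ i \<and> x $ i < b $ i + (l + 2 * e)" for i
        using y[of i] e unfolding b_def by simp
      then show ?thesis by (simp add: mem_box_cart)
    qed
    fix z assume "z \<in> ?T"
    then have "z \<in> Q'" unfolding Q'_def cube_def using box_subset_cbox by blast
    then have "(l / (l + 2 * e)) ^ CARD('n) *\<^sub>R v \<in> maximal_op F z"
      using avg[of z] eq avg_op_subset_maximal_op[OF Q'] by auto
    then show "maximal_op F z \<inter> U \<noteq> {}" using e(2) by blast
  qed (rule open_box)
qed

text \<open>The set in question is even open. \<open>C\<close> collects the points each of whose
  open neighbourhoods is met by \<open>maximal_op F z\<close> for all \<open>z\<close> near
  \<open>x\<close>. It is convex and contains the averages, hence their hull; and an open set that
  meets a closure meets the set itself.\<close>

lemma set_measurable_maximal_op: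
  assumes F: "AE y in lebesgue. F y \<in> Kbcs"
  shows "set_measurable (maximal_op F)"
  unfolding set_measurable_def
proof (intro allI impI)
  fix U :: "(real^'b) set" assume U: "open U"
  have "\<exists>T. open T \<and> x \<in> T \<and> T \<subseteq> {x. maximal_op F x \<inter> U \<noteq> {}}" if x: "maximal_op F x \<inter> U \<noteq> {}" for x
  proof -
    define C where "C = {c. \<forall>U. open U \<longrightarrow> c \<in> U \<longrightarrow> (\<exists>T. open T \<and> x \<in> T \<and> (\<forall>z\<in>T. maximal_op F z \<inter> U \<noteq> {}))}"
    have "convex C"
    proof (rule convexI)
      fix c1 c2 and u v :: real
      assume c: "c1 \<in> C" "c2 \<in> C" and uv: "0 \<le> u" "0 \<le> v" "u + v = 1"
      show "u *\<^sub>R c1 + v *\<^sub>R c2 \<in> C"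
        unfolding C_def
      proof (intro CollectI allI impI)
        fix U assume U: "open U" "u *\<^sub>R c1 + v *\<^sub>R c2 \<in> U"
        let ?m = "\<lambda>z. u *\<^sub>R fst z + v *\<^sub>R snd z"
        have "open (?m -` U)" using U(1) by (intro open_vimage continuous_intros)
        moreover have "(c1, c2) \<in> ?m -` U" using U(2) by simp
        ultimately obtain U1 U2 where U12: "open U1" "open U2" "(c1, c2) \<in> U1 \<times> U2" "U1 \<times> U2 \<subseteq> ?m -` U"
          by (rule open_prod_elim)
        obtain T1 where T1: "open T1" "x \<in> T1" "\<forall>z\<in>T1. maximal_op F z \<inter> U1 \<noteq> {}"
          using c(1) U12 unfolding C_def by blast
        obtain T2 where T2: "open T2" "x \<in> T2" "\<forall>z\<in>T2. maximal_op F z \<inter> U2 \<noteq> {}"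
          using c(2) U12 unfolding C_def by blast
        show "\<exists>T. open T \<and> x \<in> T \<and> (\<forall>z\<in>T. maximal_op F z \<inter> U \<noteq> {})"
        proof (intro exI[of _ "T1 \<inter> T2"] conjI ballI)
          fix z assume "z \<in> T1 \<inter> T2"
          then obtain w1 w2 where w: "w1 \<in> maximal_op F z" "w1 \<in> U1" "w2 \<in> maximal_op F z" "w2 \<in> U2"
            using T1(3) T2(3) by blast
          have "u *\<^sub>R w1 + v *\<^sub>R w2 \<in> maximal_op F z" using convexD[OF convex_maximal_op w(1,3) uv] .
          moreover have "u *\<^sub>R w1 + v *\<^sub>R w2 \<in> U" using U12(4) w by auto
          ultimately show "maximal_op F z \<inter> U \<noteq> {}" by blast
        qed (use T1 T2 in auto)
      qed
    qed
    moreover have "(\<Union>Q\<in>cubes. avg_op Q F x) \<subseteq> C"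
      unfolding C_def using avg_op_enlarge[OF F] by blast
    ultimately have hull: "convex hull (\<Union>Q\<in>cubes. avg_op Q F x) \<subseteq> C" by (intro hull_minimal)
    have "convex hull (\<Union>Q\<in>cubes. avg_op Q F x) \<inter> U \<noteq> {}"
      using x open_Int_closure_eq_empty[OF U] unfolding maximal_op_def by blast
    then obtain c where "c \<in> C" "c \<in> U" using hull by blast
    then obtain T where "open T" "x \<in> T" "\<forall>z\<in>T. maximal_op F z \<inter> U \<noteq> {}" using U unfolding C_def by blast
    then show ?thesis by blast
  qed
  then have "open {x. maximal_op F x \<inter> U \<noteq> {}}" by (subst open_subopen) blast
  then show "{x. maximal_op F x \<inter> U \<noteq> {}} \<in> sets lebesgue"
    by (simp add: sets_completionI_sets borel_open)
qed

section \<open>The maximal operator\<close>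

text \<open>Hides the constructions of the locale behind an existential, since grids of many scales
  and shifts are used at once.\<close>

lemma (in dyadic_weight) ex_majorant:
  assumes g: "g \<in> borel_measurable lebesgue" and g0: "\<And>y. 0 \<le> g y"
    and gp: "(\<integral>\<^sup>+x. ennreal (g x powr (r / (r - 1))) \<partial>lebesgue) < \<infinity>"
  shows "\<exists>u. u \<in> borel_measurable lebesgue \<and>
    (\<integral>\<^sup>+x. u x \<partial>lebesgue) \<le>
      ennreal (dyadic_const CARD('d) D r * B powr r) * (\<integral>\<^sup>+x. ennreal (g x powr (r / (r - 1))) \<partial>lebesgue) \<and>
    (\<forall>k x i t. 0 \<le> t \<longrightarrow> u x \<le> ennreal t \<longrightarrow>
      (\<integral>\<^sup>+y\<in>q k x. ennreal (norm (V y *v (W x *v axis i 1)) * g y) \<partial>lebesgue) \<le>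
        ennreal (t powr (1 / (r / (r - 1)))) * leb (q k x))"
  using U_measurable nn_integral_U_le[OF g g0] average_le_U[OF g g0 _ q_in_grid q_mem] gp
  unfolding p_def by (intro exI[of _ "U g"]) auto

lemma symmetric_inner_matrix:
  fixes A :: "real^'d^'d"
  assumes "transpose A = A"
  shows "u \<bullet> (A *v v) = (A *v u) \<bullet> v"
  using dot_lmul_matrix[of u A v] transpose_matrix_vector[of A u] assms by simp

text \<open>The i-th coordinate is the integral of the inner product of
  \<open>W x *v axis i 1\<close> with \<open>f\<close>. Inserting \<open>matrix_inv (W y)\<close>
  and \<open>W y\<close> before \<open>f y\<close> and moving the symmetric inverse to the other
  side separates the weight from \<open>g\<close>.\<close>

lemma integral_selection_bound:
  fixes W :: "real^'n \<Rightarrow> real^'d^'d"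
  assumes W: "matrix_weight W" and x: "pos_def (W x)" and Q: "Q \<in> sets lebesgue"
    and f: "integrable (lebesgue_on Q) f" "AE y in lebesgue_on Q. f y \<in> F y"
    and g: "AE y in lebesgue. \<forall>u\<in>F y. norm (W y *v u) \<le> g y"
  shows "ennreal \<bar>(W x *v integral\<^sup>L (lebesgue_on Q) f) $ i\<bar> \<le>
    (\<integral>\<^sup>+y\<in>Q. ennreal (norm (matrix_inv (reg W y) *v (reg W x *v axis i 1)) * g y) \<partial>lebesgue)"
proof -
  define w where "w = W x *v axis i 1"
  have reg: "reg W x = W x" using x unfolding reg_def by simp
  have "(W x *v v) $ i = w \<bullet> v" for v
  proof -
    have "(W x *v v) $ i = axis i 1 \<bullet> (W x *v v)" by (simp add: inner_axis')
    also have "\<dots> = w \<bullet> v" unfolding w_def using x by (intro symmetric_inner_matrix) (simp add: pos_def_def)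
    finally show ?thesis .
  qed
  then have "(W x *v integral\<^sup>L (lebesgue_on Q) f) $ i = (\<integral>y. w \<bullet> f y \<partial>lebesgue_on Q)"
    using f(1) by simp
  then have "ennreal \<bar>(W x *v integral\<^sup>L (lebesgue_on Q) f) $ i\<bar> \<le> (\<integral>\<^sup>+y. norm (w \<bullet> f y) \<partial>lebesgue_on Q)"
    using integral_norm_bound_ennreal[of "lebesgue_on Q" "\<lambda>y. w \<bullet> f y"] f(1) by simp
  also have "\<dots> \<le> (\<integral>\<^sup>+y. ennreal (norm (matrix_inv (reg W y) *v w) * g y) \<partial>lebesgue_on Q)"
  proof (rule nn_integral_mono_AE)
    have "AE y in lebesgue. pos_def (W y)" using W unfolding matrix_weight_def by auto
    with g have "AE y in lebesgue. pos_def (W y) \<and> (\<forall>u\<in>F y. norm (W y *v u) \<le> g y)" by eventually_elim simp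
    then have "AE y in lebesgue_on Q. pos_def (W y) \<and> (\<forall>u\<in>F y. norm (W y *v u) \<le> g y)"
      by (rule AE_lebesgue_on[OF _ Q])
    with f(2) show "AE y in lebesgue_on Q. ennreal (norm (w \<bullet> f y)) \<le> ennreal (norm (matrix_inv (reg W y) *v w) * g y)"
    proof eventually_elim
      case (elim y)
      have regy: "reg W y = W y" using elim unfolding reg_def by simp
      have sym: "transpose (matrix_inv (reg W y)) = matrix_inv (reg W y)"
        using transpose_matrix_inv[OF pos_def_invertible[OF pos_def_reg]] pos_def_reg unfolding pos_def_def by blast
      have "w \<bullet> f y = w \<bullet> (matrix_inv (reg W y) *v (W y *v f y))"
        using inv_reg_apply(2)[of W y "f y"] unfolding regy by simp
      also have "\<dots> = (matrix_inv (reg W y) *v w) \<bullet> (W y *v f y)" by (rule symmetric_inner_matrix[OF sym])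
      finally have "norm (w \<bullet> f y) \<le> norm (matrix_inv (reg W y) *v w) * norm (W y *v f y)"
        by (simp add: Cauchy_Schwarz_ineq2)
      also have "\<dots> \<le> norm (matrix_inv (reg W y) *v w) * g y" using elim by (intro mult_left_mono) auto
      finally show ?case by (rule ennreal_leI)
    qed
  qed
  also have "\<dots> = (\<integral>\<^sup>+y\<in>Q. ennreal (norm (matrix_inv (reg W y) *v w) * g y) \<partial>lebesgue)"
    using Q by (intro nn_integral_restrict_space) simp
  finally show ?thesis unfolding reg w_def .
qed

lemma set_norm_le_iff: "set_norm K \<le> c \<longleftrightarrow> (\<forall>v\<in>K. ennreal (norm v) \<le> c)"
  unfolding set_norm_def by (rule SUP_le_iff)

lemma set_norm_Kbcs_finite:
  fixes A :: "real^'d^'d"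
  assumes "K \<in> Kbcs" shows "set_norm ((\<lambda>v. A *v v) ` K) < top"
proof -
  obtain R where R: "\<And>v. v \<in> K \<Longrightarrow> norm v \<le> R" using assms unfolding Kbcs_def bounded_iff by auto
  let ?m = "\<Sum>i\<in>UNIV. norm (A $ i)"
  have "set_norm ((\<lambda>v. A *v v) ` K) \<le> ennreal (?m * R)"
    unfolding set_norm_le_iff
  proof safe
    fix v assume "v \<in> K"
    then have "?m * norm v \<le> ?m * R" using R by (intro mult_left_mono) (auto intro: sum_nonneg)
    then show "ennreal (norm (A *v v)) \<le> ennreal (?m * R)"
      using norm_matrix_vector_le[of A v] by (intro ennreal_leI) linarith
  qed
  then show ?thesis by (rule le_less_trans) simp
qed

lemma set_norm_maximal_op_le:
  fixes A :: "real^'d^'d"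
  assumes "0 \<le> c" and "\<And>Q v. Q \<in> cubes \<Longrightarrow> v \<in> avg_op Q F x \<Longrightarrow> norm (A *v v) \<le> c"
  shows "set_norm ((\<lambda>v. A *v v) ` maximal_op F x) \<le> ennreal c"
proof -
  let ?C = "(\<lambda>v. A *v v) -` cball 0 c"
  have "closed ?C"
    by (rule closed_vimage) (auto intro!: linear_continuous_on matrix_vector_mul_bounded_linear)
  moreover have "convex ?C" by (rule convex_linear_vimage) auto
  moreover have "avg_op Q F x \<subseteq> ?C" if "Q \<in> cubes" for Q using assms(2)[OF that] by auto
  ultimately have "maximal_op F x \<subseteq> ?C" by (rule maximal_op_minimal)
  then show ?thesis unfolding set_norm_le_iff using assms(1) by (auto intro!: ennreal_leI)
qed

text \<open>Only boundedness depends on \<open>x\<close>: it is recovered from that of the image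
  under \<open>W x\<close> by applying the inverse.\<close>

lemma maximal_op_Kbcs:
  assumes F: "AE y in lebesgue. F y \<in> Kbcs" and x: "pos_def (W x)"
    and fin: "wnorm W (maximal_op F) x < top"
  shows "maximal_op F x \<in> Kbcs"
proof -
  have "bounded (maximal_op F x)"
  proof -
    obtain c where c: "wnorm W (maximal_op F) x = ennreal c" "0 \<le> c"
      using fin by (cases "wnorm W (maximal_op F) x") auto
    let ?m = "\<Sum>i\<in>UNIV. norm (matrix_inv (reg W x) $ i)"
    have "norm v \<le> ?m * c" if v: "v \<in> maximal_op F x" for v
    proof -
      have "ennreal (norm (W x *v v)) \<le> ennreal c"
        using v c(1) set_norm_le_iff[of "(\<lambda>v. W x *v v) ` maximal_op F x" "ennreal c"] by auto
      then have le: "norm (W x *v v) \<le> c" using c(2) by (simp add: ennreal_le_iff)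
      have "v = matrix_inv (reg W x) *v (W x *v v)"
        using inv_reg_apply(2)[of W x v] x unfolding reg_def by simp
      then have "norm v \<le> ?m * norm (W x *v v)" using norm_matrix_vector_le by metis
      also have "\<dots> \<le> ?m * c" using le by (intro mult_left_mono) (auto intro: sum_nonneg)
      finally show ?thesis .
    qed
    then show ?thesis unfolding bounded_iff by blast
  qed
  moreover have "uminus ` maximal_op F x = maximal_op F x"
  proof
    show "uminus ` maximal_op F x \<subseteq> maximal_op F x" using maximal_op_uminus[OF F] by auto
    show "maximal_op F x \<subseteq> uminus ` maximal_op F x"
    proof
      fix v assume "v \<in> maximal_op F x"
      then have "- v \<in> maximal_op F x" by (rule maximal_op_uminus[OF F])
      then show "v \<in> uminus ` maximal_op F x" by (metis imageI minus_minus)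
    qed
  qed
  moreover have "closed (maximal_op F x)" unfolding maximal_op_def by simp
  ultimately show ?thesis
    unfolding Kbcs_def using zero_in_maximal_op[of F x] convex_maximal_op[of F x] by blast
qed

lemma avg_norm_le:
  fixes W :: "real^'n \<Rightarrow> real^'d^'d"
  assumes v: "v \<in> avg_op Q F x" and c: "0 \<le> c" and Q: "Q \<in> cubes"
    and bound: "\<And>f i. x \<in> Q \<Longrightarrow> integrable (lebesgue_on Q) f \<Longrightarrow> AE y in lebesgue_on Q. f y \<in> F y \<Longrightarrow>
      ennreal \<bar>(W x *v integral\<^sup>L (lebesgue_on Q) f) $ i\<bar> \<le> ennreal (c * vol Q)"
  shows "norm (W x *v v) \<le> real CARD('d) * c"
proof (cases "x \<in> Q")
  case False
  then show ?thesis using v c unfolding avg_op_def by simp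
next
  case True
  let ?m = "vol Q"
  have m: "0 < ?m" by (rule cubes_props(5)[OF Q])
  obtain f where f: "v = (1 / ?m) *\<^sub>R integral\<^sup>L (lebesgue_on Q) f"
      "integrable (lebesgue_on Q) f" "AE y in lebesgue_on Q. f y \<in> F y"
    using v True unfolding avg_op_def aumann_integral_def by auto
  have "\<bar>(W x *v v) $ i\<bar> \<le> c" for i
  proof -
    have "\<bar>(W x *v integral\<^sup>L (lebesgue_on Q) f) $ i\<bar> \<le> c * ?m"
      using bound[OF True f(2,3), of i] c m by (simp add: ennreal_le_iff)
    then show ?thesis unfolding f(1) using m by (simp add: matrix_vector_mult_scaleR abs_mult field_simps)
  qed
  then have "(\<Sum>i\<in>UNIV. \<bar>(W x *v v) $ i\<bar>) \<le> real CARD('d) * c"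
    using sum_bounded_above[of "UNIV :: 'd set" "\<lambda>i. \<bar>(W x *v v) $ i\<bar>" c] by simp
  then show ?thesis using norm_le_l1_cart[of "W x *v v"] by linarith
qed

text \<open>Bounds the p-th power of the norm. Here d counts coordinates, \<open>6 ^ n\<close>
  bounds the volume ratio of a grid cell to the cube inside it, and \<open>2 ^ n\<close> counts the
  shifts; the last factor is the part of \<open>B powr r\<close> that is free of the weight
  constant.\<close>

definition max_const :: "nat \<Rightarrow> nat \<Rightarrow> real \<Rightarrow> real" where
  "max_const n d p = (real d * 6 ^ n) powr p *
    (2 ^ n * (dyadic_const d (2 ^ n) (p / (p - 1)) * (real d powr (p - 1)) powr (p / (p - 1))))"

text \<open>Grids with top side \<open>2 ^ K\<close> capture only cubes of side up to
  \<open>2 ^ K / 3\<close>, so \<open>K\<close> has to grow. The majorants need not be monotone in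
  \<open>K\<close>, whence \<open>liminf\<close> and Fatou's lemma.\<close>

lemma nn_integral_maximal_op_le:
  fixes W :: "real^'n \<Rightarrow> real^'d^'d"
  assumes W: "matrix_weight W" and p: "1 < p" and A: "0 < A" "Ap_const (ennreal p) W \<le> ennreal A"
    and Fm: "set_measurable F" and FK: "AE y in lebesgue. F y \<in> Kbcs"
    and fin: "(\<integral>\<^sup>+x. ennpowr (wnorm W F x) p \<partial>lebesgue) < \<infinity>"
  shows "(\<integral>\<^sup>+x. ennpowr (wnorm W (maximal_op F) x) p \<partial>lebesgue) \<le>
    ennreal (max_const CARD('n) CARD('d) p * A powr (p * (p / (p - 1)))) *
      (\<integral>\<^sup>+x. ennpowr (wnorm W F x) p \<partial>lebesgue)"
proof -
  define r where "r = p / (p - 1)"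
  have r: "1 < r" unfolding r_def using p by (simp add: field_simps)
  have rp: "r / (r - 1) = p" unfolding r_def using p by (simp add: field_simps)
  let ?n = "CARD('n)" and ?d = "real CARD('d)"
  let ?V = "\<lambda>x. matrix_inv (reg W x)"
  define B where "B = ?d powr (p - 1) * A powr p"
  define c where "c = dyadic_const CARD('d) (2 ^ ?n) r * B powr r"
  define g where "g y = enn2real (wnorm W F y)" for y
  have Wm: "W \<in> borel_measurable lebesgue" and pd: "AE x in lebesgue. pos_def (W x)"
    using W unfolding matrix_weight_def by auto
  have g [measurable]: "g \<in> borel_measurable lebesgue"
    unfolding g_def using set_norm_measurable[OF Fm Wm] by measurable
  have g0: "0 \<le> g y" for y unfolding g_def by simp
  have gF: "AE y in lebesgue. wnorm W F y = ennreal (g y)"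
    using FK
  proof eventually_elim
    case (elim y)
    then show ?case unfolding g_def using set_norm_Kbcs_finite[of "F y" "W y"] by simp
  qed
  have gF': "AE y in lebesgue. \<forall>u\<in>F y. norm (W y *v u) \<le> g y"
    using gF
  proof eventually_elim
    case (elim y)
    then have "\<forall>v\<in>(\<lambda>v. W y *v v) ` F y. ennreal (norm v) \<le> ennreal (g y)"
      using set_norm_le_iff[of "(\<lambda>v. W y *v v) ` F y" "ennreal (g y)"] by simp
    then show ?case using g0 by (auto simp: ennreal_le_iff)
  qed
  have Geq: "(\<integral>\<^sup>+x. ennpowr (wnorm W F x) p \<partial>lebesgue) = (\<integral>\<^sup>+x. ennreal (g x powr p) \<partial>lebesgue)"
    using gF by (intro nn_integral_cong_AE) (auto elim!: eventually_mono simp: ennpowr_ennreal g0)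
  define G where "G = (\<integral>\<^sup>+x. ennreal (g x powr p) \<partial>lebesgue)"
  have Gfin: "G < \<infinity>" using fin unfolding Geq G_def .
  let ?q = "\<lambda>z::nat \<times> 'n set. dyq (shift_vec (2 ^ fst z) (snd z)) (2 ^ fst z)"
  define maj where "maj z u \<longleftrightarrow> u \<in> borel_measurable lebesgue \<and> (\<integral>\<^sup>+x. u x \<partial>lebesgue) \<le> ennreal c * G \<and>
    (\<forall>k x i t. 0 \<le> t \<longrightarrow> u x \<le> ennreal t \<longrightarrow>
      (\<integral>\<^sup>+y\<in>?q z k x. ennreal (norm (?V y *v (reg W x *v axis i 1)) * g y) \<partial>lebesgue) \<le>
        ennreal (t powr (1 / p)) * leb (?q z k x))" for z u
  have "\<forall>z. \<exists>u. maj z u"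
  proof
    fix z :: "nat \<times> 'n set"
    interpret dyadic_weight "?q z" "2 ^ ?n" "reg W" ?V r B
      unfolding r_def B_def by (rule dyadic_weight_Ap[OF W p A]) simp
    show "\<exists>u. maj z u"
      using ex_majorant[OF g g0, unfolded rp] Gfin unfolding maj_def c_def G_def by simp
  qed
  from choice[OF this] obtain u where u: "\<And>z. maj z (u z)" by blast
  have um: "\<And>z. u z \<in> borel_measurable lebesgue"
    and uint: "\<And>z. (\<integral>\<^sup>+x. u z x \<partial>lebesgue) \<le> ennreal c * G"
    and ubound: "\<And>z k x i t. 0 \<le> t \<Longrightarrow> u z x \<le> ennreal t \<Longrightarrow>
      (\<integral>\<^sup>+y\<in>?q z k x. ennreal (norm (?V y *v (reg W x *v axis i 1)) * g y) \<partial>lebesgue) \<le>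
        ennreal (t powr (1 / p)) * leb (?q z k x)"
    using u unfolding maj_def by blast+
  note [measurable] = um
  define T where "T K x = (\<Sum>S\<in>UNIV. u (K, S) x)" for K x
  have Tm [measurable]: "T K \<in> borel_measurable lebesgue" for K unfolding T_def by measurable
  define L where "L x = liminf (\<lambda>K. T K x)" for x
  have Lm [measurable]: "L \<in> borel_measurable lebesgue" unfolding L_def by measurable
  have Lint: "(\<integral>\<^sup>+x. L x \<partial>lebesgue) \<le> ennreal (2 ^ ?n) * (ennreal c * G)"
  proof -
    have TK: "(\<integral>\<^sup>+x. T K x \<partial>lebesgue) \<le> ennreal (2 ^ ?n) * (ennreal c * G)" for K
    proof -
      have "(\<integral>\<^sup>+x. T K x \<partial>lebesgue) = (\<Sum>S\<in>UNIV. \<integral>\<^sup>+x. u (K, S) x \<partial>lebesgue)"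
        unfolding T_def by (rule nn_integral_sum) measurable
      also have "\<dots> \<le> (\<Sum>S\<in>(UNIV :: 'n set set). ennreal c * G)" by (intro sum_mono uint)
      also have "\<dots> = of_nat (card (UNIV :: 'n set set)) * (ennreal c * G)" by simp
      also have "card (UNIV :: 'n set set) = 2 ^ ?n" using card_Pow[of "UNIV :: 'n set"] by simp
      also have "of_nat (2 ^ ?n) = ennreal (2 ^ ?n)" by (simp add: ennreal_of_nat_eq_real_of_nat)
      finally show ?thesis .
    qed
    have "(\<integral>\<^sup>+x. L x \<partial>lebesgue) \<le> liminf (\<lambda>K. \<integral>\<^sup>+x. T K x \<partial>lebesgue)"
      unfolding L_def by (rule nn_integral_liminf) measurable
    also have "\<dots> \<le> ennreal (2 ^ ?n) * (ennreal c * G)"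
      unfolding liminf_SUP_INF using TK by (intro SUP_least) (auto intro: INF_lower2)
    finally show ?thesis .
  qed
  let ?c6 = "(?d * 6 ^ ?n) powr p"
  have c6: "0 < ?c6" by simp
  have avg: "norm (W x *v v) powr p \<le> ?c6 * t"
    if x: "pos_def (W x)" and Q: "Q \<in> cubes" and v: "v \<in> avg_op Q F x" and t: "0 \<le> t" "L x < ennreal t" for x Q v t
  proof -
    obtain a l where al: "Q = cube a l" "0 < l" using cubesE[OF Q] by blast
    obtain K0 :: nat where "3 * l < 2 ^ K0" using real_arch_pow[of 2 "3 * l"] by auto
    \<comment> \<open>A strict bound on the \<open>liminf\<close> yields arbitrarily large
      \<open>K\<close> with \<open>T K x < ennreal t\<close>, in particular one whose grids capture
      \<open>Q\<close>.\<close>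
    have "(INF K\<in>{K0..}. T K x) \<le> L x" unfolding L_def liminf_SUP_INF by (rule SUP_upper) simp
    then have "(INF K\<in>{K0..}. T K x) < ennreal t" using t(2) by (rule le_less_trans)
    then obtain K where K: "K0 \<le> K" "T K x < ennreal t" by (auto simp: INF_less_iff)
    have "(2::real) ^ K0 \<le> 2 ^ K" using K(1) by (intro power_increasing) auto
    then have h: "3 * l \<le> 2 ^ K" using \<open>3 * l < 2 ^ K0\<close> by linarith
    obtain S k where Sk: "\<And>x. x \<in> cube a l \<Longrightarrow> cube a l \<subseteq> dyq (shift_vec (2 ^ K) S) (2 ^ K) k x" "2 ^ K / 2 ^ k \<le> 6 * l"
      using cube_in_shifted_grid[OF al(2) h] by blast
    have "u (K, S) x \<le> T K x" unfolding T_def by (rule member_le_sum) auto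
    then have u: "u (K, S) x \<le> ennreal t" using K(2) by (meson less_imp_le order_trans)
    have "norm (W x *v v) \<le> ?d * (6 ^ ?n * t powr (1 / p))"
    proof (rule avg_norm_le[OF v _ Q])
      fix f i assume xQ: "x \<in> Q" and f: "integrable (lebesgue_on Q) f" "AE y in lebesgue_on Q. f y \<in> F y"
      let ?P = "dyq (shift_vec (2 ^ K) S) (2 ^ K) k x"
      have "ennreal \<bar>(W x *v integral\<^sup>L (lebesgue_on Q) f) $ i\<bar> \<le>
          (\<integral>\<^sup>+y\<in>Q. ennreal (norm (?V y *v (reg W x *v axis i 1)) * g y) \<partial>lebesgue)"
        by (rule integral_selection_bound[OF W x cubes_props(1)[OF Q] f gF'])
      also have "\<dots> \<le> (\<integral>\<^sup>+y\<in>?P. ennreal (norm (?V y *v (reg W x *v axis i 1)) * g y) \<partial>lebesgue)"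
        using Sk(1)[of x] xQ unfolding al(1) by (intro nn_set_integral_set_mono)
      also have "\<dots> \<le> ennreal (t powr (1 / p)) * leb ?P"
        using ubound[OF t(1) u, where k=k and i=i] by simp
      also have "\<dots> = ennreal (t powr (1 / p) * (2 ^ K / 2 ^ k) ^ ?n)"
        using dyq_cube(1,2)[of "2 ^ K" "shift_vec (2 ^ K) S" k x]
        by (simp add: emeasure_eq_measure2 ennreal_mult)
      also have "\<dots> \<le> ennreal (t powr (1 / p) * (6 * l) ^ ?n)"
        using Sk(2) by (intro ennreal_leI mult_left_mono power_mono) auto
      also have "\<dots> = ennreal (6 ^ ?n * t powr (1 / p) * vol Q)"
        unfolding al(1) measure_cube[OF al(2)] by (simp add: power_mult_distrib mult_ac)
      finally show "ennreal \<bar>(W x *v integral\<^sup>L (lebesgue_on Q) f) $ i\<bar> \<le> ennreal (6 ^ ?n * t powr (1 / p) * vol Q)" .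
    qed simp
    then have "norm (W x *v v) powr p \<le> (?d * (6 ^ ?n * t powr (1 / p))) powr p" using p by (intro powr_mono2) auto
    also have "\<dots> = ?c6 * t" using p t(1) by (simp add: powr_mult powr_powr)
    finally show ?thesis .
  qed
  have "AE x in lebesgue. ennpowr (wnorm W (maximal_op F) x) p \<le> ennreal ?c6 * L x"
    using pd
  proof eventually_elim
    case (elim x)
    show ?case
    proof (cases "L x")
      case top
      then show ?thesis using c6 by (simp add: ennreal_mult_top)
    next
      case (real s)
      have "norm (W x *v v) \<le> (?c6 * s) powr (1 / p)" if Q: "Q \<in> cubes" and v: "v \<in> avg_op Q F x" for Q v
      proof -
        have "norm (W x *v v) powr p / ?c6 \<le> s"
        \<comment> \<open>\<open>avg\<close> requires the strict inequality
          \<open>L x < ennreal t\<close>, so the value of \<open>L x\<close> is approached from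
          above.\<close>
        proof (rule dense_ge)
          fix t assume "s < t"
          then have "norm (W x *v v) powr p \<le> ?c6 * t"
            using real by (intro avg[OF elim Q v]) (auto simp: ennreal_less_iff)
          then show "norm (W x *v v) powr p / ?c6 \<le> t" using c6 by (simp add: divide_le_eq mult.commute)
        qed
        then have "norm (W x *v v) powr p \<le> ?c6 * s" using c6 by (simp add: divide_le_eq mult.commute)
        then have "(norm (W x *v v) powr p) powr (1 / p) \<le> (?c6 * s) powr (1 / p)" using p by (intro powr_mono2) auto
        then show ?thesis using p by (simp add: powr_powr)
      qed
      then have "wnorm W (maximal_op F) x \<le> ennreal ((?c6 * s) powr (1 / p))"
        by (intro set_norm_maximal_op_le) auto
      then have "ennpowr (wnorm W (maximal_op F) x) p \<le> ennpowr (ennreal ((?c6 * s) powr (1 / p))) p"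
        using p by (intro ennpowr_mono) auto
      also have "\<dots> = ennreal (?c6 * s)" using p real c6 by (simp add: ennpowr_ennreal powr_powr)
      also have "\<dots> = ennreal ?c6 * L x" using real by (simp add: ennreal_mult)
      finally show ?thesis .
    qed
  qed
  then have "(\<integral>\<^sup>+x. ennpowr (wnorm W (maximal_op F) x) p \<partial>lebesgue) \<le> (\<integral>\<^sup>+x. ennreal ?c6 * L x \<partial>lebesgue)"
    by (rule nn_integral_mono_AE)
  also have "\<dots> = ennreal ?c6 * (\<integral>\<^sup>+x. L x \<partial>lebesgue)" by (rule nn_integral_cmult) measurable
  also have "\<dots> \<le> ennreal ?c6 * (ennreal (2 ^ ?n) * (ennreal c * G))" by (intro mult_left_mono Lint) simp
  also have "\<dots> = ennreal (?c6 * (2 ^ ?n * c)) * G"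
    by (simp add: ennreal_mult'[symmetric] mult.assoc[symmetric])
  also have "?c6 * (2 ^ ?n * c) = max_const ?n CARD('d) p * A powr (p * r)"
    unfolding max_const_def c_def B_def r_def[symmetric] powr_mult powr_powr[of A] by (simp only: mult_ac)
  finally show ?thesis unfolding Geq G_def[symmetric] r_def .
qed

lemma max_const_pos:
  assumes "1 < p" "0 < d"
  shows "0 < max_const n d p"
proof -
  have r: "1 < p / (p - 1)" using assms by (simp add: field_simps)
  have "(1::real) < 2 * 2 ^ n" using one_le_power[of "2::real" n] by linarith
  then have "0 < ln (2 * 2 ^ n :: real)" by (rule ln_gt_zero)
  then have "0 < dyadic_const d (2 ^ n) (p / (p - 1))"
    unfolding dyadic_const_def using assms r by (intro mult_pos_pos divide_pos_pos) auto
  then show ?thesis unfolding max_const_def using assms by (intro mult_pos_pos) auto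
qed

text \<open>For \<open>p = \<infinity>\<close> the weight constant controls each cube off a null set; cubes with rational data make the
  union of these null sets negligible.\<close>

lemma AE_set_norm_maximal_op_le:
  fixes W :: "real^'n \<Rightarrow> real^'d^'d"
  assumes W: "matrix_weight W" and A: "Ap_const \<infinity> W \<le> ennreal A" "0 \<le> A"
    and FK: "AE y in lebesgue. F y \<in> Kbcs"
    and G: "AE y in lebesgue. wnorm W F y \<le> ennreal G" "0 \<le> G"
  shows "AE x in lebesgue. wnorm W (maximal_op F) x \<le> ennreal (real CARD('d) * 2 ^ CARD('n) * A * G)"
proof -
  let ?n = "CARD('n)" and ?V = "\<lambda>x. matrix_inv (reg W x)"
  define R :: "('n \<Rightarrow> rat) \<times> rat \<Rightarrow> (real^'n) set" where
    "R z = cube (\<chi> i. of_rat (fst z i)) (of_rat (snd z))" for z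
  have GF: "AE y in lebesgue. \<forall>u\<in>F y. norm (W y *v u) \<le> G"
    using G(1)
  proof eventually_elim
    case (elim y)
    then have "\<forall>v\<in>(\<lambda>v. W y *v v) ` F y. ennreal (norm v) \<le> ennreal G"
      using set_norm_le_iff[of "(\<lambda>v. W y *v v) ` F y" "ennreal G"] by simp
    then show ?case using G(2) by (auto simp: ennreal_le_iff)
  qed
  have "AE x in lebesgue. \<forall>z. 0 < snd z \<longrightarrow> x \<in> R z \<longrightarrow> inner_avg W 1 (R z) x \<le> ennreal A"
    unfolding AE_all_countable
  proof
    fix z :: "('n \<Rightarrow> rat) \<times> rat"
    show "AE x in lebesgue. 0 < snd z \<longrightarrow> x \<in> R z \<longrightarrow> inner_avg W 1 (R z) x \<le> ennreal A"
    proof (cases "0 < snd z")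
      case True
      then have Rz: "R z \<in> cubes" unfolding R_def by (intro cube_in_cubes) simp
      let ?f = "\<lambda>x. navg (R z) (\<lambda>y. op_norm (W x ** matrix_inv (W y)))"
      have "esssup (lebesgue_on (R z)) ?f \<le> Ap_const \<infinity> W"
        unfolding Ap_const_def using Rz by (auto intro!: SUP_upper2[of "R z"])
      then have "esssup (lebesgue_on (R z)) ?f \<le> ennreal A" using A(1) by (rule order_trans)
      then have "AE x in lebesgue_on (R z). ?f x \<le> ennreal A"
        using esssup_AE[of ?f "lebesgue_on (R z)"] by (auto elim!: eventually_mono)
      then show ?thesis
        using cubes_props(1)[OF Rz] unfolding inner_avg_def ennpowr_one
        by (auto simp: AE_restrict_space_iff elim!: eventually_mono)
    qed simp
  qed
  moreover have "AE x in lebesgue. pos_def (W x)" using W unfolding matrix_weight_def by auto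
  ultimately show ?thesis
  proof eventually_elim
    case (elim x)
    have "norm (W x *v v) \<le> real CARD('d) * (2 ^ ?n * A * G)" if Q: "Q \<in> cubes" and v: "v \<in> avg_op Q F x" for Q v
    proof (rule avg_norm_le[OF v _ Q])
      fix f i assume xQ: "x \<in> Q" and f: "integrable (lebesgue_on Q) f" "AE y in lebesgue_on Q. f y \<in> F y"
      obtain a l where al: "Q = cube a l" "0 < l" using cubesE[OF Q] by blast
      \<comment> \<open>A rational corner at most \<open>l / 4\<close> below \<open>a\<close> in
        each coordinate and a rational side between \<open>5 / 4 * l\<close> and
        \<open>2 * l\<close> give a cube that contains \<open>Q\<close> and has at most 2 ^ n times
        its volume.\<close>
      have "\<forall>j. \<exists>b. a $ j - l / 4 < of_rat b \<and> of_rat b < a $ j" using al(2) by (intro allI of_rat_dense) simp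
      from choice[OF this] obtain b where b: "\<And>j. a $ j - l / 4 < of_rat (b j)" "\<And>j. of_rat (b j) < a $ j" by blast
      obtain m where m: "5 / 4 * l < of_rat m" "of_rat m < 2 * l"
        using of_rat_dense[of "5 / 4 * l" "2 * l"] al(2) by auto
      have mpos: "0 < (of_rat m :: real)" using m al(2) by linarith
      then have m0: "0 < m" by simp
      let ?R = "R (b, m)"
      have QR: "Q \<subseteq> ?R"
      proof
        fix y assume "y \<in> Q"
        then have y: "a $ j \<le> y $ j" "y $ j \<le> a $ j + l" for j unfolding al mem_cube by auto
        have "of_rat (b j) \<le> y $ j \<and> y $ j \<le> of_rat (b j) + of_rat m" for j
          using y[of j] b[of j] m al(2) by linarith
        then show "y \<in> ?R" unfolding R_def mem_cube by simp
      qed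
      have Rc: "?R \<in> cubes" unfolding R_def using mpos by (intro cube_in_cubes) simp
      note [measurable] = cubes_props(1)[OF Rc]
      have le_A: "inner_avg W 1 ?R x \<le> ennreal A"
        using elim(1) m0 xQ QR by (metis snd_conv subsetD)
      have "ennreal \<bar>(W x *v integral\<^sup>L (lebesgue_on Q) f) $ i\<bar> \<le>
          (\<integral>\<^sup>+y\<in>Q. ennreal (norm (?V y *v (reg W x *v axis i 1)) * G) \<partial>lebesgue)"
        by (rule integral_selection_bound[OF W elim(2) cubes_props(1)[OF Q] f GF])
      also have "\<dots> \<le> (\<integral>\<^sup>+y\<in>?R. ennreal (norm (?V y *v (reg W x *v axis i 1)) * G) \<partial>lebesgue)"
        by (rule nn_set_integral_set_mono[OF QR])
      also have "\<dots> \<le> ennreal (A * G * of_rat m ^ ?n)"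
      proof (cases "G = 0")
        case False
        have "(\<integral>\<^sup>+y\<in>?R. ennreal (norm (?V y *v (reg W x *v axis i 1)) * G) \<partial>lebesgue) =
            (\<integral>\<^sup>+y. ennreal G * (ennreal (norm (?V y *v (reg W x *v axis i 1)) powr 1) * indicator ?R y) \<partial>lebesgue)"
          using G(2) by (intro nn_integral_cong) (simp add: ennreal_mult mult_ac)
        also have "\<dots> \<le> ennreal G * (\<integral>\<^sup>+y\<in>?R. ennreal (norm (?V y *v (reg W x *v axis i 1)) powr 1) \<partial>lebesgue)"
          using G(2) False by (intro nn_integral_cmult_le) simp
        also have "\<dots> \<le> ennreal G * (ennreal (norm (axis i 1 :: real^'d) powr 1) * (inner_avg W 1 ?R x * leb ?R))"
          by (intro mult_left_mono nn_integral_inv_le_inner_avg[OF W elim(2) Rc]) auto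
        also have "\<dots> \<le> ennreal G * (1 * (ennreal A * leb ?R))"
          by (intro mult_left_mono mult_mono le_A) auto
        also have "\<dots> = ennreal (A * G * of_rat m ^ ?n)"
          unfolding R_def snd_conv emeasure_cube[OF mpos] using A(2) G(2) mpos
          by (simp add: ennreal_mult[symmetric] mult_ac)
        finally show ?thesis .
      qed simp
      also have "\<dots> \<le> ennreal (2 ^ ?n * A * G * vol Q)"
      proof (rule ennreal_leI)
        have "of_rat m ^ ?n \<le> (2 * l) ^ ?n" using m mpos by (intro power_mono) auto
        then have "A * G * of_rat m ^ ?n \<le> A * G * (2 * l) ^ ?n" using A(2) G(2) by (intro mult_left_mono) auto
        then show "A * G * of_rat m ^ ?n \<le> 2 ^ ?n * A * G * vol Q"
          unfolding al(1) measure_cube[OF al(2)] by (simp add: power_mult_distrib mult_ac)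
      qed
      finally show "ennreal \<bar>(W x *v integral\<^sup>L (lebesgue_on Q) f) $ i\<bar> \<le> ennreal (2 ^ ?n * A * G * vol Q)" .
    qed (use A(2) G(2) in simp)
    then have "wnorm W (maximal_op F) x \<le> ennreal (real CARD('d) * (2 ^ ?n * A * G))"
      using A(2) G(2) by (intro set_norm_maximal_op_le) auto
    then show ?case by (simp add: mult.assoc)
  qed
qed

lemma LpK_maximal_op:
  assumes W: "matrix_weight W" and F: "F \<in> LpK p W"
    and fin: "LpK_norm p W (maximal_op F) < \<infinity>"
    and ae: "AE x in lebesgue. wnorm W (maximal_op F) x < top"
  shows "maximal_op F \<in> LpK p W"
proof -
  have FK: "AE y in lebesgue. F y \<in> Kbcs" using F unfolding LpK_def by simp
  have "AE x in lebesgue. pos_def (W x)" using W unfolding matrix_weight_def by simp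
  with ae have "AE x in lebesgue. maximal_op F x \<in> Kbcs"
    by eventually_elim (rule maximal_op_Kbcs[OF FK])
  then show ?thesis unfolding LpK_def using set_measurable_maximal_op[OF FK] fin by simp
qed

theorem maximal_op_bounded_infinity:
  fixes W :: "real^'n \<Rightarrow> real^'d^'d"
  assumes Ap: "Ap_weight \<infinity> W" and F: "F \<in> LpK \<infinity> W"
  shows "maximal_op F \<in> LpK \<infinity> W"
    "LpK_norm \<infinity> W (maximal_op F) \<le> ennreal (real CARD('d) * 2 ^ CARD('n)) * Ap_const \<infinity> W * LpK_norm \<infinity> W F"
proof -
  have W: "matrix_weight W" and Wm: "W \<in> borel_measurable lebesgue" and Afin: "Ap_const \<infinity> W < \<infinity>"
    using Ap unfolding Ap_weight_def matrix_weight_def by auto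
  have FK: "AE y in lebesgue. F y \<in> Kbcs" and Ffin: "LpK_norm \<infinity> W F < \<infinity>"
    using F unfolding LpK_def by auto
  obtain A where A: "Ap_const \<infinity> W = ennreal A" "0 \<le> A" using Afin by (cases "Ap_const \<infinity> W") auto
  obtain G where G: "LpK_norm \<infinity> W F = ennreal G" "0 \<le> G" using Ffin by (cases "LpK_norm \<infinity> W F") auto
  have "AE y in lebesgue. wnorm W F y \<le> ennreal G"
    using esssup_AE[of "\<lambda>y. wnorm W F y" lebesgue] G(1) unfolding LpK_norm_def by simp
  then have ae: "AE x in lebesgue. wnorm W (maximal_op F) x \<le> ennreal (real CARD('d) * 2 ^ CARD('n) * A * G)"
    using A by (intro AE_set_norm_maximal_op_le[OF W _ _ FK _ G(2)]) auto
  have "LpK_norm \<infinity> W (maximal_op F) \<le> ennreal (real CARD('d) * 2 ^ CARD('n) * A * G)"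
    unfolding LpK_norm_def using ae set_norm_measurable[OF set_measurable_maximal_op[OF FK] Wm] by auto
  also have "\<dots> = ennreal (real CARD('d) * 2 ^ CARD('n)) * Ap_const \<infinity> W * LpK_norm \<infinity> W F"
    unfolding A(1) G(1) using A(2) G(2) by (simp add: ennreal_mult)
  finally show le: "LpK_norm \<infinity> W (maximal_op F) \<le> ennreal (real CARD('d) * 2 ^ CARD('n)) * Ap_const \<infinity> W * LpK_norm \<infinity> W F" .
  have "LpK_norm \<infinity> W (maximal_op F) < \<infinity>"
    using le unfolding A(1) G(1) by (rule le_less_trans) (simp add: ennreal_mult_less_top)
  moreover have "AE x in lebesgue. wnorm W (maximal_op F) x < top"
    using ae by eventually_elim (auto intro: le_less_trans)
  ultimately show "maximal_op F \<in> LpK \<infinity> W" by (rule LpK_maximal_op[OF W F])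
qed

theorem maximal_op_bounded_finite:
  fixes W :: "real^'n \<Rightarrow> real^'d^'d"
  assumes p: "1 < p" and Ap: "Ap_weight (ennreal p) W" and F: "F \<in> LpK (ennreal p) W"
  shows "maximal_op F \<in> LpK (ennreal p) W"
    "LpK_norm (ennreal p) W (maximal_op F) \<le> ennreal (max_const CARD('n) CARD('d) p powr (1 / p)) *
      ennpowr (Ap_const (ennreal p) W) (conj_exp (ennreal p)) * LpK_norm (ennreal p) W F"
proof -
  define r where "r = p / (p - 1)"
  have r: "0 < r" unfolding r_def using p by simp
  have conj: "conj_exp (ennreal p) = r" unfolding conj_exp_def r_def using p by simp
  let ?K = "max_const CARD('n) CARD('d) p"
  have K: "0 < ?K" using p by (intro max_const_pos) auto
  let ?I = "\<lambda>H. \<integral>\<^sup>+x. ennpowr (wnorm W H x) p \<partial>lebesgue"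
  have norm: "LpK_norm (ennreal p) W H = ennpowr (?I H) (1 / p)" for H
    unfolding LpK_norm_def using p by simp
  have W: "matrix_weight W" and Wm: "W \<in> borel_measurable lebesgue" and Afin: "Ap_const (ennreal p) W < \<infinity>"
    using Ap unfolding Ap_weight_def matrix_weight_def by auto
  have FK: "AE y in lebesgue. F y \<in> Kbcs" and Ffin: "LpK_norm (ennreal p) W F < \<infinity>" and Fm: "set_measurable F"
    using F unfolding LpK_def by auto
  have IF: "?I F < \<infinity>"
  proof (rule ccontr)
    assume "\<not> ?I F < \<infinity>"
    then have "?I F = top" by (simp only: less_top[symmetric] infinity_ennreal_def not_not)
    then show False using Ffin unfolding norm by (simp add: ennpowr_top)
  qed
  have int_le: "?I (maximal_op F) \<le> ennreal (?K * A powr (p * r)) * ?I F"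
    if "0 < A" "Ap_const (ennreal p) W \<le> ennreal A" for A
    unfolding r_def by (rule nn_integral_maximal_op_le[OF W p that Fm FK IF])
  have norm_le: "LpK_norm (ennreal p) W (maximal_op F) \<le> ennreal (?K powr (1 / p) * A powr r) * LpK_norm (ennreal p) W F"
    if A: "0 < A" "Ap_const (ennreal p) W \<le> ennreal A" for A
  proof -
    have "ennpowr (?I (maximal_op F)) (1 / p) \<le> ennpowr (ennreal (?K * A powr (p * r)) * ?I F) (1 / p)"
      using p int_le[OF A] by (intro ennpowr_mono) auto
    also have "\<dots> = ennreal ((?K * A powr (p * r)) powr (1 / p)) * ennpowr (?I F) (1 / p)"
      using K A by (intro ennpowr_mult_ennreal) simp
    also have "(?K * A powr (p * r)) powr (1 / p) = ?K powr (1 / p) * A powr r"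
      unfolding powr_mult powr_powr using p by simp
    finally show ?thesis unfolding norm .
  qed
  obtain a where a: "Ap_const (ennreal p) W = ennreal a" "0 \<le> a" using Afin by (cases "Ap_const (ennreal p) W") auto
  obtain G where G: "LpK_norm (ennreal p) W F = ennreal G" "0 \<le> G" using Ffin by (cases "LpK_norm (ennreal p) W F") auto
  show le: "LpK_norm (ennreal p) W (maximal_op F) \<le> ennreal (?K powr (1 / p)) *
      ennpowr (Ap_const (ennreal p) W) (conj_exp (ennreal p)) * LpK_norm (ennreal p) W F"
  proof (cases "a = 0")
    case False
    then show ?thesis
      using norm_le[of a] a unfolding conj by (simp add: ennpowr_ennreal ennreal_mult)
  next
    \<comment> \<open>The dyadic estimate requires a positive bound on the weight constant; for
      \<open>a = 0\<close> it is applied with arbitrarily small \<open>A\<close>, and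
      \<open>y\<close> is chosen so that the result is at most \<open>e\<close>.\<close>
    case True
    let ?c = "?K powr (1 / p)"
    have c: "0 < ?c" using K by simp
    have eps: "LpK_norm (ennreal p) W (maximal_op F) \<le> 0 + ennreal e" if e: "0 < e" for e
    proof -
      define y where "y = e / (?c * (G + 1))"
      have y: "0 < y" unfolding y_def using e c G(2) by (intro divide_pos_pos mult_pos_pos) auto
      define A where "A = y powr (1 / r)"
      have "0 < A" unfolding A_def using y by simp
      then have "LpK_norm (ennreal p) W (maximal_op F) \<le> ennreal (?c * A powr r) * ennreal G"
        using norm_le[of A] a True G(1) by simp
      also have "\<dots> = ennreal (?c * A powr r * G)" using G(2) by (simp add: ennreal_mult)
      also have "?c * A powr r * G = ?c * y * G" unfolding A_def using y r by (simp add: powr_powr)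
      also have "?c * y * G = e * (G / (G + 1))" unfolding y_def using c by simp
      also have "ennreal (e * (G / (G + 1))) \<le> ennreal e"
        using e G(2) by (intro ennreal_leI) (simp add: divide_le_eq)
      finally show ?thesis by simp
    qed
    have "LpK_norm (ennreal p) W (maximal_op F) \<le> 0" by (rule ennreal_le_epsilon) (rule eps)
    then show ?thesis by simp
  qed
  have "AE x in lebesgue. ennpowr (wnorm W (maximal_op F) x) p \<noteq> \<infinity>"
  proof (rule nn_integral_PInf_AE)
    show "(\<lambda>x. ennpowr (wnorm W (maximal_op F) x) p) \<in> borel_measurable lebesgue"
      using set_norm_measurable[OF set_measurable_maximal_op[OF FK] Wm] by measurable
    have "?I (maximal_op F) \<le> ennreal (?K * (a + 1) powr (p * r)) * ?I F"
      using a by (intro int_le) (auto intro: ennreal_leI)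
    also have "\<dots> < \<infinity>" using IF by (simp add: ennreal_mult_less_top)
    finally show "?I (maximal_op F) \<noteq> \<infinity>" by simp
  qed
  then have "AE x in lebesgue. wnorm W (maximal_op F) x < top"
  proof eventually_elim
    case (elim x)
    show ?case
    proof (rule ccontr)
      assume "\<not> wnorm W (maximal_op F) x < top"
      then have "wnorm W (maximal_op F) x = top" by (simp only: less_top[symmetric] not_not)
      then show False using elim by (simp add: ennpowr_top)
    qed
  qed
  moreover have "LpK_norm (ennreal p) W (maximal_op F) < \<infinity>"
    using le unfolding a(1) G(1) by (rule le_less_trans) (simp add: ennreal_mult_less_top ennpowr_ennreal a(2))
  ultimately show "maximal_op F \<in> LpK (ennreal p) W" by (intro LpK_maximal_op[OF W F])
qed

theorem theorem6p9:
  fixes p :: ennreal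
  assumes "1 < p"
  shows "\<exists>C::real. C > 0 \<and>
    (\<forall>W :: real^'n \<Rightarrow> real^'d^'d. Ap_weight p W \<longrightarrow>
      maximal_op \<in> LpK p W \<rightarrow> LpK p W \<and>
      (\<forall>F\<in>LpK p W.
        LpK_norm p W (maximal_op F)
          \<le> ennreal C * ennpowr (Ap_const p W) (conj_exp p) * LpK_norm p W F))"
proof (cases p)
  case top
  \<comment> \<open>At infinite p the conjugate exponent is 1, so the weight constant enters
    linearly.\<close>
  have "ennpowr c (conj_exp \<infinity>) = c" for c unfolding conj_exp_def by (simp add: ennpowr_one)
  then show ?thesis
    unfolding top infinity_ennreal_def[symmetric]
    using maximal_op_bounded_infinity
    by (intro exI[of _ "real CARD('d) * 2 ^ CARD('n)"]) auto
next
  case (real a)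
  then have a: "1 < a" using assms by (simp flip: ennreal_1 add: ennreal_less_iff)
  have "0 < max_const CARD('n) CARD('d) a powr (1 / a)" using max_const_pos[OF a, of "CARD('d)" "CARD('n)"] by simp
  then show ?thesis
    unfolding real(2) using maximal_op_bounded_finite[OF a]
    by (intro exI[of _ "max_const CARD('n) CARD('d) a powr (1 / a)"]) auto
qed

end
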